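(* Fix $c>0$ and let $\mu(\cdot;k)$, $k\in(0,\sqrt c/2)$, be the smooth solitary waves (momentum densities) of the Novikov equation described in the context. The function $k\mapsto\mathcal{F}(\mu(\cdot;k))$ is strictly positive for $k\in(0,\sqrt c/2)$. In particular, for a wave $\mu=\mu(\cdot;k)$ whose associated operator $\mathcal{L}$ satisfies the spectral assumption (A) of the context, a sufficient condition for $$\left\langle\mathcal{L}^{-1}\frac{\delta\mathcal{F}}{\delta m}(\mu),\frac{\delta\mathcal{F}}{\delta m}(\mu)\right\rangle<0$$ to hold is that $$\frac{\partial}{\partial k}\mathcal{F}(\mu(\cdot;k))<0.$$
   Context: Setting: for fixed $c>0$ and $k\in(0,\sqrt c/2)$, set $a=k(c-k^2)^{3/2}$ and $E=\frac{k^2(c-2k^2)}{2c}$; $\phi=\phi(\cdot;k)$ denotes the unique nonconstant smooth even function on $\mathbb{R}$ with $\phi'(0)=0$, $\phi(x)\to k$ as $x\to\pm\infty$ (exponentially fast, together with decay of all derivatives), $\phi^2<c$, and $\phi-\phi''=a(c-\phi^2)^{-3/2}$; it satisfies $\frac12(\phi')^2=E+\frac12\phi^2-\frac{a\phi}{c\sqrt{c-\phi^2}}$, depends smoothly on $k$, and is the profile of a smooth solitary wave $u(x,t)=\phi(x-ct)$ of the Novikov equation $u_t-u_{xxt}=u^2u_{xxx}-4u^2u_x+3uu_xu_{xx}$. Put $\mu=\mu(\cdot;k)=\phi-\phi''>0$, $\omega_0=-9a^{-2/3}$, $\omega_1=9c\,a^{-4/3}(2E+c)$. The operator $\mathcal{L}$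 on $L^2(\mathbb{R})$ with domain $H^2(\mathbb{R})$ is $$\mathcal{L}=\frac23\left(-3\,\partial_x\left(\mu^{-8/3}\partial_x\right)+8\mu''\mu^{-11/3}-\frac{44}{3}(\mu')^2\mu^{-14/3}+15\mu^{-8/3}\right)-\frac{2\omega_1}{9}\mu^{-4/3}+2\omega_0(1-\partial_x^2)^{-1},$$ where $(1-\partial_x^2)^{-1}$ is convolution with $\frac12e^{-|x|}$. Spectral assumption (A): the spectrum of the symmetric operator $\mathcal{L}$ on $L^2(\mathbb{R})$ consists of a simple negative eigenvalue, a simple eigenvalue at $\lambda=0$ (whose eigenspace is then spanned by $\mu'$), and the rest of the spectrum is strictly positive and uniformly bounded away from $0$. For each $k$, $\mathcal{F}(m)=\int_{\mathbb{R}}(m(1-\partial_x^2)^{-1}m-k^2)\,dx-3k^{4/3}\int_{\mathbb{R}}(m^{2/3}-k^{2/3})\,dx$, with first variation $\frac{\delta\mathcal{F}}{\delta m}(\mu)=2(1-\partial_x^2)^{-1}\mu-2k^{4/3}\mu^{-1/3}$ at $\mu$; $\frac{\partial}{\partial k}\mathcal{F}(\mu(\cdot;k))$ is the total $k$-derivative (the functional $\mathcal{F}$ itself depends explicitly on $k$). Under (A), the even function $\frac{\delta\mathcal{F}}{\delta m}(\mu)$ lies in the range of $\mathcal{L}$, and $\mathcal{L}^{-1}\frac{\delta\mathcal{F}}{\delta m}(\mu)$ denotes a preimage (unique up to multiples of the odd function $\mu'$, which do not affect the inner product). $\langle\cdot,\cdot\rangle$ is the $L^2(\mathbb{R})$ inner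 product. *)

theory Defs
  imports "HOL-Analysis.Analysis"
begin

section \<open>Smooth solitary waves of the Novikov equation\<close>

definition smooth :: "(real \<Rightarrow> real) \<Rightarrow> bool" where
  "smooth f \<longleftrightarrow> (\<forall>n x. (deriv ^^ n) f field_differentiable (at x))"

text \<open>\<open>D i j\<close> is the mixed partial derivative of order \<open>i\<close> in the first and \<open>j\<close> in the second
  variable; existence and total differentiability of all of them on the open set \<open>U\<close> is
  \<open>u \<in> C\<^sup>\<infinity>(U)\<close>.\<close>

definition jointly_smooth_on :: "(real \<times> real) set \<Rightarrow> (real \<Rightarrow> real \<Rightarrow> real) \<Rightarrow> bool" where
  "jointly_smooth_on U u \<longleftrightarrow>
     (\<exists>D :: nat \<Rightarrow> nat \<Rightarrow> real \<times> real \<Rightarrow> real.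
        (\<forall>p\<in>U. D 0 0 p = u (fst p) (snd p)) \<and>
        (\<forall>i j. \<forall>p\<in>U. (D i j has_derivative
            (\<lambda>h. D (Suc i) j p * fst h + D i (Suc j) p * snd h)) (at p)))"

definition nov_a :: "real \<Rightarrow> real \<Rightarrow> real" where
  "nov_a c k = k * (c - k\<^sup>2) powr (3/2)"

definition nov_E :: "real \<Rightarrow> real \<Rightarrow> real" where
  "nov_E c k = k\<^sup>2 * (c - 2 * k\<^sup>2) / (2 * c)"

definition nov_omega0 :: "real \<Rightarrow> real \<Rightarrow> real" where
  "nov_omega0 c k = - 9 * nov_a c k powr (-2/3)"

definition nov_omega1 :: "real \<Rightarrow> real \<Rightarrow> real" where
  "nov_omega1 c k = 9 * c * nov_a c k powr (-4/3) * (2 * nov_E c k + c)"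

definition solitary_profile :: "real \<Rightarrow> real \<Rightarrow> (real \<Rightarrow> real) \<Rightarrow> bool" where
  "solitary_profile c k \<phi> \<longleftrightarrow>
     smooth \<phi> \<and> \<not> \<phi> constant_on UNIV \<and> (\<forall>x. \<phi> (- x) = \<phi> x) \<and> deriv \<phi> 0 = 0 \<and>
     (\<phi> \<longlongrightarrow> k) at_top \<and> (\<phi> \<longlongrightarrow> k) at_bot \<and>
     (\<exists>r>0. \<forall>n. \<exists>C. \<forall>x. \<bar>(deriv ^^ n) (\<lambda>y. \<phi> y - k) x\<bar> \<le> C * exp (- r * \<bar>x\<bar>)) \<and>
     (\<forall>x. (\<phi> x)\<^sup>2 < c) \<and>
     (\<forall>x. \<phi> x - deriv (deriv \<phi>) x = nov_a c k * (c - (\<phi> x)\<^sup>2) powr (-3/2))"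

definition momentum :: "(real \<Rightarrow> real) \<Rightarrow> real \<Rightarrow> real" where
  "momentum \<phi> x = \<phi> x - deriv (deriv \<phi>) x"

definition helmholtz_inv :: "(real \<Rightarrow> 'a::{banach, second_countable_topology}) \<Rightarrow> real \<Rightarrow> 'a" where
  "helmholtz_inv f x = (LINT y|lborel. (exp (- \<bar>x - y\<bar>) / 2) *\<^sub>R f y)"

definition nov_F :: "real \<Rightarrow> (real \<Rightarrow> real) \<Rightarrow> real" where
  "nov_F k m = (LINT x|lborel. m x * helmholtz_inv m x - k\<^sup>2)
     - 3 * k powr (4/3) * (LINT x|lborel. m x powr (2/3) - k powr (2/3))"

text \<open>The variational derivative of \<open>nov_F k\<close> at \<open>m\<close>.\<close>

definition nov_dF :: "real \<Rightarrow> (real \<Rightarrow> real) \<Rightarrow> real \<Rightarrow> real" where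
  "nov_dF k m x = 2 * helmholtz_inv m x - 2 * k powr (4/3) * m x powr (-1/3)"

section \<open>Unbounded operators on \<open>L\<^sup>2(\<real>)\<close>\<close>

text \<open>Elements of the complex space \<open>L\<^sup>2(\<real>)\<close> are represented by Borel functions, identified when
  they agree almost everywhere. An operator \<open>T\<close> is given by its graph: \<open>T f g\<close> says that \<open>f\<close> lies
  in the domain and \<open>T f = g\<close>.\<close>

definition L2 :: "(real \<Rightarrow> complex) set" where
  "L2 = {f \<in> borel_measurable lborel. integrable lborel (\<lambda>x. (norm (f x))\<^sup>2)}"

definition L2_inner :: "(real \<Rightarrow> complex) \<Rightarrow> (real \<Rightarrow> complex) \<Rightarrow> complex" where
  "L2_inner f g = (LINT x|lborel. f x * cnj (g x))"

definition L2_norm :: "(real \<Rightarrow> complex) \<Rightarrow> real" where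
  "L2_norm f = sqrt (LINT x|lborel. (norm (f x))\<^sup>2)"

definition test_function :: "(real \<Rightarrow> real) \<Rightarrow> bool" where
  "test_function \<psi> \<longleftrightarrow> smooth \<psi> \<and> (\<exists>R. \<forall>x. \<bar>x\<bar> > R \<longrightarrow> \<psi> x = 0)"

definition weak_deriv :: "(real \<Rightarrow> complex) \<Rightarrow> (real \<Rightarrow> complex) \<Rightarrow> bool" where
  "weak_deriv f g \<longleftrightarrow> f \<in> L2 \<and> g \<in> L2 \<and>
     (\<forall>\<psi>. test_function \<psi> \<longrightarrow>
        (LINT x|lborel. deriv \<psi> x *\<^sub>R f x) = - (LINT x|lborel. \<psi> x *\<^sub>R g x))"

definition H2 :: "(real \<Rightarrow> complex) set" where
  "H2 = {f. \<exists>f' f''. weak_deriv f f' \<and> weak_deriv f' f''}"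

definition resolvent_set :: "((real \<Rightarrow> complex) \<Rightarrow> (real \<Rightarrow> complex) \<Rightarrow> bool) \<Rightarrow> complex set" where
  "resolvent_set T = {z.
     (\<forall>f. T f (\<lambda>x. z * f x) \<longrightarrow> (AE x in lborel. f x = 0)) \<and>
     (\<exists>C. \<forall>g\<in>L2. \<exists>f. T f (\<lambda>x. g x + z * f x) \<and> L2_norm f \<le> C * L2_norm g)}"

definition op_spectrum :: "((real \<Rightarrow> complex) \<Rightarrow> (real \<Rightarrow> complex) \<Rightarrow> bool) \<Rightarrow> complex set" where
  "op_spectrum T = - resolvent_set T"

definition simple_eigenvalue ::
  "((real \<Rightarrow> complex) \<Rightarrow> (real \<Rightarrow> complex) \<Rightarrow> bool) \<Rightarrow> complex \<Rightarrow> bool" where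
  "simple_eigenvalue T z \<longleftrightarrow>
     (\<exists>f. T f (\<lambda>x. z * f x) \<and> \<not> (AE x in lborel. f x = 0) \<and>
        (\<forall>g. T g (\<lambda>x. z * g x) \<longrightarrow> (\<exists>b. AE x in lborel. g x = b * f x)))"

definition spectral_assumption :: "((real \<Rightarrow> complex) \<Rightarrow> (real \<Rightarrow> complex) \<Rightarrow> bool) \<Rightarrow> bool" where
  "spectral_assumption T \<longleftrightarrow>
     (\<exists>\<nu> \<delta> :: real. \<nu> < 0 \<and> \<delta> > 0 \<and>
        simple_eigenvalue T (complex_of_real \<nu>) \<and> simple_eigenvalue T 0 \<and>
        (\<forall>z \<in> op_spectrum T - {complex_of_real \<nu>, 0}. z \<in> \<real> \<and> Re z \<ge> \<delta>))"

section \<open>The linearized operator\<close>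

text \<open>In \<open>nov_L c k \<mu> f g\<close>, \<open>f'\<close> is the weak derivative of \<open>f\<close> and \<open>h = (\<mu>\<^bsup>-8/3\<^esup> f')'\<close>.\<close>

definition nov_L ::
  "real \<Rightarrow> real \<Rightarrow> (real \<Rightarrow> real) \<Rightarrow> (real \<Rightarrow> complex) \<Rightarrow> (real \<Rightarrow> complex) \<Rightarrow> bool" where
  "nov_L c k \<mu> f g \<longleftrightarrow> f \<in> H2 \<and> g \<in> L2 \<and>
     (\<exists>f' h. weak_deriv f f' \<and> weak_deriv (\<lambda>x. (\<mu> x powr (-8/3)) *\<^sub>R f' x) h \<and>
       (AE x in lborel. g x =
          (2/3) *\<^sub>R ((-3) *\<^sub>R h x
             + (8 * deriv (deriv \<mu>) x * \<mu> x powr (-11/3)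
                - 44/3 * (deriv \<mu> x)\<^sup>2 * \<mu> x powr (-14/3)
                + 15 * \<mu> x powr (-8/3)) *\<^sub>R f x)
          - (2 * nov_omega1 c k / 9 * \<mu> x powr (-4/3)) *\<^sub>R f x
          + (2 * nov_omega0 c k) *\<^sub>R helmholtz_inv f x))"

end

theory Submission
  imports Defs
begin

text \<open>
  With \<open>\<sigma> = sqrt (c - \<phi>\<^sup>2)\<close>, \<open>t = \<phi> / \<sigma>\<close>, \<open>b = k / sqrt (c - k\<^sup>2)\<close> and \<open>q\<^sup>2 = 1 - b\<^sup>2 - 2 b t\<close> (\<open>q\<close> odd in \<open>x\<close>) the
  first integral of the profile equation becomes the polynomial system
  \<open>t' = (1 + t\<^sup>2) (b - t) q / (1 + b\<^sup>2)\<close>, \<open>q' = b (1 + t\<^sup>2) (t - b) / (1 + b\<^sup>2)\<close>, in which \<open>\<mu>'/\<mu>\<close> is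
  polynomial as well. The integrand of the functional is a positive multiple of
  \<open>(t - b) ((t - b)\<^sup>2 + 1 - 3 b\<^sup>2)\<close>, hence positive, and has an elementary primitive in \<open>b\<close> and \<open>q\<close>; so the
  functional is elementary in \<open>k\<close>.

  Differentiating the first integral in \<open>k\<close> gives, for \<open>v = \<phi>\<^sub>k - \<phi> / k\<close>, the Wronskian
  \<open>\<phi>' v' - \<phi>'' v = - (a / (k c)) (t - b)\<^sup>2 (t + 2 b)\<close>, which is \<open>O(\<phi>'\<^sup>2)\<close> at infinity; hence \<open>v / \<phi>'\<close> grows at most
  linearly and \<open>v\<close> decays exponentially. So \<open>f = v - v'' = \<mu>\<^sub>k - \<mu> / k\<close> lies in the domain of the operator.
  Differentiating the Euler--Lagrange equation of \<open>\<mu>\<close> in \<open>k\<close> and using its homogeneity, \<open>f\<close> is mapped to a positive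
  multiple of the variational derivative, and \<open>\<langle>f, \<delta>F\<rangle> = F'(k) - 2 F(k) / k\<close>. Any other preimage differs by a
  multiple of the odd function \<open>\<mu>'\<close>, because \<open>0\<close> is a simple eigenvalue.
\<close>

section \<open>Bounded and exponentially decaying functions\<close>

definition exp_decay :: "(real \<Rightarrow> real) \<Rightarrow> bool" where
  "exp_decay f \<longleftrightarrow> (\<exists>r>0. \<exists>C. \<forall>x. \<bar>f x\<bar> \<le> C * exp (- r * \<bar>x\<bar>))"

named_theorems decay_intros

lemma exp_decayI: "r > 0 \<Longrightarrow> (\<And>x. \<bar>f x\<bar> \<le> C * exp (- r * \<bar>x\<bar>)) \<Longrightarrow> exp_decay f"
  by (auto simp: exp_decay_def)

lemma exp_decayE:
  assumes "exp_decay f"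
  obtains r C where "r > 0" "C \<ge> 0" "\<And>x. \<bar>f x\<bar> \<le> C * exp (- r * \<bar>x\<bar>)"
proof -
  from assms obtain r C where bound: "r > 0" "\<And>x. \<bar>f x\<bar> \<le> C * exp (- r * \<bar>x\<bar>)"
    by (auto simp: exp_decay_def)
  moreover have "C \<ge> 0" using bound(2)[of 0] by simp
  ultimately show ?thesis using that by blast
qed

lemma exp_decay_common_rate:
  assumes "exp_decay f" "exp_decay g"
  obtains r C where "r > 0" "C \<ge> 0"
    "\<And>x. \<bar>f x\<bar> \<le> C * exp (- r * \<bar>x\<bar>)" "\<And>x. \<bar>g x\<bar> \<le> C * exp (- r * \<bar>x\<bar>)"
proof -
  obtain r A where f: "r > 0" "A \<ge> 0" "\<And>x. \<bar>f x\<bar> \<le> A * exp (- r * \<bar>x\<bar>)"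
    using assms(1) by (rule exp_decayE) blast
  obtain s B where g: "s > 0" "B \<ge> 0" "\<And>x. \<bar>g x\<bar> \<le> B * exp (- s * \<bar>x\<bar>)"
    using assms(2) by (rule exp_decayE) blast
  show ?thesis
  proof (rule that[of "min r s" "max A B"])
    fix x :: real
    have "exp (- r * \<bar>x\<bar>) \<le> exp (- min r s * \<bar>x\<bar>)" "exp (- s * \<bar>x\<bar>) \<le> exp (- min r s * \<bar>x\<bar>)"
      by (auto intro!: mult_right_mono)
    then have "A * exp (- r * \<bar>x\<bar>) \<le> max A B * exp (- min r s * \<bar>x\<bar>)"
      and "B * exp (- s * \<bar>x\<bar>) \<le> max A B * exp (- min r s * \<bar>x\<bar>)"
      using f(2) g(2) by (auto intro!: mult_mono)
    then show "\<bar>f x\<bar> \<le> max A B * exp (- min r s * \<bar>x\<bar>)" "\<bar>g x\<bar> \<le> max A B * exp (- min r s * \<bar>x\<bar>)"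
      using f(3)[of x] g(3)[of x] by linarith+
  qed (use f g in auto)
qed

lemma bounded_range_const [decay_intros]: "bounded (range (\<lambda>x :: real. c :: real))"
  by simp

lemma bounded_range_mult [decay_intros]:
  fixes f g :: "real \<Rightarrow> real"
  assumes "bounded (range f)" "bounded (range g)" shows "bounded (range (\<lambda>x. f x * g x))"
proof -
  obtain A B where "\<And>x. \<bar>f x\<bar> \<le> A" "\<And>x. \<bar>g x\<bar> \<le> B"
    using assms by (auto simp: bounded_iff)
  then have "\<bar>f x * g x\<bar> \<le> A * B" for x
    unfolding abs_mult by (intro mult_mono) (auto intro: order_trans[OF abs_ge_zero])
  then show ?thesis by (auto simp: bounded_iff)
qed

lemma bounded_range_inverse:
  fixes f :: "real \<Rightarrow> real"
  assumes "l > 0" "\<And>x. l \<le> f x" shows "bounded (range (\<lambda>x. inverse (f x)))"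
proof -
  have "\<bar>inverse (f x)\<bar> \<le> inverse l" for x
    using assms(1) assms(2)[of x] by (simp add: le_imp_inverse_le)
  then show ?thesis by (auto simp: bounded_iff)
qed

lemma bounded_range_powr:
  fixes f :: "real \<Rightarrow> real"
  assumes "l > 0" "\<And>x. l \<le> f x" "\<And>x. f x \<le> u" shows "bounded (range (\<lambda>x. f x powr e))"
proof -
  have "\<bar>f x powr e\<bar> \<le> max (l powr e) (u powr e)" for x
  proof (cases "e \<ge> 0")
    case True
    then have "f x powr e \<le> u powr e"
      using assms(1,3) assms(2)[of x] by (intro powr_mono2) auto
    then show ?thesis by simp
  next
    case False
    then have "f x powr e \<le> l powr e" using assms(1,2) by (intro powr_mono2') auto
    then show ?thesis by simp
  qed
  then show ?thesis by (auto simp: bounded_iff)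
qed

lemmas [decay_intros] = bounded_plus_comp bounded_minus_comp

lemma exp_decay_imp_bounded: assumes "exp_decay f" shows "bounded (range f)"
proof -
  obtain r C where f: "r > 0" "C \<ge> 0" "\<And>x. \<bar>f x\<bar> \<le> C * exp (- r * \<bar>x\<bar>)"
    using assms by (rule exp_decayE) blast
  have "C * exp (- r * \<bar>x\<bar>) \<le> C" for x using f(1,2) by (intro mult_left_le) auto
  with f(3) have "\<bar>f x\<bar> \<le> C" for x by (meson order_trans)
  then show ?thesis by (auto simp: bounded_iff)
qed

lemma exp_decay_zero [decay_intros]: "exp_decay (\<lambda>x. 0)"
  by (rule exp_decayI[of 1 _ 0]) auto

lemma exp_decay_add [decay_intros]:
  assumes "exp_decay f" "exp_decay g" shows "exp_decay (\<lambda>x. f x + g x)"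
proof -
  obtain r C where fg: "r > 0" "\<And>x. \<bar>f x\<bar> \<le> C * exp (- r * \<bar>x\<bar>)" "\<And>x. \<bar>g x\<bar> \<le> C * exp (- r * \<bar>x\<bar>)"
    using assms by (rule exp_decay_common_rate) blast
  have "\<bar>f x + g x\<bar> \<le> (2 * C) * exp (- r * \<bar>x\<bar>)" for x using fg(2)[of x] fg(3)[of x] by linarith
  with fg(1) show ?thesis by (rule exp_decayI)
qed

lemma exp_decay_diff [decay_intros]:
  "exp_decay f \<Longrightarrow> exp_decay g \<Longrightarrow> exp_decay (\<lambda>x. f x - g x)"
  using exp_decay_add[of f "\<lambda>x. - g x"] by (simp add: exp_decay_def)

lemma exp_decay_mult_linear:
  assumes "exp_decay f" "\<And>x. \<bar>g x\<bar> \<le> B * (1 + \<bar>x\<bar>)" shows "exp_decay (\<lambda>x. f x * g x)"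
proof -
  obtain r C where f: "r > 0" "C \<ge> 0" "\<And>x. \<bar>f x\<bar> \<le> C * exp (- r * \<bar>x\<bar>)"
    using assms(1) by (rule exp_decayE) blast
  have "B \<ge> 0" using assms(2)[of 0] by simp
  show ?thesis
  proof (rule exp_decayI[of "r/2" _ "C * B * (1 + 2/r)"])
    fix x :: real
    have "r/2 * \<bar>x\<bar> \<le> exp (r/2 * \<bar>x\<bar>)" using exp_ge_add_one_self[of "r/2 * \<bar>x\<bar>"] by linarith
    then have "\<bar>x\<bar> \<le> 2/r * exp (r/2 * \<bar>x\<bar>)" using f(1) by (simp add: field_simps)
    moreover have "1 \<le> exp (r/2 * \<bar>x\<bar>)" using f(1) by simp
    ultimately have linear_le_exp: "1 + \<bar>x\<bar> \<le> (1 + 2/r) * exp (r/2 * \<bar>x\<bar>)"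
      unfolding distrib_right by linarith
    have "\<bar>f x * g x\<bar> \<le> (C * exp (- r * \<bar>x\<bar>)) * (B * (1 + \<bar>x\<bar>))"
      unfolding abs_mult using f assms(2) by (intro mult_mono) auto
    also have "\<dots> \<le> (C * exp (- r * \<bar>x\<bar>)) * (B * ((1 + 2/r) * exp (r/2 * \<bar>x\<bar>)))"
      using f \<open>B \<ge> 0\<close> linear_le_exp by (intro mult_left_mono) auto
    also have "\<dots> = C * B * (1 + 2/r) * (exp (- r * \<bar>x\<bar>) * exp (r/2 * \<bar>x\<bar>))" by simp
    also have "exp (- r * \<bar>x\<bar>) * exp (r/2 * \<bar>x\<bar>) = exp (- (r/2) * \<bar>x\<bar>)"
      by (subst exp_add[symmetric]) (simp add: field_simps)
    finally show "\<bar>f x * g x\<bar> \<le> C * B * (1 + 2/r) * exp (- (r/2) * \<bar>x\<bar>)" .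
  qed (use f in auto)
qed

lemma exp_decay_mult_right [decay_intros]:
  assumes "exp_decay f" "bounded (range g)" shows "exp_decay (\<lambda>x. f x * g x)"
proof -
  obtain B where B: "\<And>x. \<bar>g x\<bar> \<le> B" using assms(2) by (auto simp: bounded_iff)
  have "B \<ge> 0" using B[of 0] by simp
  then have "\<bar>g x\<bar> \<le> B * (1 + \<bar>x\<bar>)" for x
    using B[of x] mult_left_mono[of 1 "1 + \<bar>x\<bar>" B] by simp
  then show ?thesis using exp_decay_mult_linear assms(1) by blast
qed

lemma exp_decay_mult_left [decay_intros]:
  "bounded (range g) \<Longrightarrow> exp_decay f \<Longrightarrow> exp_decay (\<lambda>x. g x * f x)"
  using exp_decay_mult_right[of f g] by (simp add: mult.commute)

lemma exp_decay_reflect: "exp_decay f \<Longrightarrow> exp_decay (\<lambda>x. f (- x))"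
  by (simp add: exp_decay_def) (metis abs_minus_cancel)

lemma exp_decay_tendsto_top:
  assumes "exp_decay f" shows "(f \<longlongrightarrow> 0) at_top"
proof -
  obtain r C where f: "r > 0" "\<And>x. \<bar>f x\<bar> \<le> C * exp (- r * \<bar>x\<bar>)"
    using assms by (rule exp_decayE) blast
  have "filterlim (\<lambda>x::real. r * \<bar>x\<bar>) at_top at_top"
    by (intro filterlim_tendsto_pos_mult_at_top[OF tendsto_const f(1)] filterlim_abs_real)
  then have "((\<lambda>x. C * exp (- r * \<bar>x\<bar>)) \<longlongrightarrow> C * 0) at_top"
    by (intro tendsto_intros filterlim_compose[OF exp_at_bot]) (simp add: filterlim_uminus_at_bot)
  then show ?thesis by (intro Lim_null_comparison[where f=f]) (use f in auto)
qed

lemma exp_decay_tendsto_bot: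
  assumes "exp_decay f" shows "(f \<longlongrightarrow> 0) at_bot"
  using exp_decay_tendsto_top[OF exp_decay_reflect[OF assms]]
  by (simp add: filterlim_at_bot_mirror)

lemma exp_decay_outside_compact:
  assumes "continuous_on UNIV f" "exp_decay g" "\<And>x. \<bar>x\<bar> > R \<Longrightarrow> \<bar>f x\<bar> \<le> \<bar>g x\<bar>"
  shows "exp_decay f"
proof -
  obtain r C where g: "r > 0" "C \<ge> 0" "\<And>x. \<bar>g x\<bar> \<le> C * exp (- r * \<bar>x\<bar>)"
    using assms(2) by (rule exp_decayE) blast
  have "compact (f ` {-R..R})"
    by (intro compact_continuous_image continuous_on_subset[OF assms(1)]) auto
  then obtain B where B: "\<And>x. x \<in> {-R..R} \<Longrightarrow> \<bar>f x\<bar> \<le> B"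
    using compact_imp_bounded[of "f ` {-R..R}"] unfolding bounded_iff by (metis imageI real_norm_def)
  show ?thesis
  proof (rule exp_decayI[OF g(1), of _ "\<bar>B\<bar> * exp (r * R) + C"])
    fix x
    show "\<bar>f x\<bar> \<le> (\<bar>B\<bar> * exp (r * R) + C) * exp (- r * \<bar>x\<bar>)"
    proof (cases "\<bar>x\<bar> \<le> R")
      case True
      then have "\<bar>f x\<bar> \<le> \<bar>B\<bar>" by (intro order_trans[OF B abs_ge_self]) auto
      also have "\<bar>B\<bar> \<le> \<bar>B\<bar> * (exp (r * R) * exp (- r * \<bar>x\<bar>))"
        using True g(1) by (intro mult_le_cancel_left1[THEN iffD2]) (simp add: exp_add[symmetric])
      also have "\<dots> \<le> (\<bar>B\<bar> * exp (r * R) + C) * exp (- r * \<bar>x\<bar>)"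
        using g(2) by (simp add: distrib_right)
      finally show ?thesis .
    next
      case False
      then have "\<bar>f x\<bar> \<le> C * exp (- r * \<bar>x\<bar>)" using assms(3)[of x] g(3)[of x] by linarith
      also have "\<dots> \<le> (\<bar>B\<bar> * exp (r * R) + C) * exp (- r * \<bar>x\<bar>)" by (simp add: distrib_right)
      finally show ?thesis .
    qed
  qed
qed

lemma exp_decay_interpolate:
  assumes deriv_v: "\<And>x. (v has_real_derivative v' x) (at x)"
    and deriv_v': "\<And>x. (v' has_real_derivative v'' x) (at x)"
    and decay: "exp_decay v" "exp_decay v''"
  shows "exp_decay v'"
proof -
  obtain r C where "r > 0" "C \<ge> 0"
    and v: "\<And>x. \<bar>v x\<bar> \<le> C * exp (- r * \<bar>x\<bar>)" and v'': "\<And>x. \<bar>v'' x\<bar> \<le> C * exp (- r * \<bar>x\<bar>)"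
    using decay by (rule exp_decay_common_rate) blast
  have shift: "C * exp (- r * \<bar>y\<bar>) \<le> C * exp r * exp (- r * \<bar>x\<bar>)" if "\<bar>y - x\<bar> \<le> 1" for x y :: real
  proof -
    have "r * \<bar>x\<bar> \<le> r * (\<bar>y\<bar> + 1)" using \<open>r > 0\<close> that by (intro mult_left_mono) auto
    then have "exp (- r * \<bar>y\<bar>) \<le> exp r * exp (- r * \<bar>x\<bar>)"
      by (simp add: exp_add[symmetric] algebra_simps)
    then show ?thesis using \<open>C \<ge> 0\<close> by (simp add: mult_left_mono mult.assoc)
  qed
  show ?thesis
  proof (rule exp_decayI[OF \<open>r > 0\<close>])
    fix x :: real
    obtain z where z: "x < z" "z < x + 1" "v (x + 1) - v x = (x + 1 - x) * v' z"
      using MVT2[of x "x + 1" v v'] deriv_v by auto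
    obtain y where y: "x < y" "y < z" "v' z - v' x = (z - x) * v'' y"
      using MVT2[of x z v' v''] deriv_v' z by auto
    have "v' x = v (x + 1) - v x - (z - x) * v'' y" using z y by simp
    moreover have "\<bar>(z - x) * v'' y\<bar> \<le> 1 * \<bar>v'' y\<bar>"
      unfolding abs_mult using z by (intro mult_right_mono) auto
    ultimately have "\<bar>v' x\<bar> \<le> \<bar>v (x + 1)\<bar> + \<bar>v x\<bar> + \<bar>v'' y\<bar>" by linarith
    moreover have "\<bar>v (x + 1)\<bar> \<le> C * exp r * exp (- r * \<bar>x\<bar>)" "\<bar>v x\<bar> \<le> C * exp r * exp (- r * \<bar>x\<bar>)"
      "\<bar>v'' y\<bar> \<le> C * exp r * exp (- r * \<bar>x\<bar>)"
      by (rule order_trans[OF v shift] order_trans[OF v'' shift]; use y z in simp)+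
    ultimately show "\<bar>v' x\<bar> \<le> (3 * (C * exp r)) * exp (- r * \<bar>x\<bar>)" by linarith
  qed
qed

text \<open>Reduction of order: the Wronskian bound says that the quotient \<open>v / f\<close> has a bounded derivative.\<close>

lemma Wronskian_quotient_linear_growth:
  assumes deriv_v: "\<And>x. (v has_real_derivative v' x) (at x)" and deriv_f: "\<And>x. (f has_real_derivative f' x) (at x)"
    and nz: "\<And>x. x \<ge> 1 \<Longrightarrow> f x \<noteq> 0"
    and Wronskian: "\<And>x. x \<ge> 1 \<Longrightarrow> \<bar>f x * v' x - f' x * v x\<bar> \<le> B * (f x)\<^sup>2"
  obtains M where "M \<ge> 0" "\<And>x. x \<ge> 1 \<Longrightarrow> \<bar>v x / f x\<bar> \<le> M * (1 + \<bar>x\<bar>)"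
proof -
  define h where "h x = v x / f x" for x
  have deriv_h: "(h has_real_derivative (f x * v' x - f' x * v x) / (f x)\<^sup>2) (at x)" if "x \<ge> 1" for x
    unfolding h_def[abs_def]
    using DERIV_divide[OF deriv_v deriv_f nz[OF that]] by (simp add: power2_eq_square mult.commute)
  have "0 \<le> B * (f 1)\<^sup>2" using Wronskian[of 1] by (intro order_trans[OF abs_ge_zero]) auto
  then have "B \<ge> 0" using nz[of 1] by (simp add: zero_le_mult_iff)
  have "\<bar>h x\<bar> \<le> (\<bar>h 1\<bar> + B) * (1 + \<bar>x\<bar>)" if "x \<ge> 1" for x
  proof -
    have "\<bar>h x - h 1\<bar> \<le> B * \<bar>x - 1\<bar>"
    proof (rule field_differentiable_bound[of "{1..}" h _ B x 1, unfolded real_norm_def])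
      fix z :: real assume "z \<in> {1..}"
      then have "z \<ge> 1" by simp
      show "(h has_real_derivative (f z * v' z - f' z * v z) / (f z)\<^sup>2) (at z within {1..})"
        using deriv_h[OF \<open>z \<ge> 1\<close>] by (rule has_field_derivative_at_within)
      show "\<bar>(f z * v' z - f' z * v z) / (f z)\<^sup>2\<bar> \<le> B"
        using Wronskian[OF \<open>z \<ge> 1\<close>] nz[OF \<open>z \<ge> 1\<close>] by (simp add: divide_le_eq)
    qed (use that in auto)
    then have "\<bar>h x\<bar> \<le> \<bar>h 1\<bar> + B * \<bar>x\<bar>" using that \<open>B \<ge> 0\<close> by (auto simp: algebra_simps)
    also have "\<dots> \<le> (\<bar>h 1\<bar> + B) * (1 + \<bar>x\<bar>)" using \<open>B \<ge> 0\<close> by (simp add: algebra_simps)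
    finally show ?thesis .
  qed
  with \<open>B \<ge> 0\<close> show ?thesis unfolding h_def by (intro that[of "\<bar>v 1 / f 1\<bar> + B"]) auto
qed

lemma exp_decay_Wronskian:
  assumes deriv_v: "\<And>x. (v has_real_derivative v' x) (at x)" and even: "\<And>x. v (- x) = v x"
    and deriv_f: "\<And>x. (f has_real_derivative f' x) (at x)" and "exp_decay f"
    and nz: "\<And>x. x \<ge> 1 \<Longrightarrow> f x \<noteq> 0"
    and Wronskian: "\<And>x. x \<ge> 1 \<Longrightarrow> \<bar>f x * v' x - f' x * v x\<bar> \<le> B * (f x)\<^sup>2"
  shows "exp_decay v"
proof -
  obtain M where "M \<ge> 0" and quotient: "\<And>x. x \<ge> 1 \<Longrightarrow> \<bar>v x / f x\<bar> \<le> M * (1 + \<bar>x\<bar>)"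
    using Wronskian_quotient_linear_growth[OF deriv_v deriv_f nz Wronskian] by blast
  have "exp_decay (\<lambda>x. f \<bar>x\<bar>)"
    using \<open>exp_decay f\<close> unfolding exp_decay_def by (metis abs_idempotent)
  then have "exp_decay (\<lambda>x. f \<bar>x\<bar> * (M * (1 + \<bar>x\<bar>)))"
    by (rule exp_decay_mult_linear[where B=M]) (use \<open>M \<ge> 0\<close> in \<open>simp add: abs_mult\<close>)
  then show ?thesis
  proof (rule exp_decay_outside_compact[of v _ 1, rotated])
    show "continuous_on UNIV v"
      using deriv_v by (blast intro: DERIV_continuous_on has_field_derivative_at_within)
    fix x :: real assume "\<bar>x\<bar> > 1"
    then have "\<bar>v x\<bar> = \<bar>f \<bar>x\<bar>\<bar> * \<bar>v \<bar>x\<bar> / f \<bar>x\<bar>\<bar>"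
      using nz[of "\<bar>x\<bar>"] even[of x] unfolding abs_mult[symmetric] by (simp add: abs_if)
    also have "\<dots> \<le> \<bar>f \<bar>x\<bar>\<bar> * (M * (1 + \<bar>x\<bar>))"
      using quotient[of "\<bar>x\<bar>"] \<open>\<bar>x\<bar> > 1\<close> by (intro mult_left_mono) auto
    also have "\<dots> = \<bar>f \<bar>x\<bar> * (M * (1 + \<bar>x\<bar>))\<bar>" using \<open>M \<ge> 0\<close> by (simp add: abs_mult)
    finally show "\<bar>v x\<bar> \<le> \<bar>f \<bar>x\<bar> * (M * (1 + \<bar>x\<bar>))\<bar>" .
  qed
qed

subsection \<open>Conditions on all derivatives up to a given order\<close>

primrec derivs_upto :: "((real \<Rightarrow> real) \<Rightarrow> bool) \<Rightarrow> nat \<Rightarrow> (real \<Rightarrow> real) \<Rightarrow> bool" where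
  "derivs_upto P 0 f \<longleftrightarrow> P f"
| "derivs_upto P (Suc n) f \<longleftrightarrow>
     P f \<and> (\<exists>f'. (\<forall>x. (f has_real_derivative f' x) (at x)) \<and> derivs_upto P n f')"

abbreviation bounded_derivs :: "nat \<Rightarrow> (real \<Rightarrow> real) \<Rightarrow> bool" where
  "bounded_derivs \<equiv> derivs_upto (\<lambda>f. bounded (range f))"

abbreviation decaying_derivs :: "nat \<Rightarrow> (real \<Rightarrow> real) \<Rightarrow> bool" where
  "decaying_derivs \<equiv> derivs_upto exp_decay"

lemma derivs_upto_zero: "derivs_upto P n f \<Longrightarrow> P f"
  by (cases n) auto

lemma derivs_upto_SucI:
  "P f \<Longrightarrow> (\<And>x. (f has_real_derivative f' x) (at x)) \<Longrightarrow> derivs_upto P n f' \<Longrightarrow> derivs_upto P (Suc n) f"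
  by auto

lemma derivs_upto_SucD: "derivs_upto P (Suc n) f \<Longrightarrow> derivs_upto P n f"
  by (induction n arbitrary: f) auto

lemma derivs_upto_deriv:
  assumes "derivs_upto P (Suc n) f" "\<And>x. (f has_real_derivative f' x) (at x)"
  shows "derivs_upto P n f'"
proof -
  obtain g where g: "\<And>x. (f has_real_derivative g x) (at x)" "derivs_upto P n g"
    using assms(1) by auto
  have "f' = g" using DERIV_unique[OF assms(2) g(1)] by (rule ext)
  then show ?thesis using g(2) by simp
qed

lemma derivs_upto_add:
  assumes P_add: "\<And>f g. P f \<Longrightarrow> P g \<Longrightarrow> P (\<lambda>x. f x + g x)"
  shows "derivs_upto P n f \<Longrightarrow> derivs_upto P n g \<Longrightarrow> derivs_upto P n (\<lambda>x. f x + g x)"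
proof (induction n arbitrary: f g)
  case 0
  then show ?case by (simp add: P_add)
next
  case (Suc n)
  then obtain f' g' where "\<And>x. (f has_real_derivative f' x) (at x)" "derivs_upto P n f'"
    "\<And>x. (g has_real_derivative g' x) (at x)" "derivs_upto P n g'"
    by auto
  then show ?case
    using Suc.prems by (intro derivs_upto_SucI[where f'="\<lambda>x. f' x + g' x"] DERIV_add Suc.IH P_add) auto
qed

lemma derivs_upto_mult:
  assumes P_add: "\<And>f g. P f \<Longrightarrow> P g \<Longrightarrow> P (\<lambda>x. f x + g x)"
    and PR_mult: "\<And>f g. P f \<Longrightarrow> R g \<Longrightarrow> P (\<lambda>x. f x * g x)"
  shows "derivs_upto P n f \<Longrightarrow> derivs_upto R n g \<Longrightarrow> derivs_upto P n (\<lambda>x. f x * g x)"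
proof (induction n arbitrary: f g)
  case 0
  then show ?case by (simp add: PR_mult)
next
  case (Suc n)
  then obtain f' g' where f': "\<And>x. (f has_real_derivative f' x) (at x)" "derivs_upto P n f'"
    and g': "\<And>x. (g has_real_derivative g' x) (at x)" "derivs_upto R n g'"
    by auto
  show ?case
  proof (rule derivs_upto_SucI)
    show "P (\<lambda>x. f x * g x)" using Suc.prems by (auto intro: PR_mult)
    show "((\<lambda>x. f x * g x) has_real_derivative f' x * g x + f x * g' x) (at x)" for x
      using DERIV_mult[OF f'(1) g'(1)] by (simp add: mult.commute)
    show "derivs_upto P n (\<lambda>x. f' x * g x + f x * g' x)"
      using f'(2) g'(2) Suc.prems[THEN derivs_upto_SucD]
      by (intro derivs_upto_add P_add Suc.IH)
  qed
qed

lemma bounded_derivs_const [decay_intros]: "bounded_derivs n (\<lambda>x. c)"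
proof (induction n arbitrary: c)
  case (Suc n)
  then show ?case by (intro derivs_upto_SucI[where f'="\<lambda>x. 0"]) auto
qed simp

lemma bounded_derivs_add [decay_intros]:
  "bounded_derivs n f \<Longrightarrow> bounded_derivs n g \<Longrightarrow> bounded_derivs n (\<lambda>x. f x + g x)"
  by (rule derivs_upto_add) (rule bounded_plus_comp)

lemma bounded_derivs_mult [decay_intros]:
  "bounded_derivs n f \<Longrightarrow> bounded_derivs n g \<Longrightarrow> bounded_derivs n (\<lambda>x. f x * g x)"
  by (rule derivs_upto_mult[where R="\<lambda>f. bounded (range f)"])
     (rule bounded_plus_comp bounded_range_mult; assumption)+

lemma bounded_derivs_diff [decay_intros]:
  "bounded_derivs n f \<Longrightarrow> bounded_derivs n g \<Longrightarrow> bounded_derivs n (\<lambda>x. f x - g x)"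
  using bounded_derivs_add[OF _ bounded_derivs_mult[OF bounded_derivs_const[of n "-1"]], of f g] by simp

lemma bounded_derivs_power [decay_intros]: "bounded_derivs n f \<Longrightarrow> bounded_derivs n (\<lambda>x. f x ^ m)"
  by (induction m) (auto intro: decay_intros simp del: derivs_upto.simps)

lemma bounded_derivs_divide_const [decay_intros]: "bounded_derivs n f \<Longrightarrow> bounded_derivs n (\<lambda>x. f x / c)"
  unfolding divide_inverse by (intro decay_intros)

lemma decaying_derivs_add [decay_intros]:
  "decaying_derivs n f \<Longrightarrow> decaying_derivs n g \<Longrightarrow> decaying_derivs n (\<lambda>x. f x + g x)"
  by (rule derivs_upto_add) (rule exp_decay_add)

lemma decaying_derivs_mult_right [decay_intros]:
  "decaying_derivs n f \<Longrightarrow> bounded_derivs n g \<Longrightarrow> decaying_derivs n (\<lambda>x. f x * g x)"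
  by (rule derivs_upto_mult) (rule exp_decay_add exp_decay_mult_right; assumption)+

lemma decaying_derivs_mult_left [decay_intros]:
  "bounded_derivs n g \<Longrightarrow> decaying_derivs n f \<Longrightarrow> decaying_derivs n (\<lambda>x. g x * f x)"
  using decaying_derivs_mult_right[of n f g] by (simp add: mult.commute)

lemma decaying_derivs_imp_bounded: "decaying_derivs n f \<Longrightarrow> bounded_derivs n f"
proof (induction n arbitrary: f)
  case (Suc n)
  then show ?case by (auto intro: exp_decay_imp_bounded)
qed (simp add: exp_decay_imp_bounded)

lemma bounded_derivs_linear_ODE:
  assumes "bounded (range u)" "\<And>x. (u has_real_derivative g x * u x) (at x)" "\<And>n. bounded_derivs n g"
  shows "bounded_derivs n u"
proof (induction n)
  case (Suc n)
  then show ?case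
    by (intro derivs_upto_SucI[where f'="\<lambda>x. g x * u x"] assms(2) bounded_derivs_mult) (simp_all add: assms(1,3))
qed (simp add: assms(1))

lemma decaying_derivs_linear_ODE:
  assumes "exp_decay u" "\<And>x. (u has_real_derivative g x * u x) (at x)" "\<And>n. bounded_derivs n g"
  shows "decaying_derivs n u"
proof (induction n)
  case (Suc n)
  then show ?case
    by (intro derivs_upto_SucI[where f'="\<lambda>x. g x * u x"] assms(2) decaying_derivs_mult_left)
       (simp_all add: assms(1,3))
qed (simp add: assms(1))

section \<open>Smooth functions\<close>

lemma DERIV_continuous_on_UNIV:
  fixes f :: "real \<Rightarrow> real"
  shows "(\<And>x. (f has_real_derivative f' x) (at x)) \<Longrightarrow> continuous_on A f"
  by (blast intro: DERIV_continuous_on has_field_derivative_at_within)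

lemma smooth_DERIV_funpow:
  assumes "smooth f"
  shows "((deriv ^^ n) f has_real_derivative (deriv ^^ Suc n) f x) (at x)"
  using assms by (simp add: smooth_def DERIV_deriv_iff_field_differentiable)

lemma smooth_DERIV: "smooth f \<Longrightarrow> (f has_real_derivative deriv f x) (at x)"
  using smooth_DERIV_funpow[of f 0] by simp

lemma smooth_deriv: "smooth f \<Longrightarrow> smooth (deriv f)"
  unfolding smooth_def by (metis funpow_swap1 funpow.simps(2) comp_apply)

lemma smooth_continuous_on: "smooth f \<Longrightarrow> continuous_on A f"
  by (rule DERIV_continuous_on_UNIV) (rule smooth_DERIV)

lemma derivs_upto_Suc_smooth:
  assumes "smooth f" shows "derivs_upto P (Suc n) f \<longleftrightarrow> P f \<and> derivs_upto P n (deriv f)"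
  using derivs_upto_deriv[OF _ smooth_DERIV[OF assms]] derivs_upto_SucI[OF _ smooth_DERIV[OF assms]]
  by (metis derivs_upto_zero)

lemma funpow_deriv_lincomb:
  assumes "smooth f" "smooth g"
  shows "(deriv ^^ n) (\<lambda>x. a * f x + b * g x) = (\<lambda>x. a * (deriv ^^ n) f x + b * (deriv ^^ n) g x)"
proof (induction n)
  case (Suc n)
  have "((\<lambda>x. a * (deriv ^^ n) f x + b * (deriv ^^ n) g x) has_real_derivative
      a * (deriv ^^ Suc n) f x + b * (deriv ^^ Suc n) g x) (at x)" for x
    by (intro DERIV_add DERIV_cmult smooth_DERIV_funpow assms)
  then show ?case using Suc by (auto intro: DERIV_imp_deriv)
qed simp

lemma smooth_lincomb:
  assumes "smooth f" "smooth g" shows "smooth (\<lambda>x. a * f x + b * g x)"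
  unfolding smooth_def funpow_deriv_lincomb[OF assms]
  using assms by (auto intro!: derivative_intros simp: smooth_def)

lemma smooth_momentum: "smooth u \<Longrightarrow> smooth (momentum u)"
  using smooth_lincomb[of u "deriv (deriv u)" 1 "-1"] by (simp add: smooth_deriv momentum_def[abs_def])

lemma deriv_momentum: "smooth u \<Longrightarrow> deriv (momentum u) = momentum (deriv u)"
  using funpow_deriv_lincomb[of u "deriv (deriv u)" 1 1 "-1"]
  by (simp add: smooth_deriv momentum_def[abs_def])

subsection \<open>Joint smoothness\<close>

definition partial1 :: "(real \<Rightarrow> real \<Rightarrow> real) \<Rightarrow> real \<Rightarrow> real \<Rightarrow> real" where
  "partial1 u k x = deriv (\<lambda>\<kappa>. u \<kappa> x) k"

lemma jointly_smooth_onE: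
  assumes "jointly_smooth_on (S \<times> UNIV) u" "open S"
  obtains D where "\<And>i j. jointly_smooth_on (S \<times> UNIV) (\<lambda>k x. D i j (k, x))"
    "\<And>k x. k \<in> S \<Longrightarrow> D 0 0 (k, x) = u k x"
    "\<And>i j k x. k \<in> S \<Longrightarrow> isCont (D i j) (k, x)"
    "\<And>i j k x. k \<in> S \<Longrightarrow> ((\<lambda>\<kappa>. D i j (\<kappa>, x)) has_real_derivative D (Suc i) j (k, x)) (at k)"
    "\<And>i j k x. k \<in> S \<Longrightarrow> ((\<lambda>y. D i j (k, y)) has_real_derivative D i (Suc j) (k, x)) (at x)"
proof -
  obtain D :: "nat \<Rightarrow> nat \<Rightarrow> real \<times> real \<Rightarrow> real" where D: "\<And>p. p \<in> S \<times> UNIV \<Longrightarrow> D 0 0 p = u (fst p) (snd p)"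
    and deriv_D: "\<And>i j p. p \<in> S \<times> UNIV \<Longrightarrow>
       (D i j has_derivative (\<lambda>h. D (Suc i) j p * fst h + D i (Suc j) p * snd h)) (at p)"
    using assms(1) unfolding jointly_smooth_on_def by blast
  show ?thesis
  proof (rule that)
    fix i j k x assume "k \<in> S"
    then have deriv_D: "(D i j has_derivative
        (\<lambda>h. D (Suc i) j (k, x) * fst h + D i (Suc j) (k, x) * snd h)) (at (k, x))"
      by (intro deriv_D) simp
    then show "isCont (D i j) (k, x)" by (rule has_derivative_continuous)
    have "((\<lambda>\<kappa>. (\<kappa>, x)) has_derivative (\<lambda>h. (h, 0))) (at k)"
      and "((\<lambda>y. (k, y)) has_derivative (\<lambda>h. (0, h))) (at x)"
      by (auto intro!: derivative_eq_intros)
    from this[THEN has_derivative_compose, OF deriv_D]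
    show "((\<lambda>\<kappa>. D i j (\<kappa>, x)) has_real_derivative D (Suc i) j (k, x)) (at k)"
      and "((\<lambda>y. D i j (k, y)) has_real_derivative D i (Suc j) (k, x)) (at x)"
      by (simp_all add: has_field_derivative_def)
  next
    show "jointly_smooth_on (S \<times> UNIV) (\<lambda>k x. D i j (k, x))" for i j
      unfolding jointly_smooth_on_def using deriv_D
      by (intro exI[of _ "\<lambda>m n. D (i + m) (j + n)"]) simp
  qed (use D in auto)
qed

lemma jointly_smooth_on_cong:
  "(\<And>k x. k \<in> S \<Longrightarrow> u k x = v k x) \<Longrightarrow> jointly_smooth_on (S \<times> UNIV) u \<longleftrightarrow> jointly_smooth_on (S \<times> UNIV) v"
  by (simp add: jointly_smooth_on_def)

lemma jointly_smooth_on_diff: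
  assumes "jointly_smooth_on U u" "jointly_smooth_on U v"
  shows "jointly_smooth_on U (\<lambda>k x. u k x - v k x)"
proof -
  obtain D :: "nat \<Rightarrow> nat \<Rightarrow> real \<times> real \<Rightarrow> real" where D: "\<forall>p\<in>U. D 0 0 p = u (fst p) (snd p)"
    and deriv_D: "\<forall>i j. \<forall>p\<in>U. (D i j has_derivative (\<lambda>h. D (Suc i) j p * fst h + D i (Suc j) p * snd h)) (at p)"
    using assms(1) unfolding jointly_smooth_on_def by blast
  obtain E :: "nat \<Rightarrow> nat \<Rightarrow> real \<times> real \<Rightarrow> real" where E: "\<forall>p\<in>U. E 0 0 p = v (fst p) (snd p)"
    and deriv_E: "\<forall>i j. \<forall>p\<in>U. (E i j has_derivative (\<lambda>h. E (Suc i) j p * fst h + E i (Suc j) p * snd h)) (at p)"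
    using assms(2) unfolding jointly_smooth_on_def by blast
  show ?thesis
    unfolding jointly_smooth_on_def
  proof (intro exI[of _ "\<lambda>i j p. D i j p - E i j p"] conjI allI ballI)
    fix i j p assume "p \<in> U"
    then show "((\<lambda>p. D i j p - E i j p) has_derivative
        (\<lambda>h. (D (Suc i) j p - E (Suc i) j p) * fst h + (D i (Suc j) p - E i (Suc j) p) * snd h)) (at p)"
      using has_derivative_diff[OF deriv_D[rule_format] deriv_E[rule_format], of p i j i j]
      by (simp add: algebra_simps)
  qed (use D E in simp)
qed

locale jointly_smooth =
  fixes S :: "real set" and u :: "real \<Rightarrow> real \<Rightarrow> real"
  assumes open_S: "open S" and joint: "jointly_smooth_on (S \<times> UNIV) u"
begin

lemma DERIV_partial1: "k \<in> S \<Longrightarrow> ((\<lambda>\<kappa>. u \<kappa> x) has_real_derivative partial1 u k x) (at k)"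
  and jointly_smooth_partial1: "jointly_smooth_on (S \<times> UNIV) (partial1 u)"
  and DERIV_space: "k \<in> S \<Longrightarrow> (u k has_real_derivative deriv (u k) x) (at x)"
  and jointly_smooth_deriv: "jointly_smooth_on (S \<times> UNIV) (\<lambda>k. deriv (u k))"
  and continuous_on_joint: "continuous_on (S \<times> A) (\<lambda>(k, x). u k x)"
  and partial1_deriv: "k \<in> S \<Longrightarrow> partial1 (\<lambda>\<kappa>. deriv (u \<kappa>)) k = deriv (partial1 u k)"
proof -
  obtain D where D: "\<And>i j. jointly_smooth_on (S \<times> UNIV) (\<lambda>k x. D i j (k, x))"
    "\<And>k x. k \<in> S \<Longrightarrow> D 0 0 (k, x) = u k x"
    "\<And>i j k x. k \<in> S \<Longrightarrow> isCont (D i j) (k, x)"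
    and D_k: "\<And>i j k x. k \<in> S \<Longrightarrow> ((\<lambda>\<kappa>. D i j (\<kappa>, x)) has_real_derivative D (Suc i) j (k, x)) (at k)"
    and D_x: "\<And>i j k x. k \<in> S \<Longrightarrow> ((\<lambda>y. D i j (k, y)) has_real_derivative D i (Suc j) (k, x)) (at x)"
    by (rule jointly_smooth_onE[OF joint open_S]) blast
  have u_k: "((\<lambda>\<kappa>. u \<kappa> x) has_real_derivative D 1 0 (k, x)) (at k)" if "k \<in> S" for k x
    using has_field_derivative_transform_within_open[OF D_k[OF that, of 0 0 x] open_S that] D(2) by simp
  then have partial1_eq: "partial1 u k x = D 1 0 (k, x)" if "k \<in> S" for k x
    using that unfolding partial1_def by (metis DERIV_imp_deriv)
  show "k \<in> S \<Longrightarrow> ((\<lambda>\<kappa>. u \<kappa> x) has_real_derivative partial1 u k x) (at k)"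
    using u_k partial1_eq by simp
  have u_x: "(u k has_real_derivative D 0 1 (k, x)) (at x)" if "k \<in> S" for k x
    using D_x[OF that, of 0 0 x] D(2)[OF that] by simp
  then have deriv_eq: "deriv (u k) x = D 0 1 (k, x)" if "k \<in> S" for k x
    using that by (metis DERIV_imp_deriv)
  show "k \<in> S \<Longrightarrow> (u k has_real_derivative deriv (u k) x) (at x)"
    using u_x deriv_eq by simp
  show "jointly_smooth_on (S \<times> UNIV) (partial1 u)" "jointly_smooth_on (S \<times> UNIV) (\<lambda>k. deriv (u k))"
    using D(1)[of 1 0] D(1)[of 0 1] partial1_eq deriv_eq by (auto cong: jointly_smooth_on_cong)
  have "continuous_on (S \<times> A) (D 0 0)"
    using D(3) by (intro continuous_at_imp_continuous_on) auto
  then show "continuous_on (S \<times> A) (\<lambda>(k, x). u k x)"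
    by (rule continuous_on_eq) (use D(2) in auto)
  assume k: "k \<in> S"
  have xk: "((\<lambda>\<kappa>. deriv (u \<kappa>) x) has_real_derivative D 1 1 (k, x)) (at k)" for x
    using has_field_derivative_transform_within_open[OF D_k[OF k, of 0 1 x] open_S k] deriv_eq by simp
  have kx: "(partial1 u k has_real_derivative D 1 1 (k, x)) (at x)" for x
    using D_x[OF k, of 1 0 x] partial1_eq[OF k, abs_def] by simp
  show "partial1 (\<lambda>\<kappa>. deriv (u \<kappa>)) k = deriv (partial1 u k)"
    unfolding partial1_def[of "\<lambda>\<kappa>. deriv (u \<kappa>)"] DERIV_imp_deriv[OF xk]
    using DERIV_imp_deriv[OF kx] by (intro ext) (rule sym)
qed

end

lemma jointly_smooth_funpow_deriv:
  "jointly_smooth S u \<Longrightarrow> jointly_smooth S (\<lambda>k. (deriv ^^ n) (u k))"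
proof (induction n)
  case (Suc n)
  then interpret jointly_smooth S "\<lambda>k. (deriv ^^ n) (u k)" by simp
  show ?case using jointly_smooth_deriv open_S by (simp add: jointly_smooth_def)
qed simp

context jointly_smooth
begin

lemma smooth: "k \<in> S \<Longrightarrow> smooth (u k)"
  using jointly_smooth.DERIV_space[OF jointly_smooth_funpow_deriv[OF jointly_smooth_axioms]]
  by (auto simp: smooth_def field_differentiable_def)

lemma jointly_smooth_momentum: "jointly_smooth S (\<lambda>k. momentum (u k))"
  using jointly_smooth_on_diff[OF joint] jointly_smooth_funpow_deriv[OF jointly_smooth_axioms, of 2] open_S
  by (simp add: jointly_smooth_def momentum_def[abs_def] numeral_2_eq_2)

lemma partial1_funpow_deriv:
  assumes "k \<in> S"
  shows "partial1 (\<lambda>\<kappa>. (deriv ^^ n) (u \<kappa>)) k = (deriv ^^ n) (partial1 u k)"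
proof (induction n)
  case (Suc n)
  show ?case
    using jointly_smooth.partial1_deriv[OF jointly_smooth_funpow_deriv[OF jointly_smooth_axioms] assms, of n] Suc
    by simp
qed simp

lemma DERIV_partial1_funpow_deriv:
  assumes "k \<in> S"
  shows "((\<lambda>\<kappa>. (deriv ^^ n) (u \<kappa>) x) has_real_derivative (deriv ^^ n) (partial1 u k) x) (at k)"
  using jointly_smooth.DERIV_partial1[OF jointly_smooth_funpow_deriv[OF jointly_smooth_axioms] assms]
  by (simp add: partial1_funpow_deriv[OF assms, symmetric])

lemma partial1_momentum:
  assumes "k \<in> S"
  shows "partial1 (\<lambda>\<kappa>. momentum (u \<kappa>)) k = momentum (partial1 u k)"
proof (rule ext)
  fix x
  have "((\<lambda>\<kappa>. (deriv ^^ 0) (u \<kappa>) x - (deriv ^^ 2) (u \<kappa>) x) has_real_derivative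
      (deriv ^^ 0) (partial1 u k) x - (deriv ^^ 2) (partial1 u k) x) (at k)"
    by (intro DERIV_diff DERIV_partial1_funpow_deriv assms)
  then show "partial1 (\<lambda>\<kappa>. momentum (u \<kappa>)) k x = momentum (partial1 u k) x"
    by (simp add: partial1_def[of "\<lambda>\<kappa>. momentum (u \<kappa>)"] momentum_def numeral_2_eq_2 DERIV_imp_deriv)
qed

end

lemma DERIV_param_primitive:
  fixes g :: "real \<Rightarrow> real \<Rightarrow> real"
  assumes S: "open S" "convex S" "k \<in> S"
    and primitive: "\<And>\<kappa> x. \<kappa> \<in> S \<Longrightarrow> (G \<kappa> has_real_derivative g \<kappa> x) (at x)"
    and deriv_g: "\<And>\<kappa> x. \<kappa> \<in> S \<Longrightarrow> ((\<lambda>\<kappa>. g \<kappa> x) has_real_derivative g' \<kappa> x) (at \<kappa>)"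
    and cont: "continuous_on (S \<times> UNIV) (\<lambda>(\<kappa>, x). g' \<kappa> x)"
    and deriv_G: "\<And>x. ((\<lambda>\<kappa>. G \<kappa> x) has_real_derivative G' x) (at k)"
  shows "(G' has_real_derivative g' k x) (at x)"
proof -
  have integral_g': "integral {\<alpha>..\<beta>} (g' k) = G' \<beta> - G' \<alpha>" if "\<alpha> \<le> \<beta>" for \<alpha> \<beta>
  proof -
    have FTC: "(g \<kappa> has_integral G \<kappa> \<beta> - G \<kappa> \<alpha>) {\<alpha>..\<beta>}" if "\<kappa> \<in> S" for \<kappa>
      using primitive[OF that] \<open>\<alpha> \<le> \<beta>\<close>
      by (intro fundamental_theorem_of_calculus)
         (auto simp: has_real_derivative_iff_has_vector_derivative[symmetric]
               intro: has_field_derivative_at_within)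
    have "((\<lambda>\<kappa>. integral (cbox \<alpha> \<beta>) (g \<kappa>)) has_real_derivative integral (cbox \<alpha> \<beta>) (g' k)) (at k within S)"
    proof (rule leibniz_rule_field_derivative)
      show "((\<lambda>\<kappa>. g \<kappa> x) has_real_derivative g' \<kappa> x) (at \<kappa> within S)" if "\<kappa> \<in> S" for \<kappa> x
        using deriv_g[OF that] by (rule has_field_derivative_at_within)
      show "g \<kappa> integrable_on cbox \<alpha> \<beta>" if "\<kappa> \<in> S" for \<kappa> using FTC[OF that] by auto
      show "continuous_on (S \<times> cbox \<alpha> \<beta>) (\<lambda>(\<kappa>, x). g' \<kappa> x)"
        using cont by (rule continuous_on_subset) auto
    qed (use S in auto)
    then have "((\<lambda>\<kappa>. integral {\<alpha>..\<beta>} (g \<kappa>)) has_real_derivative integral {\<alpha>..\<beta>} (g' k)) (at k)"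
      by (simp add: at_within_open[OF S(3,1)])
    then have "((\<lambda>\<kappa>. G \<kappa> \<beta> - G \<kappa> \<alpha>) has_real_derivative integral {\<alpha>..\<beta>} (g' k)) (at k)"
      by (rule has_field_derivative_transform_within_open[OF _ S(1,3)]) (rule integral_unique[OF FTC])
    then show ?thesis by (rule DERIV_unique) (intro DERIV_diff deriv_G)
  qed
  have "continuous_on UNIV (\<lambda>y. (\<lambda>(\<kappa>, x). g' \<kappa> x) (k, y))"
    by (rule continuous_on_compose2[OF cont]) (use S(3) in \<open>auto intro!: continuous_intros\<close>)
  then have "continuous_on {x - 1..x + 1} (g' k)" by (auto intro: continuous_on_subset)
  then have "((\<lambda>y. integral {x - 1..y} (g' k)) has_real_derivative g' k x) (at x within {x - 1..x + 1})"
    by (rule integral_has_real_derivative) auto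
  then have "((\<lambda>y. integral {x - 1..y} (g' k) + G' (x - 1)) has_real_derivative g' k x) (at x)"
    using DERIV_add[OF _ DERIV_const, of _ "g' k x" x UNIV "G' (x - 1)"] by (simp add: at_within_Icc_at)
  then show ?thesis
    by (rule has_field_derivative_transform_within_open[of _ _ _ "{x - 1<..}"]) (auto simp: integral_g')
qed

section \<open>Integration on the line\<close>

lemma integrable_exp_minus_abs:
  assumes "r > 0" shows "integrable lborel (\<lambda>x::real. exp (- r * \<bar>x\<bar>))"
proof -
  define g where "g = (\<lambda>x::real. indicator {0..} x *\<^sub>R exp (- r * x))"
  have "set_integrable lebesgue {0..} (\<lambda>x. exp (- r * x))"
    using assms
    by (intro nonnegative_absolutely_integrable_1 integrable_on_exp_minus_to_infinity) auto
  then have "integrable lborel g"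
    unfolding set_integrable_def g_def[symmetric] by (subst (asm) integrable_completion) (auto simp: g_def)
  moreover from this have "integrable lborel (\<lambda>x. g (0 + (-1) * x))"
    by (subst lborel_integrable_real_affine_iff) auto
  ultimately have "integrable lborel (\<lambda>x. g x + g (- x))" by simp
  then show ?thesis
    by (rule Bochner_Integration.integrable_bound) (auto simp: g_def indicator_def)
qed

lemma exp_decay_integrable:
  assumes "exp_decay f" "continuous_on UNIV f" shows "integrable lborel f"
proof -
  obtain r C where f: "r > 0" "C \<ge> 0" "\<And>x. \<bar>f x\<bar> \<le> C * exp (- r * \<bar>x\<bar>)"
    using assms(1) by (rule exp_decayE) blast
  have "integrable lborel (\<lambda>x. C * exp (- r * \<bar>x\<bar>))"
    using integrable_exp_minus_abs[OF f(1)] by simp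
  then show ?thesis
    by (rule Bochner_Integration.integrable_bound)
      (use f assms(2) in \<open>auto intro: borel_measurable_continuous_onI\<close>)
qed

lemma LINT_FTC_real:
  fixes F f :: "real \<Rightarrow> real"
  assumes "\<And>x. (F has_real_derivative f x) (at x)" "continuous_on UNIV f" "integrable lborel f"
    and "(F \<longlongrightarrow> l) at_top" "(F \<longlongrightarrow> m) at_bot"
  shows "(LINT x|lborel. f x) = l - m"
proof -
  have "(LBINT x=-\<infinity>..\<infinity>. f x) = l - m"
  proof (rule interval_integral_FTC_integrable)
    show "set_integrable lborel (einterval (-\<infinity>) \<infinity>) f" using assms(3) by (simp add: set_integrable_def)
    show "((F \<circ> real_of_ereal) \<longlongrightarrow> m) (at_right (-\<infinity>))" "((F \<circ> real_of_ereal) \<longlongrightarrow> l) (at_left \<infinity>)"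
      using assms(4,5) by (simp_all add: ereal_tendsto_simps)
  qed (use assms(1,2) in \<open>auto simp: has_real_derivative_iff_has_vector_derivative continuous_on_eq_continuous_at\<close>)
  then show ?thesis
    by (simp add: interval_lebesgue_integral_def set_lebesgue_integral_def)
qed

lemma LINT_FTC_lessThan:
  fixes F f :: "real \<Rightarrow> real"
  assumes "\<And>x. x \<le> a \<Longrightarrow> (F has_real_derivative f x) (at x)" "continuous_on UNIV f" "integrable lborel f"
    and "(F \<longlongrightarrow> m) at_bot"
  shows "(LINT x:{..<a}|lborel. f x) = F a - m"
proof -
  have "(LBINT x=-\<infinity>..ereal a. f x) = F a - m"
  proof (rule interval_integral_FTC_integrable)
    show "set_integrable lborel (einterval (-\<infinity>) (ereal a)) f"
      using assms(3) integrable_mult_indicator[of "{..<a}" lborel f] by (simp add: set_integrable_def)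
    have "isCont F a" using assms(1)[of a] by (auto intro: DERIV_isCont)
    then show "((F \<circ> real_of_ereal) \<longlongrightarrow> m) (at_right (-\<infinity>))"
      and "((F \<circ> real_of_ereal) \<longlongrightarrow> F a) (at_left (ereal a))"
      using assms(4) by (simp_all add: ereal_tendsto_simps isCont_def filterlim_at_split)
  qed (use assms(1,2) in \<open>auto simp: has_real_derivative_iff_has_vector_derivative continuous_on_eq_continuous_at\<close>)
  then show ?thesis by (simp add: interval_lebesgue_integral_def)
qed

lemma LINT_reflect:
  fixes f :: "real \<Rightarrow> 'a :: {banach, second_countable_topology}"
  shows "(LINT x|lborel. f (- x)) = (LINT x|lborel. f x)"
  using lborel_integral_real_affine[of "-1" f 0] by simp

lemma LINT_odd:
  fixes f :: "real \<Rightarrow> real"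
  assumes "\<And>x. f (- x) = - f x" shows "(LINT x|lborel. f x) = 0"
  using LINT_reflect[of f] by (simp add: assms)

lemma LINT_pos:
  fixes f :: "real \<Rightarrow> real"
  assumes "integrable lborel f" "\<And>x. f x > 0" shows "(LINT x|lborel. f x) > 0"
proof -
  have "(LINT x|lborel. f x) \<noteq> 0"
  proof
    assume "(LINT x|lborel. f x) = 0"
    then have "AE x in lborel. f x = 0"
      using integral_nonneg_eq_0_iff_AE[OF assms(1)] assms(2) by (simp add: less_imp_le)
    then have "AE x in (lborel :: real measure). False"
      by eventually_elim (use assms(2) in \<open>metis less_irrefl\<close>)
    then show False by (simp add: eventually_False ae_filter_eq_bot_iff)
  qed
  moreover have "(LINT x|lborel. f x) \<ge> 0"
    by (intro Bochner_Integration.integral_nonneg) (simp add: assms(2) less_imp_le)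
  ultimately show ?thesis by simp
qed

subsection \<open>The inverse of \<open>1 - \<partial>\<^sub>x\<^sup>2\<close>\<close>

lemma exp_decay_kernel: "exp_decay (\<lambda>y. exp (- \<bar>x - y\<bar>))"
proof (rule exp_decayI[of 1 _ "exp \<bar>x\<bar>"])
  fix y show "\<bar>exp (- \<bar>x - y\<bar>)\<bar> \<le> exp \<bar>x\<bar> * exp (- 1 * \<bar>y\<bar>)"
    by (simp add: exp_add[symmetric])
qed simp

lemma helmholtz_integrable:
  fixes f :: "real \<Rightarrow> real"
  assumes "bounded (range f)" "continuous_on UNIV f"
  shows "integrable lborel (\<lambda>y. exp (- \<bar>x - y\<bar>) * f y)"
  using assms by (intro exp_decay_integrable exp_decay_mult_right exp_decay_kernel continuous_intros)

lemma bounded_derivs_2D: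
  assumes "smooth u" "bounded_derivs 2 u"
  shows "bounded (range u)" "bounded (range (deriv u))" "bounded (range (momentum u))"
  unfolding momentum_def[abs_def] using assms smooth_deriv[OF assms(1)]
  by (simp_all add: numeral_2_eq_2 derivs_upto_Suc_smooth del: derivs_upto.simps(2))
     (simp_all add: bounded_minus_comp)

text \<open>The sign \<open>s\<close> covers the half-lines on both sides of \<open>x\<close>.\<close>

lemma DERIV_half_line_primitive:
  fixes s :: real
  assumes "s * s = 1" "smooth u" "y \<le> s * x"
  shows "((\<lambda>y. exp (y - s * x) * (u (s * y) - s * deriv u (s * y))) has_real_derivative
    exp (- \<bar>s * x - y\<bar>) * momentum u (s * y)) (at y)"
proof -
  have inner: "((\<lambda>y. s * y) has_real_derivative s) (at y)" by (auto intro!: derivative_eq_intros)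
  have "((\<lambda>y. exp (y - s * x) * (u (s * y) - s * deriv u (s * y))) has_real_derivative
      exp (y - s * x) * (u (s * y) - s * deriv u (s * y))
      + (deriv u (s * y) * s - s * (deriv (deriv u) (s * y) * s)) * exp (y - s * x)) (at y)"
    by (intro DERIV_mult DERIV_diff DERIV_cmult DERIV_chain2[OF smooth_DERIV inner] smooth_deriv \<open>smooth u\<close>)
       (auto intro!: derivative_eq_intros)
  moreover have "s * (deriv (deriv u) (s * y) * s) = deriv (deriv u) (s * y)" using \<open>s * s = 1\<close> by algebra
  then have "exp (y - s * x) * (u (s * y) - s * deriv u (s * y))
      + (deriv u (s * y) * s - s * (deriv (deriv u) (s * y) * s)) * exp (y - s * x)
      = exp (- \<bar>s * x - y\<bar>) * momentum u (s * y)"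
    using \<open>y \<le> s * x\<close> by (simp only: momentum_def) (simp add: algebra_simps)
  ultimately show ?thesis by simp
qed

lemma LINT_momentum_half_line:
  fixes s :: real
  assumes s: "s * s = 1" and u: "smooth u" "bounded_derivs 2 u"
  shows "(LINT y:{..<s * x}|lborel. exp (- \<bar>s * x - y\<bar>) * momentum u (s * y)) = u x - s * deriv u x"
proof -
  have bounded: "bounded (range (\<lambda>y. f (s * y)))" if "bounded (range f)" for f :: "real \<Rightarrow> real"
    using that by (auto simp: bounded_iff)
  define F where "F y = exp (y - s * x) * (u (s * y) - s * deriv u (s * y))" for y
  have "(LINT y:{..<s * x}|lborel. exp (- \<bar>s * x - y\<bar>) * momentum u (s * y)) = F (s * x) - 0"
  proof (rule LINT_FTC_lessThan)
    show "(F has_real_derivative exp (- \<bar>s * x - y\<bar>) * momentum u (s * y)) (at y)" if "y \<le> s * x" for y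
      unfolding F_def[abs_def] by (rule DERIV_half_line_primitive[OF s u(1) that])
    have momentum_cont: "continuous_on A (\<lambda>y. momentum u (s * y))" for A
      by (intro continuous_on_compose2[OF smooth_continuous_on[OF smooth_momentum[OF u(1)], of UNIV]])
         (auto intro!: continuous_intros)
    then show "continuous_on UNIV (\<lambda>y. exp (- \<bar>s * x - y\<bar>) * momentum u (s * y))" by (intro continuous_intros)
    show "integrable lborel (\<lambda>y. exp (- \<bar>s * x - y\<bar>) * momentum u (s * y))"
      by (rule helmholtz_integrable[OF bounded[OF bounded_derivs_2D(3)[OF u]] momentum_cont])
    have "exp_decay (\<lambda>y. exp (- \<bar>s * x - y\<bar>) * (u (s * y) - s * deriv u (s * y)))"
      by (intro exp_decay_mult_right exp_decay_kernel bounded_minus_comp bounded_range_mult bounded_range_const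
          bounded[OF bounded_derivs_2D(1)[OF u]] bounded[OF bounded_derivs_2D(2)[OF u]])
    then have "((\<lambda>y. exp (- \<bar>s * x - y\<bar>) * (u (s * y) - s * deriv u (s * y))) \<longlongrightarrow> 0) at_bot"
      by (rule exp_decay_tendsto_bot)
    moreover have "\<forall>\<^sub>F y in at_bot. exp (- \<bar>s * x - y\<bar>) * (u (s * y) - s * deriv u (s * y)) = F y"
      using eventually_le_at_bot[of "s * x"] by eventually_elim (simp add: F_def)
    ultimately show "(F \<longlongrightarrow> 0) at_bot"
      by (rule Lim_transform_eventually)
  qed
  moreover have "s * (s * x) = x" using s by algebra
  ultimately show ?thesis by (simp add: F_def)
qed

lemma helmholtz_inv_momentum:
  assumes u: "smooth u" "bounded_derivs 2 u"
  shows "helmholtz_inv (momentum u) x = u x"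
proof -
  define g where "g y = exp (- \<bar>x - y\<bar>) * momentum u y" for y
  have "integrable lborel g"
    unfolding g_def[abs_def] using u
    by (intro helmholtz_integrable bounded_derivs_2D smooth_continuous_on smooth_momentum)
  then have left_integrable: "integrable lborel (\<lambda>y. indicator {..<x} y * g y)"
    and right_integrable: "integrable lborel (\<lambda>y. indicator {x<..} y * g y)"
    using integrable_mult_indicator[of _ lborel g] by simp_all
  have left: "(LINT y|lborel. indicator {..<x} y * g y) = u x - deriv u x"
    using LINT_momentum_half_line[OF _ u, of 1 x] by (simp add: set_lebesgue_integral_def g_def)
  have "(LINT y|lborel. indicator {x<..} y * g y) = (LINT y|lborel. indicator {x<..} (- y) * g (- y))"
    by (rule LINT_reflect[symmetric])
  also have "\<dots> = (LINT y|lborel. indicator {..<- x} y * g (- y))"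
    by (intro Bochner_Integration.integral_cong) (auto simp: indicator_def)
  also have "\<dots> = u x + deriv u x"
    using LINT_momentum_half_line[OF _ u, of "-1" x]
    by (simp add: set_lebesgue_integral_def g_def abs_minus_commute add.commute)
  finally have right: "(LINT y|lborel. indicator {x<..} y * g y) = u x + deriv u x" .
  have "AE y in lborel. g y = indicator {..<x} y * g y + indicator {x<..} y * g y"
    using AE_lborel_singleton[of x] by eventually_elim (auto simp: indicator_def)
  then have "(LINT y|lborel. g y) = (LINT y|lborel. indicator {..<x} y * g y + indicator {x<..} y * g y)"
    using \<open>integrable lborel g\<close> by (intro integral_cong_AE) auto
  also have "\<dots> = 2 * u x" using left_integrable right_integrable by (simp add: left right)
  finally show ?thesis by (simp add: helmholtz_inv_def g_def)
qed

lemma LINT_momentum_symmetric: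
  assumes u: "smooth u" "bounded_derivs 2 u" and v: "smooth v" "decaying_derivs 2 v"
  shows "integrable lborel (\<lambda>x. u x * momentum v x - momentum u x * v x)"
    and "(LINT x|lborel. u x * momentum v x - momentum u x * v x) = 0"
proof -
  have v_decay: "exp_decay v" "exp_decay (deriv v)" "exp_decay (momentum v)"
    unfolding momentum_def[abs_def] using v smooth_deriv[OF v(1)]
    by (simp_all add: numeral_2_eq_2 derivs_upto_Suc_smooth del: derivs_upto.simps(2))
       (simp_all add: exp_decay_diff)
  note bounded = bounded_derivs_2D[OF u]
  have cont: "continuous_on UNIV (\<lambda>x. u x * momentum v x - momentum u x * v x)"
    by (intro continuous_intros smooth_continuous_on smooth_momentum u(1) v(1))
  show integrable: "integrable lborel (\<lambda>x. u x * momentum v x - momentum u x * v x)"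
    by (intro exp_decay_integrable cont exp_decay_diff exp_decay_mult_left bounded v_decay)
  have "(LINT x|lborel. u x * momentum v x - momentum u x * v x) = 0 - 0"
  proof (rule LINT_FTC_real)
    show "((\<lambda>x. deriv u x * v x - u x * deriv v x) has_real_derivative
        u x * momentum v x - momentum u x * v x) (at x)" for x
      unfolding momentum_def
      by (auto intro!: derivative_eq_intros smooth_DERIV smooth_deriv u(1) v(1) simp: algebra_simps)
    have "exp_decay (\<lambda>x. deriv u x * v x - u x * deriv v x)"
      by (intro exp_decay_diff exp_decay_mult_left bounded v_decay)
    then show "((\<lambda>x. deriv u x * v x - u x * deriv v x) \<longlongrightarrow> 0) at_top"
      "((\<lambda>x. deriv u x * v x - u x * deriv v x) \<longlongrightarrow> 0) at_bot"
      by (rule exp_decay_tendsto_top exp_decay_tendsto_bot)+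
  qed (fact cont integrable)+
  then show "(LINT x|lborel. u x * momentum v x - momentum u x * v x) = 0" by simp
qed

section \<open>The operator on classical functions\<close>

lemma test_functionD:
  assumes "test_function \<psi>"
  shows "smooth \<psi>" "exp_decay \<psi>" "exp_decay (deriv \<psi>)"
proof -
  show smooth: "smooth \<psi>" using assms by (simp add: test_function_def)
  obtain R where R: "\<And>x. \<bar>x\<bar> > R \<Longrightarrow> \<psi> x = 0" using assms by (auto simp: test_function_def)
  have "deriv \<psi> x = 0" if "\<bar>x\<bar> > R" for x
  proof -
    have "open {x. \<bar>x\<bar> > R}" by (intro open_Collect_less continuous_intros)
    then have "\<forall>\<^sub>F y in nhds x. \<psi> y = 0"
      using that R by (intro eventually_nhds_in_open[THEN eventually_mono, of "{x. \<bar>x\<bar> > R}"]) auto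
    then have "deriv \<psi> x = deriv (\<lambda>_. 0) x" by (rule deriv_cong_ev) simp
    then show ?thesis by simp
  qed
  with R show "exp_decay \<psi>" "exp_decay (deriv \<psi>)"
    using exp_decay_outside_compact[OF smooth_continuous_on exp_decay_zero, of _ R] smooth smooth_deriv by simp_all
qed

lemma exp_decay_L2:
  assumes "exp_decay f" "continuous_on UNIV f" shows "(\<lambda>x. complex_of_real (f x)) \<in> L2"
proof -
  have "integrable lborel (\<lambda>x. f x * f x)"
    using assms by (intro exp_decay_integrable decay_intros continuous_intros exp_decay_imp_bounded) auto
  moreover have "f \<in> borel_measurable borel" using assms(2) by (rule borel_measurable_continuous_onI)
  ultimately show ?thesis by (simp add: L2_def power2_eq_square)
qed

lemma weak_deriv_classical:
  assumes deriv_f: "\<And>x. (f has_real_derivative f' x) (at x)" and cont: "continuous_on UNIV f'"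
    and decay: "exp_decay f" "exp_decay f'"
  shows "weak_deriv (\<lambda>x. complex_of_real (f x)) (\<lambda>x. complex_of_real (f' x))"
proof -
  have cont_f: "continuous_on UNIV f" using deriv_f by (rule DERIV_continuous_on_UNIV)
  have "(LINT x|lborel. deriv \<psi> x *\<^sub>R complex_of_real (f x)) = - (LINT x|lborel. \<psi> x *\<^sub>R complex_of_real (f' x))"
    if "test_function \<psi>" for \<psi>
  proof -
    note \<psi> = test_functionD[OF that]
    note cont_intros = continuous_intros cont cont_f smooth_continuous_on \<psi>(1) smooth_deriv
    have integrable: "integrable lborel (\<lambda>x. deriv \<psi> x * f x)" "integrable lborel (\<lambda>x. \<psi> x * f' x)"
      by (intro exp_decay_integrable exp_decay_mult_right \<psi> exp_decay_imp_bounded decay cont_intros)+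
    have "exp_decay (\<lambda>x. \<psi> x * f x)" by (intro exp_decay_mult_right \<psi> exp_decay_imp_bounded decay)
    then have "(LINT x|lborel. deriv \<psi> x * f x + \<psi> x * f' x) = 0 - 0"
      using integrable
      by (intro LINT_FTC_real[where F="\<lambda>x. \<psi> x * f x"] exp_decay_tendsto_top exp_decay_tendsto_bot cont_intros)
         (auto intro!: derivative_eq_intros deriv_f smooth_DERIV \<psi>)
    then have "(LINT x|lborel. deriv \<psi> x * f x) = - (LINT x|lborel. \<psi> x * f' x)"
      using integrable by simp
    then have "complex_of_real (LINT x|lborel. deriv \<psi> x * f x) = - complex_of_real (LINT x|lborel. \<psi> x * f' x)"
      by simp
    then show ?thesis unfolding integral_complex_of_real[symmetric] by (simp add: scaleR_conv_of_real)
  qed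
  then show ?thesis unfolding weak_deriv_def using decay cont cont_f by (auto intro: exp_decay_L2)
qed

lemma helmholtz_inv_of_real:
  "helmholtz_inv (\<lambda>x. complex_of_real (f x)) x = complex_of_real (helmholtz_inv f x)"
  unfolding helmholtz_inv_def
  by (subst integral_complex_of_real[symmetric]) (simp add: scaleR_conv_of_real)

definition nov_L_expr ::
  "real \<Rightarrow> real \<Rightarrow> (real \<Rightarrow> real) \<Rightarrow> (real \<Rightarrow> complex) \<Rightarrow> (real \<Rightarrow> complex) \<Rightarrow> real \<Rightarrow> complex" where
  "nov_L_expr c k \<mu> f h x =
     (2/3) *\<^sub>R ((-3) *\<^sub>R h x
       + (8 * deriv (deriv \<mu>) x * \<mu> x powr (-11/3)
          - 44/3 * (deriv \<mu> x)\<^sup>2 * \<mu> x powr (-14/3)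
          + 15 * \<mu> x powr (-8/3)) *\<^sub>R f x)
     - (2 * nov_omega1 c k / 9 * \<mu> x powr (-4/3)) *\<^sub>R f x
     + (2 * nov_omega0 c k) *\<^sub>R helmholtz_inv f x"

lemma nov_L_iff:
  "nov_L c k \<mu> f g \<longleftrightarrow> f \<in> H2 \<and> g \<in> L2 \<and>
     (\<exists>f' h. weak_deriv f f' \<and> weak_deriv (\<lambda>x. (\<mu> x powr (-8/3)) *\<^sub>R f' x) h \<and>
       (AE x in lborel. g x = nov_L_expr c k \<mu> f h x))"
  by (simp add: nov_L_def nov_L_expr_def)

text \<open>Arguments: \<open>m, m\<^sub>1, m\<^sub>2\<close> stand for \<open>\<mu>, \<mu>', \<mu>''\<close> at a point, \<open>f, f\<^sub>1, f\<^sub>2\<close> for \<open>f, f', f''\<close>, and \<open>p\<close>, \<open>u\<close> for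
  \<open>(1 - \<partial>\<^sub>x\<^sup>2)\<^sup>-\<^sup>1\<close> applied to \<open>\<mu>\<close> and \<open>f\<close>.\<close>

definition euler_lagrange :: "real \<Rightarrow> real \<Rightarrow> real \<Rightarrow> real \<Rightarrow> real \<Rightarrow> real \<Rightarrow> real" where
  "euler_lagrange \<omega>\<^sub>0 \<omega>\<^sub>1 m m\<^sub>1 m\<^sub>2 p =
     8/3 * m powr (-11/3) * m\<^sub>1\<^sup>2 - 2 * m powr (-8/3) * m\<^sub>2 - 6 * m powr (-5/3)
     + 2/3 * \<omega>\<^sub>1 * m powr (-1/3) + 2 * \<omega>\<^sub>0 * p"

definition linearized_EL ::
  "real \<Rightarrow> real \<Rightarrow> real \<Rightarrow> real \<Rightarrow> real \<Rightarrow> real \<Rightarrow> real \<Rightarrow> real \<Rightarrow> real \<Rightarrow> real" where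
  "linearized_EL \<omega>\<^sub>0 \<omega>\<^sub>1 m m\<^sub>1 m\<^sub>2 f f\<^sub>1 f\<^sub>2 u =
     2/3 * (- 3 * (m powr (-8/3) * f\<^sub>2 - 8/3 * m powr (-11/3) * m\<^sub>1 * f\<^sub>1)
       + (8 * m\<^sub>2 * m powr (-11/3) - 44/3 * m\<^sub>1\<^sup>2 * m powr (-14/3) + 15 * m powr (-8/3)) * f)
     - 2 * \<omega>\<^sub>1 / 9 * m powr (-4/3) * f + 2 * \<omega>\<^sub>0 * u"

lemma nov_L_classical:
  assumes f: "smooth f" "decaying_derivs 2 f"
    and \<mu>: "smooth \<mu>" "bounded (range (deriv \<mu>))" "l > 0" "\<And>x. l \<le> \<mu> x" "\<And>x. \<mu> x \<le> u"
    and g: "exp_decay g" "continuous_on UNIV g"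
      "\<And>x. g x = linearized_EL (nov_omega0 c k) (nov_omega1 c k) (\<mu> x) (deriv \<mu> x) (deriv (deriv \<mu>) x)
         (f x) (deriv f x) (deriv (deriv f) x) (helmholtz_inv f x)"
  shows "nov_L c k \<mu> (\<lambda>x. complex_of_real (f x)) (\<lambda>x. complex_of_real (g x))"
proof -
  have pos: "\<mu> x > 0" for x using \<mu>(3) \<mu>(4)[of x] by linarith
  note f' = smooth_deriv[OF f(1)]
  note cont_intros = continuous_intros smooth_continuous_on smooth_deriv f(1) \<mu>(1)
  have decay: "exp_decay f" "exp_decay (deriv f)" "exp_decay (deriv (deriv f))"
    using f(2) by (simp_all add: numeral_2_eq_2 derivs_upto_Suc_smooth f(1) f' del: derivs_upto.simps(2))
  define h where
    "h x = \<mu> x powr (-8/3) * deriv (deriv f) x - 8/3 * \<mu> x powr (-11/3) * deriv \<mu> x * deriv f x" for x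
  have "weak_deriv (\<lambda>x. complex_of_real (f x)) (\<lambda>x. complex_of_real (deriv f x))"
    and "weak_deriv (\<lambda>x. complex_of_real (deriv f x)) (\<lambda>x. complex_of_real (deriv (deriv f) x))"
    by (intro weak_deriv_classical smooth_DERIV f(1) f' decay cont_intros)+
  moreover have "weak_deriv (\<lambda>x. complex_of_real (\<mu> x powr (-8/3) * deriv f x)) (\<lambda>x. complex_of_real (h x))"
  proof (rule weak_deriv_classical)
    fix x
    have "((\<lambda>x. \<mu> x powr (-8/3)) has_real_derivative -8/3 * \<mu> x powr (-11/3) * deriv \<mu> x) (at x)"
      using DERIV_chain2[OF has_real_derivative_powr[OF pos[of x], of "-8/3"] smooth_DERIV[OF \<mu>(1)]] by simp
    then show "((\<lambda>x. \<mu> x powr (-8/3) * deriv f x) has_real_derivative h x) (at x)"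
      unfolding h_def by (rule DERIV_cong[OF DERIV_mult[OF _ smooth_DERIV[OF f']]]) (simp add: algebra_simps)
  next
    show "continuous_on UNIV h"
      unfolding h_def by (intro cont_intros) (use pos in \<open>auto simp: less_imp_neq[symmetric]\<close>)
    show "exp_decay (\<lambda>x. \<mu> x powr (-8/3) * deriv f x)" "exp_decay h"
      unfolding h_def by (intro decay_intros decay \<mu>(2) bounded_range_powr[OF \<mu>(3-5)])+
  qed
  moreover have "complex_of_real (g x)
      = nov_L_expr c k \<mu> (\<lambda>x. complex_of_real (f x)) (\<lambda>x. complex_of_real (h x)) x" for x
    unfolding nov_L_expr_def helmholtz_inv_of_real scaleR_conv_of_real
      of_real_mult[symmetric] of_real_add[symmetric] of_real_diff[symmetric]
    by (rule arg_cong[where f=complex_of_real]) (simp add: g(3) h_def linearized_EL_def)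
  ultimately show ?thesis
    unfolding nov_L_iff H2_def using exp_decay_L2[OF g(1,2)] by (auto simp: scaleR_conv_of_real)
qed

section \<open>Linearity of the operator\<close>

lemma L2_lincomb:
  assumes "f \<in> L2" "g \<in> L2" shows "(\<lambda>x. \<alpha> * f x + \<beta> * g x) \<in> L2"
proof -
  have measurable: "f \<in> borel_measurable borel" "g \<in> borel_measurable borel"
    and integrable: "integrable lborel (\<lambda>x. (norm (f x))\<^sup>2)" "integrable lborel (\<lambda>x. (norm (g x))\<^sup>2)"
    using assms by (auto simp: L2_def)
  have "(norm (\<alpha> * f x + \<beta> * g x))\<^sup>2 \<le> 2 * (norm \<alpha>)\<^sup>2 * (norm (f x))\<^sup>2 + 2 * (norm \<beta>)\<^sup>2 * (norm (g x))\<^sup>2" for x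
  proof -
    have "(norm (\<alpha> * f x + \<beta> * g x))\<^sup>2 \<le> (norm (\<alpha> * f x) + norm (\<beta> * g x))\<^sup>2"
      by (intro power_mono norm_triangle_ineq norm_ge_zero)
    also have "\<dots> \<le> 2 * (norm (\<alpha> * f x))\<^sup>2 + 2 * (norm (\<beta> * g x))\<^sup>2"
      using sum_squares_bound[of "norm (\<alpha> * f x)" "norm (\<beta> * g x)"] by (simp add: power2_sum)
    finally show ?thesis by (simp add: norm_mult power_mult_distrib mult.assoc)
  qed
  then have "integrable lborel (\<lambda>x. (norm (\<alpha> * f x + \<beta> * g x))\<^sup>2)"
    using measurable
    by (intro Bochner_Integration.integrable_bound[OF Bochner_Integration.integrable_add[OF
          integrable_mult_right[OF integrable(1), of "2 * (norm \<alpha>)\<^sup>2"]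
          integrable_mult_right[OF integrable(2), of "2 * (norm \<beta>)\<^sup>2"]]]) auto
  then show ?thesis using measurable by (simp add: L2_def)
qed

lemma L2_mult_integrable:
  assumes "f \<in> L2" "exp_decay e" "continuous_on UNIV e"
  shows "integrable lborel (\<lambda>x. e x *\<^sub>R f x)"
proof -
  have measurable: "f \<in> borel_measurable borel" "e \<in> borel_measurable borel"
    using assms by (auto simp: L2_def intro: borel_measurable_continuous_onI)
  have "integrable lborel (\<lambda>x. e x * e x)"
    using assms(2,3) by (intro exp_decay_integrable exp_decay_mult_right exp_decay_imp_bounded continuous_intros)
  then have "integrable lborel (\<lambda>x. (e x * e x + (norm (f x))\<^sup>2) / 2)"
    using assms(1) by (simp add: L2_def)
  moreover have "norm (e x *\<^sub>R f x) \<le> norm ((e x * e x + (norm (f x))\<^sup>2) / 2)" for x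
    using sum_squares_bound[of "\<bar>e x\<bar>" "norm (f x)"] by (simp add: power2_eq_square)
  ultimately show ?thesis
    using measurable by (elim Bochner_Integration.integrable_bound) auto
qed

lemma LINT_scaleR_lincomb:
  assumes "f \<in> L2" "g \<in> L2" "exp_decay e" "continuous_on UNIV e"
  shows "(LINT x|lborel. e x *\<^sub>R (\<alpha> * f x + \<beta> * g x))
    = \<alpha> * (LINT x|lborel. e x *\<^sub>R f x) + \<beta> * (LINT x|lborel. e x *\<^sub>R g x)"
proof -
  have "integrable lborel (\<lambda>x. \<alpha> * (e x *\<^sub>R f x))" "integrable lborel (\<lambda>x. \<beta> * (e x *\<^sub>R g x))"
    by (intro integrable_mult_right L2_mult_integrable assms)+
  then have "(LINT x|lborel. \<alpha> * (e x *\<^sub>R f x) + \<beta> * (e x *\<^sub>R g x))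
      = \<alpha> * (LINT x|lborel. e x *\<^sub>R f x) + \<beta> * (LINT x|lborel. e x *\<^sub>R g x)"
    by (simp only: Bochner_Integration.integral_add integral_mult_right_zero)
  then show ?thesis by (simp add: scaleR_add_right)
qed

lemma weak_deriv_lincomb:
  assumes "weak_deriv f f'" "weak_deriv g g'"
  shows "weak_deriv (\<lambda>x. \<alpha> * f x + \<beta> * g x) (\<lambda>x. \<alpha> * f' x + \<beta> * g' x)"
proof -
  have L2: "f \<in> L2" "f' \<in> L2" "g \<in> L2" "g' \<in> L2" using assms by (auto simp: weak_deriv_def)
  have "(LINT x|lborel. deriv \<psi> x *\<^sub>R (\<alpha> * f x + \<beta> * g x))
      = - (LINT x|lborel. \<psi> x *\<^sub>R (\<alpha> * f' x + \<beta> * g' x))" if "test_function \<psi>" for \<psi>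
  proof -
    note \<psi> = test_functionD[OF that]
    show ?thesis
      using assms that
      by (simp add: LINT_scaleR_lincomb[OF L2(1,3) \<psi>(3)] LINT_scaleR_lincomb[OF L2(2,4) \<psi>(2)]
          smooth_continuous_on smooth_deriv \<psi>(1) weak_deriv_def)
  qed
  then show ?thesis using L2 by (auto simp: weak_deriv_def intro: L2_lincomb)
qed

lemma helmholtz_inv_lincomb:
  assumes "f \<in> L2" "g \<in> L2"
  shows "helmholtz_inv (\<lambda>x. \<alpha> * f x + \<beta> * g x) x = \<alpha> * helmholtz_inv f x + \<beta> * helmholtz_inv g x"
proof -
  have "exp_decay (\<lambda>y. exp (- \<bar>x - y\<bar>) * inverse 2)"
    by (rule exp_decay_mult_right[OF exp_decay_kernel bounded_range_const])
  then have "exp_decay (\<lambda>y. exp (- \<bar>x - y\<bar>) / 2)" by (simp only: divide_inverse)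
  then show ?thesis
    unfolding helmholtz_inv_def by (rule LINT_scaleR_lincomb[OF assms]) (intro continuous_intros; simp)
qed

lemma nov_L_lincomb:
  assumes "nov_L c k \<mu> f\<^sub>1 g\<^sub>1" "nov_L c k \<mu> f\<^sub>2 g\<^sub>2"
  shows "nov_L c k \<mu> (\<lambda>x. \<alpha> * f\<^sub>1 x + \<beta> * f\<^sub>2 x) (\<lambda>x. \<alpha> * g\<^sub>1 x + \<beta> * g\<^sub>2 x)"
proof -
  obtain f\<^sub>1' h\<^sub>1 where L\<^sub>1: "f\<^sub>1 \<in> H2" "g\<^sub>1 \<in> L2" "weak_deriv f\<^sub>1 f\<^sub>1'"
    "weak_deriv (\<lambda>x. (\<mu> x powr (-8/3)) *\<^sub>R f\<^sub>1' x) h\<^sub>1" "AE x in lborel. g\<^sub>1 x = nov_L_expr c k \<mu> f\<^sub>1 h\<^sub>1 x"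
    using assms(1) by (auto simp: nov_L_iff)
  obtain f\<^sub>2' h\<^sub>2 where L\<^sub>2: "f\<^sub>2 \<in> H2" "g\<^sub>2 \<in> L2" "weak_deriv f\<^sub>2 f\<^sub>2'"
    "weak_deriv (\<lambda>x. (\<mu> x powr (-8/3)) *\<^sub>R f\<^sub>2' x) h\<^sub>2" "AE x in lborel. g\<^sub>2 x = nov_L_expr c k \<mu> f\<^sub>2 h\<^sub>2 x"
    using assms(2) by (auto simp: nov_L_iff)
  have L2: "f\<^sub>1 \<in> L2" "f\<^sub>2 \<in> L2" using L\<^sub>1(3) L\<^sub>2(3) by (auto simp: weak_deriv_def)
  show ?thesis
    unfolding nov_L_iff
  proof (intro conjI exI)
    show "(\<lambda>x. \<alpha> * f\<^sub>1 x + \<beta> * f\<^sub>2 x) \<in> H2"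
      using L\<^sub>1(1) L\<^sub>2(1) unfolding H2_def by (blast intro: weak_deriv_lincomb)
    show "(\<lambda>x. \<alpha> * g\<^sub>1 x + \<beta> * g\<^sub>2 x) \<in> L2" using L\<^sub>1(2) L\<^sub>2(2) by (rule L2_lincomb)
    show "weak_deriv (\<lambda>x. \<alpha> * f\<^sub>1 x + \<beta> * f\<^sub>2 x) (\<lambda>x. \<alpha> * f\<^sub>1' x + \<beta> * f\<^sub>2' x)"
      using L\<^sub>1(3) L\<^sub>2(3) by (rule weak_deriv_lincomb)
    show "weak_deriv (\<lambda>x. (\<mu> x powr (-8/3)) *\<^sub>R (\<alpha> * f\<^sub>1' x + \<beta> * f\<^sub>2' x)) (\<lambda>x. \<alpha> * h\<^sub>1 x + \<beta> * h\<^sub>2 x)"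
      using weak_deriv_lincomb[OF L\<^sub>1(4) L\<^sub>2(4)] by (simp add: scaleR_add_right)
    show "AE x in lborel. \<alpha> * g\<^sub>1 x + \<beta> * g\<^sub>2 x
        = nov_L_expr c k \<mu> (\<lambda>x. \<alpha> * f\<^sub>1 x + \<beta> * f\<^sub>2 x) (\<lambda>x. \<alpha> * h\<^sub>1 x + \<beta> * h\<^sub>2 x) x"
      using L\<^sub>1(5) L\<^sub>2(5)
    proof eventually_elim
      case (elim x)
      then show ?case
        by (simp only: nov_L_expr_def helmholtz_inv_lincomb[OF L2] scaleR_conv_of_real) (simp only: algebra_simps)
    qed
  qed
qed

lemma simple_eigenvalue_eigenvector:
  assumes "simple_eigenvalue T z" and p: "T p (\<lambda>x. z * p x)" "\<not> (AE x in lborel. p x = 0)"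
    and f: "T f (\<lambda>x. z * f x)"
  shows "\<exists>b. AE x in lborel. f x = b * p x"
proof -
  obtain e where e: "\<And>g. T g (\<lambda>x. z * g x) \<Longrightarrow> \<exists>b. AE x in lborel. g x = b * e x"
    using assms(1) unfolding simple_eigenvalue_def by blast
  obtain \<beta> \<gamma> where \<beta>: "AE x in lborel. p x = \<beta> * e x" and \<gamma>: "AE x in lborel. f x = \<gamma> * e x"
    using e[OF p(1)] e[OF f] by blast
  have "\<beta> \<noteq> 0" using \<beta> p(2) by auto
  have "AE x in lborel. f x = \<gamma> / \<beta> * p x"
    using \<beta> \<gamma> by eventually_elim (simp add: \<open>\<beta> \<noteq> 0\<close>)
  then show ?thesis by blast
qed

lemma L2_inner_AE_lincomb:
  assumes "f \<in> L2" "g \<in> L2" "w \<in> borel_measurable lborel" "exp_decay e" "continuous_on UNIV e"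
    and "AE x in lborel. w x = \<alpha> * f x + \<beta> * g x"
  shows "L2_inner w (\<lambda>x. complex_of_real (e x))
    = \<alpha> * L2_inner f (\<lambda>x. complex_of_real (e x)) + \<beta> * L2_inner g (\<lambda>x. complex_of_real (e x))"
proof -
  have real_weight: "L2_inner f (\<lambda>x. complex_of_real (e x)) = (LINT x|lborel. e x *\<^sub>R f x)" for f
    by (simp add: L2_inner_def scaleR_conv_of_real mult.commute)
  have [measurable]: "w \<in> borel_measurable borel" "f \<in> borel_measurable borel" "g \<in> borel_measurable borel"
    "e \<in> borel_measurable borel"
    using assms by (auto simp: L2_def intro: borel_measurable_continuous_onI)
  have "AE x in lborel. e x *\<^sub>R w x = e x *\<^sub>R (\<alpha> * f x + \<beta> * g x)"
    using assms(6) by eventually_elim simp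
  then have "(LINT x|lborel. e x *\<^sub>R w x) = (LINT x|lborel. e x *\<^sub>R (\<alpha> * f x + \<beta> * g x))"
    by (intro integral_cong_AE) measurable
  then show ?thesis unfolding real_weight by (simp only: LINT_scaleR_lincomb[OF assms(1,2,4,5)])
qed

section \<open>The Euler--Lagrange expression and its linearization\<close>

lemma DERIV_euler_lagrange:
  assumes m: "(m has_real_derivative m') (at s)" "m s > 0"
    and jets: "(m\<^sub>1 has_real_derivative m\<^sub>1') (at s)" "(m\<^sub>2 has_real_derivative m\<^sub>2') (at s)"
      "(p has_real_derivative p') (at s)"
    and coeffs: "(\<omega>\<^sub>0 has_real_derivative \<omega>\<^sub>0') (at s)" "(\<omega>\<^sub>1 has_real_derivative \<omega>\<^sub>1') (at s)"
  shows "((\<lambda>r. euler_lagrange (\<omega>\<^sub>0 r) (\<omega>\<^sub>1 r) (m r) (m\<^sub>1 r) (m\<^sub>2 r) (p r)) has_real_derivative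
    linearized_EL (\<omega>\<^sub>0 s) (\<omega>\<^sub>1 s) (m s) (m\<^sub>1 s) (m\<^sub>2 s) m' m\<^sub>1' m\<^sub>2' p'
      + 2/3 * \<omega>\<^sub>1' * m s powr (-1/3) + 2 * \<omega>\<^sub>0' * p s) (at s)"
proof -
  have powr: "((\<lambda>r. m r powr e) has_real_derivative e * m s powr (e - 1) * m') (at s)" for e
    using DERIV_chain2[OF has_real_derivative_powr[OF m(2)] m(1)] .
  have exponents: "-11/3 - 1 = (-14/3 :: real)" "-8/3 - 1 = (-11/3 :: real)" "-5/3 - 1 = (-8/3 :: real)"
    "-1/3 - 1 = (-4/3 :: real)"
    by simp_all
  note powrs = powr[of "-11/3", unfolded exponents] powr[of "-8/3", unfolded exponents]
    powr[of "-5/3", unfolded exponents] powr[of "-1/3", unfolded exponents]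
  show ?thesis
    unfolding euler_lagrange_def
    by (rule derivative_eq_intros powrs m jets coeffs refl)+
       (simp add: linearized_EL_def algebra_simps power2_eq_square)
qed

lemma euler_lagrange_log_derivative:
  assumes "m > 0"
  shows "euler_lagrange \<omega>\<^sub>0 \<omega>\<^sub>1 m (r * m) ((r' + r\<^sup>2) * m) p = m powr (-5/3) *
    (2/3 * r\<^sup>2 - 2 * r' - 6 + 2/3 * (\<omega>\<^sub>1 * m powr (4/3)) + 2 * (\<omega>\<^sub>0 * p * m powr (5/3)))"
proof -
  have powr_shift: "m powr (-11/3) = m powr (-5/3) / m\<^sup>2" "m powr (-8/3) = m powr (-5/3) / m"
    "m powr (-1/3) = m powr (-5/3) * m powr (4/3)"
    using assms powr_diff[of m "-5/3" 2] powr_diff[of m "-5/3" 1] powr_add[of m "-5/3" "4/3"]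
    by (simp_all add: powr_numeral)
  have "\<omega>\<^sub>0 * p = \<omega>\<^sub>0 * p * (m powr (-5/3) * m powr (5/3))" using assms by (simp add: powr_add[symmetric])
  also have "\<dots> = m powr (-5/3) * (\<omega>\<^sub>0 * p * m powr (5/3))" by (simp only: mult_ac)
  finally have "2 * \<omega>\<^sub>0 * p = m powr (-5/3) * (2 * (\<omega>\<^sub>0 * p * m powr (5/3)))" by simp
  then show ?thesis
    unfolding euler_lagrange_def powr_shift using assms
    by (simp add: field_simps power2_eq_square)
qed

lemma linearized_EL_lincomb:
  "linearized_EL \<omega>\<^sub>0 \<omega>\<^sub>1 m m\<^sub>1 m\<^sub>2 (\<alpha> * f + \<beta> * g) (\<alpha> * f\<^sub>1 + \<beta> * g\<^sub>1) (\<alpha> * f\<^sub>2 + \<beta> * g\<^sub>2) (\<alpha> * u + \<beta> * v)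
   = \<alpha> * linearized_EL \<omega>\<^sub>0 \<omega>\<^sub>1 m m\<^sub>1 m\<^sub>2 f f\<^sub>1 f\<^sub>2 u + \<beta> * linearized_EL \<omega>\<^sub>0 \<omega>\<^sub>1 m m\<^sub>1 m\<^sub>2 g g\<^sub>1 g\<^sub>2 v"
  by (simp add: linearized_EL_def algebra_simps add_divide_distrib diff_divide_distrib)

text \<open>Euler's identity: the terms of \<open>euler_lagrange\<close> without \<open>\<omega>\<^sub>0\<close> or \<open>\<omega>\<^sub>1\<close> are homogeneous of degree \<open>-5/3\<close>.\<close>

lemma linearized_EL_self:
  assumes "m > 0" "euler_lagrange \<omega>\<^sub>0 \<omega>\<^sub>1 m m\<^sub>1 m\<^sub>2 p = 0"
  shows "linearized_EL \<omega>\<^sub>0 \<omega>\<^sub>1 m m\<^sub>1 m\<^sub>2 m m\<^sub>1 m\<^sub>2 p = 8/9 * \<omega>\<^sub>1 * m powr (-1/3) + 16/3 * \<omega>\<^sub>0 * p"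
proof -
  have shift: "m powr (-14/3) * m = m powr (-11/3)" "m powr (-11/3) * m = m powr (-8/3)"
    "m powr (-8/3) * m = m powr (-5/3)" "m powr (-4/3) * m = m powr (-1/3)"
    using assms(1) by (simp_all add: powr_mult_base mult.commute[of _ m])
  have "linearized_EL \<omega>\<^sub>0 \<omega>\<^sub>1 m m\<^sub>1 m\<^sub>2 m m\<^sub>1 m\<^sub>2 p
      = 10/3 * m powr (-8/3) * m\<^sub>2 - 40/9 * m powr (-11/3) * m\<^sub>1\<^sup>2 + 10 * m powr (-5/3)
        - 2/9 * \<omega>\<^sub>1 * m powr (-1/3) + 2 * \<omega>\<^sub>0 * p"
    unfolding linearized_EL_def shift[symmetric] by algebra
  then show ?thesis using assms(2) unfolding euler_lagrange_def by linarith
qed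

section \<open>The profile in explicit coordinates\<close>

definition sigma :: "real \<Rightarrow> real \<Rightarrow> real" where
  "sigma c p = sqrt (c - p\<^sup>2)"

definition tau :: "real \<Rightarrow> real \<Rightarrow> real" where
  "tau c p = p / sigma c p"

lemma sigma_pos: "p\<^sup>2 < c \<Longrightarrow> sigma c p > 0"
  by (simp add: sigma_def)

lemma tau_mult_sigma: "p\<^sup>2 < c \<Longrightarrow> tau c p * sigma c p = p"
  using sigma_pos[of p c] by (simp add: tau_def)

lemma one_plus_tau_sq: "p\<^sup>2 < c \<Longrightarrow> 1 + (tau c p)\<^sup>2 = c / (sigma c p)\<^sup>2"
  by (simp add: tau_def sigma_def power_divide field_simps)

lemma DERIV_sigma:
  assumes "(p has_real_derivative p') (at s)" "(p s)\<^sup>2 < c"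
  shows "((\<lambda>s. sigma c (p s)) has_real_derivative - tau c (p s) * p') (at s)"
  unfolding sigma_def tau_def using assms by (auto intro!: derivative_eq_intros simp: field_simps)

lemma DERIV_tau:
  assumes "(p has_real_derivative p') (at s)" "(p s)\<^sup>2 < c"
  shows "((\<lambda>s. tau c (p s)) has_real_derivative (1 + (tau c (p s))\<^sup>2) * p' / sigma c (p s)) (at s)"
proof -
  have nz: "sigma c (p s) \<noteq> 0" using sigma_pos[OF assms(2)] by simp
  have "((\<lambda>s. p s / sigma c (p s)) has_real_derivative
      (p' * sigma c (p s) - p s * (- tau c (p s) * p')) / (sigma c (p s) * sigma c (p s))) (at s)"
    by (rule DERIV_divide[OF assms(1) DERIV_sigma[OF assms] nz])
  moreover have "(p' * sigma c (p s) - p s * (- tau c (p s) * p')) / (sigma c (p s) * sigma c (p s))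
      = (1 + (tau c (p s))\<^sup>2) * p' / sigma c (p s)"
    using nz by (simp add: tau_def field_simps power2_eq_square)
  ultimately show ?thesis by (simp add: tau_def)
qed

lemma gronwall_zero_forward:
  fixes u :: "real \<Rightarrow> real"
  assumes "a \<le> b" and deriv: "\<And>x. (u has_real_derivative u' x) (at x)"
    and bound: "\<And>x. x \<in> {a..b} \<Longrightarrow> \<bar>u' x\<bar> \<le> B * \<bar>u x\<bar>" and "u a = 0"
  shows "u b = 0"
proof -
  have "(u b)\<^sup>2 * exp (- 2 * B * b) \<le> (u a)\<^sup>2 * exp (- 2 * B * a)"
  proof (rule DERIV_nonpos_imp_nonincreasing[OF \<open>a \<le> b\<close>, where f="\<lambda>x. (u x)\<^sup>2 * exp (- 2 * B * x)"])
    fix x assume "a \<le> x" "x \<le> b"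
    then have "\<bar>u' x\<bar> \<le> B * \<bar>u x\<bar>" by (intro bound) simp
    have "u x * u' x \<le> \<bar>u x\<bar> * \<bar>u' x\<bar>" using abs_ge_self[of "u x * u' x"] by (simp only: abs_mult)
    also have "\<dots> \<le> \<bar>u x\<bar> * (B * \<bar>u x\<bar>)" using \<open>\<bar>u' x\<bar> \<le> B * \<bar>u x\<bar>\<close> by (rule mult_left_mono) simp
    also have "\<dots> = B * (u x)\<^sup>2" by (simp add: power2_eq_square)
    finally have "2 * (u x * u' x - B * (u x)\<^sup>2) * exp (- 2 * B * x) \<le> 0"
      by (simp add: mult_le_0_iff)
    moreover have "((\<lambda>x. (u x)\<^sup>2 * exp (- 2 * B * x)) has_real_derivative
        2 * (u x * u' x - B * (u x)\<^sup>2) * exp (- 2 * B * x)) (at x)"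
      by (auto intro!: derivative_eq_intros deriv simp: algebra_simps)
    ultimately show "\<exists>d. ((\<lambda>x. (u x)\<^sup>2 * exp (- 2 * B * x)) has_real_derivative d) (at x) \<and> d \<le> 0" by blast
  qed
  then show ?thesis using \<open>u a = 0\<close> by (simp add: mult_le_0_iff)
qed

lemma gronwall_zero:
  fixes u :: "real \<Rightarrow> real"
  assumes deriv: "\<And>x. (u has_real_derivative u' x) (at x)"
    and bound: "\<And>x. \<bar>u' x\<bar> \<le> K x * \<bar>u x\<bar>" and cont: "continuous_on UNIV K" and zero: "u a = 0"
  shows "u b = 0"
proof -
  have "bounded (K ` {min a b..max a b})"
    by (intro compact_imp_bounded compact_continuous_image continuous_on_subset[OF cont]) auto
  then obtain B where B: "\<And>x. x \<in> {min a b..max a b} \<Longrightarrow> \<bar>K x\<bar> \<le> B"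
    unfolding bounded_iff by (metis imageI real_norm_def)
  have local_bound: "\<bar>u' x\<bar> \<le> B * \<bar>u x\<bar>" if "x \<in> {min a b..max a b}" for x
    using bound[of x] B[OF that] by (meson abs_ge_self abs_ge_zero mult_right_mono order_trans)
  show ?thesis
  proof (cases "a \<le> b")
    case True
    then show ?thesis
      using local_bound zero by (intro gronwall_zero_forward[OF True deriv]) auto
  next
    case False
    have "u (- (- b)) = 0"
    proof (rule gronwall_zero_forward[of "- a" "- b" "\<lambda>x. u (- x)" "\<lambda>x. - u' (- x)" B])
      show "((\<lambda>x. u (- x)) has_real_derivative - u' (- x)) (at x)" for x
        using deriv[of "- x"] by (simp add: DERIV_mirror)
      show "\<bar>- u' (- x)\<bar> \<le> B * \<bar>u (- x)\<bar>" if "x \<in> {- a..- b}" for x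
        using local_bound[of "- x"] that False by auto
    qed (use False zero in auto)
    then show ?thesis by simp
  qed
qed

text \<open>The square root \<open>q\<close> of \<open>1 - b\<^sup>2 - 2 b t\<close>, written through \<open>\<phi>'\<close> so that its sign and its smoothness in
  \<open>(k, x)\<close> at the crest come for free.\<close>

definition wave_q :: "real \<Rightarrow> real \<Rightarrow> (real \<Rightarrow> real) \<Rightarrow> real \<Rightarrow> real" where
  "wave_q c k \<phi> x = (1 + (tau c k)\<^sup>2) * deriv \<phi> x / (sigma c (\<phi> x) * (tau c k - tau c (\<phi> x)))"

definition wave_Q :: "real \<Rightarrow> real \<Rightarrow> real" where
  "wave_Q c k = sqrt (1 - 3 * (tau c k)\<^sup>2)"

lemma one_plus_sq_pos: "1 + y\<^sup>2 > 0" for y :: real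
  by (intro add_pos_nonneg) auto

definition wave_density :: "real \<Rightarrow> (real \<Rightarrow> real) \<Rightarrow> real \<Rightarrow> real" where
  "wave_density k \<phi> x = momentum \<phi> x * \<phi> x - k\<^sup>2
     - 3 * k powr (4/3) * (momentum \<phi> x powr (2/3) - k powr (2/3))"

definition wave_primitive :: "real \<Rightarrow> real \<Rightarrow> real" where
  "wave_primitive b r = r + b\<^sup>2 * (ln ((1 - r)\<^sup>2 + b\<^sup>2) - ln ((1 + r)\<^sup>2 + b\<^sup>2))"

definition wave_primitive_b :: "real \<Rightarrow> real \<Rightarrow> real" where
  "wave_primitive_b b r = 2 * b * (ln ((1 - r)\<^sup>2 + b\<^sup>2) - ln ((1 + r)\<^sup>2 + b\<^sup>2))
     + 2 * b ^ 3 * (1 / ((1 - r)\<^sup>2 + b\<^sup>2) - 1 / ((1 + r)\<^sup>2 + b\<^sup>2))"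

definition wave_primitive_r :: "real \<Rightarrow> real \<Rightarrow> real" where
  "wave_primitive_r b r = 1 - 2 * b\<^sup>2 * ((1 - r) / ((1 - r)\<^sup>2 + b\<^sup>2) + (1 + r) / ((1 + r)\<^sup>2 + b\<^sup>2))"

lemma DERIV_wave_primitive:
  assumes B: "(B has_real_derivative b') (at s)" and r: "(r has_real_derivative r') (at s)" and "B s \<noteq> 0"
  shows "((\<lambda>s. wave_primitive (B s) (r s)) has_real_derivative
    wave_primitive_b (B s) (r s) * b' + wave_primitive_r (B s) (r s) * r') (at s)"
proof -
  define P R where "P = (1 - r s)\<^sup>2 + (B s)\<^sup>2" and "R = (1 + r s)\<^sup>2 + (B s)\<^sup>2"
  have pos: "P > 0" "R > 0" using \<open>B s \<noteq> 0\<close> by (auto simp: P_def R_def intro: add_nonneg_pos)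
  have deriv_P: "((\<lambda>s. (1 - r s)\<^sup>2 + (B s)\<^sup>2) has_real_derivative 2 * (B s * b' - (1 - r s) * r')) (at s)"
    and deriv_R: "((\<lambda>s. (1 + r s)\<^sup>2 + (B s)\<^sup>2) has_real_derivative 2 * (B s * b' + (1 + r s) * r')) (at s)"
    by (rule derivative_eq_intros B r refl | simp add: algebra_simps)+
  have "((\<lambda>s. ln ((1 - r s)\<^sup>2 + (B s)\<^sup>2) - ln ((1 + r s)\<^sup>2 + (B s)\<^sup>2)) has_real_derivative
      1 / P * (2 * (B s * b' - (1 - r s) * r')) - 1 / R * (2 * (B s * b' + (1 + r s) * r'))) (at s)"
    using pos unfolding P_def R_def
    by (intro DERIV_diff DERIV_chain2[OF DERIV_ln_divide deriv_P] DERIV_chain2[OF DERIV_ln_divide deriv_R])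
  then have "((\<lambda>s. wave_primitive (B s) (r s)) has_real_derivative r' + (2 * B s * b' * (ln P - ln R)
      + (1 / P * (2 * (B s * b' - (1 - r s) * r')) - 1 / R * (2 * (B s * b' + (1 + r s) * r'))) * (B s)\<^sup>2)) (at s)"
    unfolding wave_primitive_def P_def R_def
    by (intro DERIV_add r DERIV_mult) (auto intro!: derivative_eq_intros B)
  then show ?thesis
    unfolding wave_primitive_b_def wave_primitive_r_def P_def[symmetric] R_def[symmetric]
    by (rule DERIV_cong)
       (simp add: algebra_simps add_divide_distrib diff_divide_distrib power2_eq_square power3_eq_cube)
qed

lemma wave_primitive_minus: "wave_primitive b (- r) = - wave_primitive b r"
  by (simp add: wave_primitive_def algebra_simps)

lemma wave_primitive_b_minus: "wave_primitive_b b (- r) = - wave_primitive_b b r"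
  and wave_primitive_r_minus: "wave_primitive_r b (- r) = wave_primitive_r b r"
  by (simp_all add: wave_primitive_b_def wave_primitive_r_def algebra_simps)

lemma wave_primitive_denominators_pos: "b \<noteq> 0 \<Longrightarrow> (1 - r)\<^sup>2 + b\<^sup>2 > 0 \<and> (1 + r)\<^sup>2 + b\<^sup>2 > 0" for b r :: real
  by (auto intro: add_nonneg_pos)

lemma isCont_wave_primitive: "b \<noteq> 0 \<Longrightarrow> isCont (wave_primitive b) r"
  and isCont_wave_primitive_b: "b \<noteq> 0 \<Longrightarrow> isCont (wave_primitive_b b) r"
  and isCont_wave_primitive_r: "b \<noteq> 0 \<Longrightarrow> isCont (wave_primitive_r b) r"
  unfolding wave_primitive_def[abs_def] wave_primitive_b_def[abs_def] wave_primitive_r_def[abs_def]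
  using wave_primitive_denominators_pos[of b r] by (auto intro!: continuous_intros)

locale novikov_wave =
  fixes c k :: real and \<phi> :: "real \<Rightarrow> real"
  assumes c_pos: "c > 0" and k_range: "k \<in> {0<..<sqrt c / 2}" and profile: "solitary_profile c k \<phi>"
begin

abbreviation a :: real where "a \<equiv> nov_a c k"
abbreviation \<mu> :: "real \<Rightarrow> real" where "\<mu> \<equiv> momentum \<phi>"
abbreviation \<sigma>\<^sub>0 :: real where "\<sigma>\<^sub>0 \<equiv> sigma c k"
abbreviation b :: real where "b \<equiv> tau c k"
abbreviation \<sigma> :: "real \<Rightarrow> real" where "\<sigma> x \<equiv> sigma c (\<phi> x)"
abbreviation t :: "real \<Rightarrow> real" where "t x \<equiv> tau c (\<phi> x)"
abbreviation q :: "real \<Rightarrow> real" where "q \<equiv> wave_q c k \<phi>"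
abbreviation Q :: real where "Q \<equiv> wave_Q c k"

lemma k_pos: "k > 0" and four_k_sq: "4 * k\<^sup>2 < c" and k_sq: "k\<^sup>2 < c"
proof -
  show "k > 0" using k_range by simp
  have "(2 * k)\<^sup>2 < (sqrt c)\<^sup>2" using k_range by (intro power_strict_mono) auto
  then show "4 * k\<^sup>2 < c" using c_pos by (simp add: power_mult_distrib)
  then show "k\<^sup>2 < c" using zero_le_power2[of k] by linarith
qed

lemma phi_sq: "(\<phi> x)\<^sup>2 < c" using profile by (simp add: solitary_profile_def)

lemma \<sigma>\<^sub>0_pos: "\<sigma>\<^sub>0 > 0" and k_eq: "k = b * \<sigma>\<^sub>0" and \<sigma>\<^sub>0_sq: "\<sigma>\<^sub>0\<^sup>2 = c / (1 + b\<^sup>2)"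
  using sigma_pos[OF k_sq] tau_mult_sigma[OF k_sq] one_plus_tau_sq[OF k_sq] c_pos by simp_all

lemma \<sigma>_pos: "\<sigma> x > 0" and phi_eq: "\<phi> x = t x * \<sigma> x" and \<sigma>_sq: "(\<sigma> x)\<^sup>2 = c / (1 + (t x)\<^sup>2)"
  using sigma_pos[OF phi_sq] tau_mult_sigma[OF phi_sq] one_plus_tau_sq[OF phi_sq] c_pos by simp_all

lemma k_sq_eq: "k\<^sup>2 = b\<^sup>2 * c / (1 + b\<^sup>2)" and phi_sq_eq: "(\<phi> x)\<^sup>2 = (t x)\<^sup>2 * c / (1 + (t x)\<^sup>2)"
  using arg_cong[OF k_eq, of "\<lambda>y. y\<^sup>2"] arg_cong[OF phi_eq[of x], of "\<lambda>y. y\<^sup>2"]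
  unfolding power_mult_distrib \<sigma>\<^sub>0_sq \<sigma>_sq times_divide_eq_right .

lemma b_pos: "b > 0" and three_b_sq: "3 * b\<^sup>2 < 1"
proof -
  show "b > 0" using k_pos \<sigma>\<^sub>0_pos by (simp add: tau_def)
  have "4 * (b\<^sup>2 * c / (1 + b\<^sup>2)) < c" using four_k_sq unfolding k_sq_eq .
  then have "4 * b\<^sup>2 < 1 + b\<^sup>2" using c_pos one_plus_sq_pos[of b] by (simp add: field_simps)
  then show "3 * b\<^sup>2 < 1" by simp
qed

lemma a_eq: "a = k * \<sigma>\<^sub>0 ^ 3"
proof -
  have "(c - k\<^sup>2) powr (3/2) = \<sigma>\<^sub>0 ^ 3"
    using k_sq by (simp add: sigma_def powr_half_sqrt[symmetric] powr_realpow[symmetric] powr_powr)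
  then show ?thesis by (simp add: nov_a_def)
qed

lemma a_pos: "a > 0" unfolding a_eq using k_pos \<sigma>\<^sub>0_pos by simp

lemma a_rational: "a = b * c\<^sup>2 / (1 + b\<^sup>2)\<^sup>2"
proof -
  have "a = b * (\<sigma>\<^sub>0\<^sup>2)\<^sup>2" unfolding a_eq by (subst k_eq) (simp add: power_numeral_reduce)
  then show ?thesis by (simp add: \<sigma>\<^sub>0_sq power_divide)
qed

lemma mu_eq: "\<mu> x = a / \<sigma> x ^ 3"
proof -
  have "(c - (\<phi> x)\<^sup>2) powr (-3/2) = 1 / \<sigma> x ^ 3"
    using phi_sq[of x]
    by (simp add: sigma_def powr_minus_divide powr_half_sqrt[symmetric] powr_realpow[symmetric] powr_powr)
  then show ?thesis using profile by (simp add: solitary_profile_def momentum_def)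
qed

lemma mu_pos: "\<mu> x > 0" unfolding mu_eq using a_pos \<sigma>_pos by simp

lemma mu_rational: "\<mu> x = b * (1 + (t x)\<^sup>2)\<^sup>2 / (1 + b\<^sup>2)\<^sup>2 * \<sigma> x"
proof -
  have "\<mu> x = a / ((\<sigma> x)\<^sup>2)\<^sup>2 * \<sigma> x" using \<sigma>_pos[of x] by (simp add: mu_eq power_numeral_reduce)
  then show ?thesis using c_pos by (simp add: a_rational \<sigma>_sq power_divide)
qed

lemma smooth_phi: "smooth \<phi>" using profile by (simp add: solitary_profile_def)

lemma phi_even: "\<phi> (- x) = \<phi> x" using profile by (simp add: solitary_profile_def)

lemma deriv_phi_odd: "deriv \<phi> (- x) = - deriv \<phi> x"
proof -
  have "(\<phi> has_real_derivative - deriv \<phi> (- x)) (at x)"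
    using smooth_DERIV[OF smooth_phi, of "- x"] by (simp add: DERIV_mirror phi_even)
  then have "deriv \<phi> x = - deriv \<phi> (- x)" by (rule DERIV_imp_deriv)
  then show ?thesis by simp
qed

lemma phi_decay: "exp_decay (\<lambda>x. \<phi> x - k)" and deriv_phi_decay: "exp_decay (deriv \<phi>)"
proof -
  obtain r where r: "r > 0" "\<And>n. \<exists>C. \<forall>x. \<bar>(deriv ^^ n) (\<lambda>y. \<phi> y - k) x\<bar> \<le> C * exp (- r * \<bar>x\<bar>)"
    using profile unfolding solitary_profile_def by blast
  have "deriv (\<lambda>y. \<phi> y - k) = deriv \<phi>"
    using smooth_DERIV[OF smooth_phi] by (intro ext DERIV_imp_deriv) (auto intro!: derivative_eq_intros)
  then show "exp_decay (\<lambda>x. \<phi> x - k)" "exp_decay (deriv \<phi>)"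
    using r(1) r(2)[of 0] r(2)[of 1] by (auto simp: exp_decay_def)
qed

lemma DERIV_phi: "(\<phi> has_real_derivative deriv \<phi> x) (at x)"
  by (rule smooth_DERIV[OF smooth_phi])

lemma DERIV_phi': "(deriv \<phi> has_real_derivative \<phi> x - \<mu> x) (at x)"
  using smooth_DERIV[OF smooth_deriv[OF smooth_phi]] by (simp add: momentum_def)

lemma DERIV_\<sigma>_phi': "(\<sigma> has_real_derivative - t x * deriv \<phi> x) (at x)"
  by (rule DERIV_sigma[OF DERIV_phi phi_sq])

lemma DERIV_t_phi': "(t has_real_derivative (1 + (t x)\<^sup>2) * deriv \<phi> x / \<sigma> x) (at x)"
  by (rule DERIV_tau[OF DERIV_phi phi_sq])

text \<open>Conservation of energy for \<open>\<phi>'' = \<phi> - a (c - \<phi>\<^sup>2)\<^bsup>-3/2\<^esup>\<close>, with the constant read off at infinity.\<close>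

lemma first_integral: "(deriv \<phi> x)\<^sup>2 = (\<phi> x)\<^sup>2 - 2 * a / c * t x + 2 * nov_E c k"
proof -
  define R where "R x = (deriv \<phi> x)\<^sup>2 - (\<phi> x)\<^sup>2 + 2 * a / c * t x" for x
  have "(R has_real_derivative 0) (at x)" for x
  proof -
    have "(R has_real_derivative 2 * deriv \<phi> x * (\<phi> x - \<mu> x) - 2 * \<phi> x * deriv \<phi> x
        + 2 * a / c * ((1 + (t x)\<^sup>2) * deriv \<phi> x / \<sigma> x)) (at x)"
      unfolding R_def[abs_def]
      by (intro DERIV_add DERIV_diff DERIV_cmult DERIV_t_phi')
         (auto intro!: derivative_eq_intros DERIV_phi DERIV_phi')
    moreover have "2 * a / c * ((1 + (t x)\<^sup>2) * deriv \<phi> x / \<sigma> x) = 2 * deriv \<phi> x * \<mu> x"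
      unfolding mu_eq one_plus_tau_sq[OF phi_sq] using c_pos \<sigma>_pos[of x]
      by (simp add: field_simps power_numeral_reduce)
    ultimately show ?thesis by (simp add: algebra_simps)
  qed
  then obtain C where C: "\<And>x. R x = C" using DERIV_isconst_all by blast
  have "(\<phi> \<longlongrightarrow> k) at_top" using profile by (simp add: solitary_profile_def)
  then have "(R \<longlongrightarrow> 0\<^sup>2 - k\<^sup>2 + 2 * a / c * b) at_top"
    unfolding R_def[abs_def] tau_def sigma_def using k_sq
    by (intro tendsto_intros exp_decay_tendsto_top[OF deriv_phi_decay]) auto
  moreover have "R = (\<lambda>_. C)" using C by auto
  then have "(R \<longlongrightarrow> C) at_top" by simp
  ultimately have "C = 0\<^sup>2 - k\<^sup>2 + 2 * a / c * b" by (intro tendsto_unique[of at_top]) auto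
  also have "\<dots> = 2 * nov_E c k"
  proof -
    have ab: "a * b = k\<^sup>2 * (c - k\<^sup>2)"
      unfolding a_eq using k_sq by (simp add: sigma_def tau_def power_numeral_reduce)
    have E_limit: "0\<^sup>2 - k\<^sup>2 + 2 * a / c * b = 2 * (k\<^sup>2 * (c - k\<^sup>2)) / c - k\<^sup>2" by (simp add: ab[symmetric])
    show ?thesis unfolding E_limit nov_E_def using c_pos by (simp add: field_simps power2_eq_square)
  qed
  finally show ?thesis using C[of x] by (simp add: R_def)
qed

lemma nov_E_rational: "nov_E c k = c * b\<^sup>2 * (1 - b\<^sup>2) / (2 * (1 + b\<^sup>2)\<^sup>2)"
  unfolding nov_E_def k_sq_eq using c_pos one_plus_sq_pos[of b]
  by (simp add: divide_simps) (simp add: algebra_simps power2_eq_square)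

lemma first_integral_factored:
  "(deriv \<phi> x)\<^sup>2 = ((t x - b) * \<sigma> x / (1 + b\<^sup>2))\<^sup>2 * (1 - b\<^sup>2 - 2 * b * t x)"
proof -
  define T B where "T = 1 + (t x)\<^sup>2" and "B = 1 + b\<^sup>2"
  have pos: "T > 0" "B > 0" by (simp_all add: T_def B_def one_plus_sq_pos)
  have "(deriv \<phi> x)\<^sup>2 = c * (((t x)\<^sup>2 * B\<^sup>2 - 2 * b * t x * T + b\<^sup>2 * (1 - b\<^sup>2) * T) / (T * B\<^sup>2))"
    unfolding first_integral phi_sq_eq a_rational nov_E_rational
      T_def[symmetric] B_def[symmetric]
    using pos c_pos by (simp add: field_simps power2_eq_square)
  also have "(t x)\<^sup>2 * B\<^sup>2 - 2 * b * t x * T + b\<^sup>2 * (1 - b\<^sup>2) * T = (t x - b)\<^sup>2 * (1 - b\<^sup>2 - 2 * b * t x)"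
    unfolding T_def B_def by algebra
  finally show ?thesis
    by (simp add: power_mult_distrib power_divide \<sigma>_sq T_def B_def)
qed

text \<open>The factored first integral is a linear differential inequality for \<open>t - b\<close>, which therefore vanishes
  everywhere if it vanishes somewhere.\<close>

lemma t_ne_b: "t x \<noteq> b"
proof
  assume "t x = b"
  define K where "K y = (1 + (t y)\<^sup>2) * sqrt \<bar>1 - b\<^sup>2 - 2 * b * t y\<bar> / (1 + b\<^sup>2)" for y
  have "t y - b = 0" for y
  proof (rule gronwall_zero[where u="\<lambda>y. t y - b" and a=x and K=K])
    fix y
    show "((\<lambda>y. t y - b) has_real_derivative (1 + (t y)\<^sup>2) * deriv \<phi> y / \<sigma> y) (at y)"
      using DERIV_diff[OF DERIV_t_phi' DERIV_const] by simp
    define A G where "A = (t y - b) * \<sigma> y / (1 + b\<^sup>2)" and "G = 1 - b\<^sup>2 - 2 * b * t y"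
    have "\<bar>deriv \<phi> y\<bar> = sqrt \<bar>A\<^sup>2 * G\<bar>"
      unfolding A_def G_def first_integral_factored[symmetric] by simp
    also have "\<dots> = \<bar>A\<bar> * sqrt \<bar>G\<bar>" by (simp add: abs_mult real_sqrt_mult)
    finally show "\<bar>(1 + (t y)\<^sup>2) * deriv \<phi> y / \<sigma> y\<bar> \<le> K y * \<bar>t y - b\<bar>"
      using \<sigma>_pos[of y] one_plus_sq_pos by (simp add: K_def A_def G_def abs_mult mult_ac)
    show "continuous_on UNIV K"
      unfolding K_def using one_plus_sq_pos[of b]
      by (intro continuous_intros DERIV_continuous_on_UNIV[OF DERIV_t_phi']) simp
  qed (use \<open>t x = b\<close> in simp)
  then have "\<phi> y = b * sqrt (c / (1 + b\<^sup>2))" for y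
    using phi_eq[of y] \<sigma>_sq[of y] \<sigma>_pos[of y] real_sqrt_unique[of "\<sigma> y"] by simp
  then have "\<phi> constant_on UNIV" by (auto simp: constant_on_def)
  then show False using profile by (simp add: solitary_profile_def)
qed

lemma t_gt_b: "t x > b"
proof (rule ccontr)
  have "deriv \<phi> 0 = 0" using deriv_phi_odd[of 0] by simp
  then have "2 * b * t 0 = 1 - b\<^sup>2"
    using first_integral_factored[of 0] t_ne_b[of 0] \<sigma>_pos[of 0] one_plus_sq_pos[of b] by auto
  then have "2 * b * (t 0 - b) > 0" using three_b_sq by (simp add: algebra_simps power2_eq_square)
  then have "t 0 > b" using b_pos by (simp add: zero_less_mult_iff)
  moreover assume "\<not> t x > b"
  moreover have "continuous_on A t" for A by (rule DERIV_continuous_on_UNIV[OF DERIV_t_phi'])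
  ultimately have "\<exists>y. t y = b"
    using IVT'[of t x b 0] IVT2'[of t x b 0] by (cases "x \<le> 0") auto
  then show False using t_ne_b by blast
qed

lemma deriv_phi_eq: "deriv \<phi> x = \<sigma> x * (b - t x) * q x / (1 + b\<^sup>2)"
  using \<sigma>_pos[of x] t_ne_b[of x] one_plus_sq_pos[of b] by (simp add: wave_q_def)

lemma q_sq: "(q x)\<^sup>2 = 1 - b\<^sup>2 - 2 * b * t x"
proof -
  have "((t x - b) * \<sigma> x / (1 + b\<^sup>2))\<^sup>2 * (q x)\<^sup>2 = (deriv \<phi> x)\<^sup>2"
    unfolding deriv_phi_eq by (simp add: power_mult_distrib power_divide power2_commute[of b] mult_ac)
  then have "((t x - b) * \<sigma> x / (1 + b\<^sup>2))\<^sup>2 * (q x)\<^sup>2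
      = ((t x - b) * \<sigma> x / (1 + b\<^sup>2))\<^sup>2 * (1 - b\<^sup>2 - 2 * b * t x)"
    unfolding first_integral_factored .
  then show ?thesis using \<sigma>_pos[of x] t_ne_b[of x] one_plus_sq_pos[of b] by simp
qed

subsection \<open>The polynomial system for \<open>t\<close>, \<open>q\<close>, \<open>\<sigma>\<close> and \<open>\<mu>\<close>\<close>

lemma DERIV_t: "(t has_real_derivative (1 + (t x)\<^sup>2) * (b - t x) * q x / (1 + b\<^sup>2)) (at x)"
  using DERIV_t_phi'[of x] \<sigma>_pos[of x] by (simp add: deriv_phi_eq mult.assoc)

lemma DERIV_\<sigma>: "(\<sigma> has_real_derivative t x * (t x - b) * q x / (1 + b\<^sup>2) * \<sigma> x) (at x)"
  by (rule DERIV_cong[OF DERIV_\<sigma>_phi']) (simp add: deriv_phi_eq algebra_simps diff_divide_distrib)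

lemma DERIV_q: "(q has_real_derivative b * (1 + (t x)\<^sup>2) * (t x - b) / (1 + b\<^sup>2)) (at x)"
proof -
  define y B where "y = b - t x" and "B = 1 + b\<^sup>2"
  have nz: "\<sigma> x \<noteq> 0" "y \<noteq> 0" "B \<noteq> 0"
    using \<sigma>_pos[of x] t_ne_b[of x] one_plus_sq_pos[of b] by (auto simp: y_def B_def)
  have "((\<lambda>x. \<sigma> x * (b - t x)) has_real_derivative - deriv \<phi> x * (1 + b * t x)) (at x)"
    by (rule DERIV_cong[OF DERIV_mult[OF DERIV_\<sigma>_phi' DERIV_diff[OF DERIV_const DERIV_t_phi']]])
       (use \<sigma>_pos[of x] in \<open>simp add: field_simps power2_eq_square\<close>)
  then have "(q has_real_derivative (B * (\<phi> x - \<mu> x) * (\<sigma> x * y) - B * deriv \<phi> x * (- deriv \<phi> x * (1 + b * t x)))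
      / ((\<sigma> x * y) * (\<sigma> x * y))) (at x)"
    unfolding wave_q_def[abs_def] y_def B_def
    by (intro DERIV_divide DERIV_cmult DERIV_phi') (use nz in \<open>simp_all add: y_def\<close>)
  moreover have "(B * (\<phi> x - \<mu> x) * (\<sigma> x * y) - B * deriv \<phi> x * (- deriv \<phi> x * (1 + b * t x)))
      / ((\<sigma> x * y) * (\<sigma> x * y)) = - b * (1 + (t x)\<^sup>2) * y / B"
  proof -
    have phi'': "\<phi> x - \<mu> x = \<sigma> x * (t x * B\<^sup>2 - b * (1 + (t x)\<^sup>2)\<^sup>2) / B\<^sup>2"
    proof -
      have "\<phi> x - \<mu> x = t x * \<sigma> x - \<mu> x" unfolding phi_eq[symmetric] ..
      then show ?thesis unfolding mu_rational B_def[symmetric] using nz by (simp add: field_simps)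
    qed
    have phi': "deriv \<phi> x = \<sigma> x * y * q x / B" by (simp add: deriv_phi_eq y_def B_def)
    have "(B * (\<phi> x - \<mu> x) * (\<sigma> x * y) - B * deriv \<phi> x * (- deriv \<phi> x * (1 + b * t x)))
        / ((\<sigma> x * y) * (\<sigma> x * y)) = ((q x)\<^sup>2 * y * (1 + b * t x) + (t x * B\<^sup>2 - b * (1 + (t x)\<^sup>2)\<^sup>2)) / (y * B)"
      unfolding phi'' phi' using nz by (simp add: field_simps power2_eq_square)
    also have "(q x)\<^sup>2 * y * (1 + b * t x) + (t x * B\<^sup>2 - b * (1 + (t x)\<^sup>2)\<^sup>2) = - b * (1 + (t x)\<^sup>2) * y * y"
      unfolding q_sq y_def B_def by algebra
    finally show ?thesis using nz by simp
  qed
  ultimately show ?thesis by (simp add: y_def B_def algebra_simps)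
qed

lemma DERIV_mu: "(\<mu> has_real_derivative 3 * t x * (b - t x) * q x / (1 + b\<^sup>2) * \<mu> x) (at x)"
proof -
  define z where "z = t x * (t x - b) * q x / (1 + b\<^sup>2)"
  have "((\<lambda>x. a * inverse (\<sigma> x ^ 3)) has_real_derivative
      a * - (inverse (\<sigma> x ^ 3) * (real 3 * (z * \<sigma> x * \<sigma> x ^ (3 - Suc 0))) * inverse (\<sigma> x ^ 3))) (at x)"
    unfolding z_def using \<sigma>_pos[of x] by (intro DERIV_cmult DERIV_inverse' DERIV_power DERIV_\<sigma>) simp
  moreover have "a * - (inverse (\<sigma> x ^ 3) * (real 3 * (z * \<sigma> x * \<sigma> x ^ (3 - Suc 0))) * inverse (\<sigma> x ^ 3))
      = - 3 * z * \<mu> x"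
    using \<sigma>_pos[of x] by (simp add: mu_eq field_simps power_numeral_reduce)
  moreover have "- 3 * z = 3 * t x * (b - t x) * q x / (1 + b\<^sup>2)"
    by (simp add: z_def algebra_simps diff_divide_distrib)
  ultimately show ?thesis unfolding mu_eq[abs_def] by (simp only: divide_inverse)
qed

lemma q_odd: "q (- x) = - q x"
  by (simp add: wave_q_def deriv_phi_odd phi_even)

lemma q_0: "q 0 = 0"
  using q_odd[of 0] by simp

lemma Q_pos: "Q > 0" and Q_sq: "Q\<^sup>2 = 1 - 3 * b\<^sup>2"
  using three_b_sq by (auto simp: wave_Q_def)

lemma Q_sq_minus_q_sq: "Q\<^sup>2 - (q x)\<^sup>2 = 2 * b * (t x - b)"
  unfolding Q_sq q_sq by algebra

lemma abs_q_less_Q: "\<bar>q x\<bar> < Q"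
proof (rule power2_less_imp_less)
  have "2 * b * (t x - b) > 0" using b_pos t_gt_b[of x] by simp
  then have "(q x)\<^sup>2 < Q\<^sup>2" using Q_sq_minus_q_sq[of x] by linarith
  then show "\<bar>q x\<bar>\<^sup>2 < Q\<^sup>2" by simp
qed (use Q_pos in simp)

lemma t_le: "t x \<le> (1 - b\<^sup>2) / (2 * b)"
proof -
  have "2 * b * t x \<le> 1 - b\<^sup>2" using q_sq[of x] zero_le_power2[of "q x"] by linarith
  then show ?thesis using b_pos by (simp add: field_simps)
qed

lemma t_pos: "t x > 0" using t_gt_b[of x] b_pos by linarith

lemma t_sq_le: "(t x)\<^sup>2 \<le> ((1 - b\<^sup>2) / (2 * b))\<^sup>2"
  using t_le t_pos[of x] by (intro power_mono) auto

lemma \<sigma>_le: "\<sigma> x \<le> sqrt c"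
  unfolding sigma_def by (intro real_sqrt_le_mono) simp

lemma \<sigma>_lower_bound: obtains l where "l > 0" "\<And>x. l \<le> \<sigma> x"
proof
  define T where "T = ((1 - b\<^sup>2) / (2 * b))\<^sup>2"
  have "T \<ge> 0" by (simp add: T_def)
  then show "sqrt (c / (1 + T)) > 0" using c_pos by simp
  fix x
  have "c / (1 + T) \<le> (\<sigma> x)\<^sup>2"
    unfolding \<sigma>_sq using c_pos one_plus_sq_pos[of "t x"] \<open>T \<ge> 0\<close> t_sq_le[of x]
    by (intro divide_left_mono) (auto simp: T_def)
  then show "sqrt (c / (1 + T)) \<le> \<sigma> x" using \<sigma>_pos[of x] by (simp add: real_le_lsqrt)
qed

lemma mu_bounds: obtains l u where "l > 0" "\<And>x. l \<le> \<mu> x" "\<And>x. \<mu> x \<le> u"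
proof -
  obtain l where l: "l > 0" "\<And>x. l \<le> \<sigma> x" using \<sigma>_lower_bound by blast
  show ?thesis
  proof (rule that)
    show "a / (sqrt c) ^ 3 > 0" using a_pos c_pos by simp
    show "a / (sqrt c) ^ 3 \<le> \<mu> x" "\<mu> x \<le> a / l ^ 3" for x
      unfolding mu_eq using a_pos c_pos \<sigma>_pos[of x] \<sigma>_le[of x] l
      by (intro divide_left_mono power_mono mult_pos_pos zero_less_power; simp add: less_imp_le)+
  qed
qed

lemma t_minus_b_decay: "exp_decay (\<lambda>x. t x - b)"
proof -
  have "t x - b = (\<phi> x - k) * ((\<phi> x + k) * (1 + (t x)\<^sup>2) * ((1 + b\<^sup>2) / c) * inverse (t x + b))" for x
  proof -
    have "(\<phi> x - k) * (\<phi> x + k) = (\<phi> x)\<^sup>2 - k\<^sup>2" by algebra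
    also have "\<dots> = c * ((t x - b) * (t x + b)) / ((1 + (t x)\<^sup>2) * (1 + b\<^sup>2))"
      unfolding phi_sq_eq k_sq_eq using one_plus_sq_pos[of b] one_plus_sq_pos[of "t x"]
      by (simp add: divide_simps) (simp add: algebra_simps power2_eq_square)
    finally have "(\<phi> x - k) * (\<phi> x + k) * ((1 + (t x)\<^sup>2) * ((1 + b\<^sup>2) / c)) = (t x - b) * (t x + b)"
      using c_pos one_plus_sq_pos[of b] one_plus_sq_pos[of "t x"] by simp
    then have "(\<phi> x - k) * (\<phi> x + k) * ((1 + (t x)\<^sup>2) * ((1 + b\<^sup>2) / c)) / (t x + b) = t x - b"
      using t_pos[of x] b_pos by simp
    then show ?thesis by (simp add: divide_inverse mult_ac)
  qed
  moreover have "bounded (range (\<lambda>x. (\<phi> x + k) * (1 + (t x)\<^sup>2) * ((1 + b\<^sup>2) / c) * inverse (t x + b)))"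
  proof (intro bounded_range_mult bounded_range_const bounded_plus_comp)
    show "bounded (range \<phi>)"
      using bounded_plus_comp[OF exp_decay_imp_bounded[OF phi_decay] bounded_range_const[of k]] by simp
    show "bounded (range (\<lambda>x. (t x)\<^sup>2))" using t_sq_le by (auto simp: bounded_iff)
    show "bounded (range (\<lambda>x. inverse (t x + b)))"
      by (rule bounded_range_inverse[of b]) (use b_pos t_pos in \<open>auto intro: less_imp_le\<close>)
  qed
  ultimately show ?thesis using exp_decay_mult_right[OF phi_decay] by presburger
qed

lemma bounded_derivs_t_q: "bounded_derivs n t \<and> bounded_derivs n q"
proof (induction n)
  case 0
  have "\<bar>t x\<bar> \<le> (1 - b\<^sup>2) / (2 * b)" "\<bar>q x\<bar> \<le> Q" for x
    using t_pos[of x] t_le[of x] abs_q_less_Q[of x] by auto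
  then show ?case by (auto simp: bounded_iff)
next
  case (Suc n)
  then have IH: "bounded_derivs n t" "bounded_derivs n q" by auto
  have "bounded_derivs n (\<lambda>x. (1 + (t x)\<^sup>2) * (b - t x) * q x / (1 + b\<^sup>2))"
    and "bounded_derivs n (\<lambda>x. b * (1 + (t x)\<^sup>2) * (t x - b) / (1 + b\<^sup>2))"
    by (intro decay_intros IH)+
  with IH show ?case
    by (intro conjI derivs_upto_SucI[OF _ DERIV_t] derivs_upto_SucI[OF _ DERIV_q]) (auto dest: derivs_upto_zero)
qed

lemma bounded_derivs_t [decay_intros]: "bounded_derivs n t"
  and bounded_derivs_q [decay_intros]: "bounded_derivs n q"
  using bounded_derivs_t_q by auto

lemma bounded_derivs_\<sigma> [decay_intros]: "bounded_derivs n \<sigma>"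
proof (rule bounded_derivs_linear_ODE[OF _ DERIV_\<sigma>])
  have "\<bar>\<sigma> x\<bar> \<le> sqrt c" for x using \<sigma>_pos[of x] \<sigma>_le[of x] by simp
  then show "bounded (range \<sigma>)" by (auto simp: bounded_iff)
qed (intro decay_intros)

lemma bounded_derivs_mu [decay_intros]: "bounded_derivs n \<mu>"
proof (rule bounded_derivs_linear_ODE[OF _ DERIV_mu])
  obtain l u where "l > 0" "\<And>x. l \<le> \<mu> x" "\<And>x. \<mu> x \<le> u" using mu_bounds by blast
  then have "\<bar>\<mu> x\<bar> \<le> u" for x using mu_pos[of x] by simp
  then show "bounded (range \<mu>)" by (auto simp: bounded_iff)
qed (intro decay_intros)

lemma bounded_derivs_phi [decay_intros]: "bounded_derivs n \<phi>"
proof -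
  have "bounded_derivs n (\<lambda>x. t x * \<sigma> x)" by (intro decay_intros)
  then show ?thesis by (simp only: phi_eq[symmetric])
qed

lemma decaying_derivs_t_minus_b [decay_intros]: "decaying_derivs n (\<lambda>x. t x - b)"
proof (rule decaying_derivs_linear_ODE[OF t_minus_b_decay])
  show "((\<lambda>x. t x - b) has_real_derivative - ((1 + (t x)\<^sup>2) * q x / (1 + b\<^sup>2)) * (t x - b)) (at x)" for x
    by (rule DERIV_cong[OF DERIV_diff[OF DERIV_t DERIV_const]]) (simp add: algebra_simps diff_divide_distrib)
  have "bounded_derivs n (\<lambda>x. - 1 * ((1 + (t x)\<^sup>2) * q x / (1 + b\<^sup>2)))" for n by (intro decay_intros)
  then show "bounded_derivs n (\<lambda>x. - ((1 + (t x)\<^sup>2) * q x / (1 + b\<^sup>2)))" for n by simp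
qed

lemma continuous_on_t [continuous_intros]: "continuous_on A t"
  and continuous_on_\<sigma> [continuous_intros]: "continuous_on A \<sigma>"
  and continuous_on_q [continuous_intros]: "continuous_on A q"
  by (rule DERIV_continuous_on_UNIV, rule DERIV_t DERIV_\<sigma> DERIV_q)+

subsection \<open>Evaluation of the functional\<close>

lemma helmholtz_inv_mu: "helmholtz_inv \<mu> x = \<phi> x"
  by (rule helmholtz_inv_momentum[OF smooth_phi bounded_derivs_phi])

lemma mu_powr: "\<mu> x powr e = k powr e * (\<sigma>\<^sub>0 / \<sigma> x) powr (3 * e)"
proof -
  have "\<mu> x = k * (\<sigma>\<^sub>0 / \<sigma> x) powr 3"
    using \<sigma>\<^sub>0_pos \<sigma>_pos[of x] by (simp add: mu_eq a_eq power_divide powr_numeral)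
  then show ?thesis
    using k_pos \<sigma>\<^sub>0_pos \<sigma>_pos[of x] by (simp add: powr_mult powr_powr del: powr_numeral)
qed

lemma mu_powr_two_thirds: "k powr (4/3) * \<mu> x powr (2/3) = k\<^sup>2 * (1 + (t x)\<^sup>2) / (1 + b\<^sup>2)"
proof -
  have "k powr (4/3) * k powr (2/3) = k\<^sup>2"
    using k_pos by (simp add: powr_add[symmetric] powr_numeral)
  moreover have "(\<sigma>\<^sub>0 / \<sigma> x) powr (3 * (2/3)) = (1 + (t x)\<^sup>2) / (1 + b\<^sup>2)"
    using \<sigma>\<^sub>0_pos \<sigma>_pos[of x] c_pos by (simp add: powr_numeral power_divide \<sigma>\<^sub>0_sq \<sigma>_sq)
  ultimately show ?thesis unfolding mu_powr by (simp add: mult.assoc[symmetric])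
qed

lemma mu_powr_minus_third: "k powr (4/3) * \<mu> x powr (-1/3) = b * \<sigma> x"
proof -
  have "k powr (4/3) * k powr (-1/3) = k" using k_pos by (simp add: powr_add[symmetric])
  moreover have "(\<sigma>\<^sub>0 / \<sigma> x) powr (3 * (-1/3)) = \<sigma> x / \<sigma>\<^sub>0"
    using \<sigma>\<^sub>0_pos \<sigma>_pos[of x] by (simp add: powr_minus_divide)
  ultimately show ?thesis unfolding mu_powr by (simp add: mult.assoc[symmetric] tau_def)
qed

lemma nov_dF_eq: "nov_dF k \<mu> x = 2 * (\<sigma> x * (t x - b))"
proof -
  have "nov_dF k \<mu> x = 2 * (\<phi> x - b * \<sigma> x)"
    unfolding nov_dF_def helmholtz_inv_mu mult.assoc mu_powr_minus_third by simp
  also have "\<phi> x - b * \<sigma> x = \<sigma> x * (t x - b)"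
    unfolding right_diff_distrib mult.commute[of "\<sigma> x"] phi_eq[symmetric] ..
  finally show ?thesis .
qed

lemma decaying_derivs_dF: "decaying_derivs n (nov_dF k \<mu>)"
  unfolding nov_dF_eq[abs_def] by (intro decay_intros)

lemma continuous_on_dF: "continuous_on A (nov_dF k \<mu>)"
  unfolding nov_dF_eq[abs_def] by (intro continuous_intros)

lemma mu_phi_minus_k_sq:
  "\<mu> x * \<phi> x - k\<^sup>2 = (t x - b) * (c * b / (1 + b\<^sup>2)\<^sup>2 * (1 + (t x)\<^sup>2 + b * t x + b\<^sup>2))"
proof -
  define B where "B = 1 + b\<^sup>2"
  have pos: "B > 0" "1 + (t x)\<^sup>2 > 0" using one_plus_sq_pos by (simp_all add: B_def)
  have "\<mu> x * \<phi> x = \<mu> x * (t x * \<sigma> x)" by (simp only: phi_eq[symmetric])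
  also have "\<dots> = b * (1 + (t x)\<^sup>2)\<^sup>2 / B\<^sup>2 * t x * (\<sigma> x)\<^sup>2"
    by (simp add: mu_rational B_def power2_eq_square)
  also have "\<dots> = c * b * (t x * (1 + (t x)\<^sup>2)) / B\<^sup>2"
    unfolding \<sigma>_sq using pos by (simp add: power2_eq_square)
  finally have "\<mu> x * \<phi> x - k\<^sup>2 = c * b * (t x * (1 + (t x)\<^sup>2) - b * B) / B\<^sup>2"
    unfolding k_sq_eq B_def[symmetric] using pos
    by (simp add: divide_simps) (simp add: algebra_simps power2_eq_square)
  also have "t x * (1 + (t x)\<^sup>2) - b * B = (t x - b) * (1 + (t x)\<^sup>2 + b * t x + b\<^sup>2)"
    unfolding B_def by algebra
  finally show ?thesis by (simp add: B_def mult_ac)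
qed

lemma powr_term_factored:
  "k powr (4/3) * (\<mu> x powr (2/3) - k powr (2/3)) = (t x - b) * (k\<^sup>2 * (t x + b) / (1 + b\<^sup>2))"
proof -
  have "k powr (4/3) * k powr (2/3) = k\<^sup>2"
    using k_pos by (simp add: powr_add[symmetric] powr_numeral)
  then have "k powr (4/3) * (\<mu> x powr (2/3) - k powr (2/3)) = k\<^sup>2 * (1 + (t x)\<^sup>2) / (1 + b\<^sup>2) - k\<^sup>2"
    by (simp only: right_diff_distrib mu_powr_two_thirds)
  also have "\<dots> = (t x - b) * (k\<^sup>2 * (t x + b) / (1 + b\<^sup>2))"
    using one_plus_sq_pos[of b] by (simp add: divide_simps) (simp add: algebra_simps power2_eq_square)
  finally show ?thesis .
qed

lemma wave_density_factored:
  "wave_density k \<phi> x = c * b / (1 + b\<^sup>2)\<^sup>2 * ((t x - b) * ((t x - b)\<^sup>2 + Q\<^sup>2))"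
proof -
  define B where "B = 1 + b\<^sup>2"
  have "wave_density k \<phi> x = (t x - b) * (c * b / B\<^sup>2 * (1 + (t x)\<^sup>2 + b * t x + b\<^sup>2))
      - 3 * ((t x - b) * (b\<^sup>2 * c / B * (t x + b) / B))"
    unfolding wave_density_def mult.assoc mu_phi_minus_k_sq powr_term_factored unfolding k_sq_eq B_def ..
  also have "\<dots> = c * b / B\<^sup>2 * ((t x - b) * ((1 + (t x)\<^sup>2 + b * t x + b\<^sup>2) - 3 * (b * (t x + b))))"
    by (simp add: algebra_simps power2_eq_square add_divide_distrib diff_divide_distrib)
  also have "(1 + (t x)\<^sup>2 + b * t x + b\<^sup>2) - 3 * (b * (t x + b)) = (t x - b)\<^sup>2 + Q\<^sup>2"
    unfolding Q_sq by algebra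
  finally show ?thesis by (simp add: B_def)
qed

lemma wave_density_pos: "wave_density k \<phi> x > 0"
proof -
  have "(t x - b)\<^sup>2 + Q\<^sup>2 > 0" using Q_pos by (intro add_nonneg_pos) auto
  then show ?thesis
    unfolding wave_density_factored using c_pos b_pos t_gt_b[of x] one_plus_sq_pos[of b] by simp
qed

lemma continuous_on_wave_density: "continuous_on A (wave_density k \<phi>)"
  unfolding wave_density_factored[abs_def] by (intro continuous_intros)

lemma integrable_wave_density: "integrable lborel (wave_density k \<phi>)"
proof (rule exp_decay_integrable[OF _ continuous_on_wave_density])
  have "decaying_derivs 0 (wave_density k \<phi>)"
    unfolding wave_density_factored[abs_def] by (intro decay_intros)
  then show "exp_decay (wave_density k \<phi>)" by simp
qed

lemma nov_F_eq_LINT: "nov_F k \<mu> = (LINT x|lborel. wave_density k \<phi> x)"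
proof -
  have "decaying_derivs 0 (\<lambda>x. \<mu> x * \<phi> x - k\<^sup>2)"
    and "decaying_derivs 0 (\<lambda>x. k powr (4/3) * (\<mu> x powr (2/3) - k powr (2/3)))"
    unfolding mu_phi_minus_k_sq powr_term_factored by (intro decay_intros)+
  moreover have "continuous_on UNIV (\<lambda>x. \<mu> x * \<phi> x - k\<^sup>2)"
    and "continuous_on UNIV (\<lambda>x. k powr (4/3) * (\<mu> x powr (2/3) - k powr (2/3)))"
    unfolding mu_phi_minus_k_sq powr_term_factored
    by (intro continuous_intros; use one_plus_sq_pos[of b] in simp)+
  ultimately have "integrable lborel (\<lambda>x. \<mu> x * \<phi> x - k\<^sup>2)"
    and "integrable lborel (\<lambda>x. k powr (4/3) * (\<mu> x powr (2/3) - k powr (2/3)))"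
    by (simp_all only: derivs_upto.simps exp_decay_integrable)
  then show ?thesis
    using k_pos by (simp add: nov_F_def wave_density_def helmholtz_inv_mu)
qed

lemma nov_F_pos: "nov_F k \<mu> > 0"
  unfolding nov_F_eq_LINT by (rule LINT_pos[OF integrable_wave_density wave_density_pos])

lemma wave_primitive_r_q: "wave_primitive_r b (q x) = 1 - 2 * b * (t x + b) / (1 + (t x)\<^sup>2)"
proof -
  define P R where "P = (1 - q x)\<^sup>2 + b\<^sup>2" and "R = (1 + q x)\<^sup>2 + b\<^sup>2"
  have pos: "P > 0" "R > 0" using wave_primitive_denominators_pos[of b "q x"] b_pos by (auto simp: P_def R_def)
  have "P * R = 4 * b\<^sup>2 * (1 + (t x)\<^sup>2)" "(1 - q x) * R + (1 + q x) * P = 4 * b * (t x + b)"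
    unfolding P_def R_def using q_sq[of x] by algebra+
  then have "(1 - q x) / P + (1 + q x) / R = 4 * b * (t x + b) / (4 * b\<^sup>2 * (1 + (t x)\<^sup>2))"
    using pos by (simp add: add_frac_eq)
  then show ?thesis
    unfolding wave_primitive_r_def P_def[symmetric] R_def[symmetric] using b_pos by (simp add: power2_eq_square)
qed

lemma DERIV_wave_primitive_q:
  "((\<lambda>x. (c - k\<^sup>2) * wave_primitive b (q x)) has_real_derivative wave_density k \<phi> x) (at x)"
proof -
  define T B where "T = 1 + (t x)\<^sup>2" and "B = 1 + b\<^sup>2"
  have pos: "T > 0" "B > 0" using one_plus_sq_pos by (simp_all add: T_def B_def)
  have "((\<lambda>x. (c - k\<^sup>2) * wave_primitive b (q x)) has_real_derivative
      (c - k\<^sup>2) * (wave_primitive_b b (q x) * 0 + wave_primitive_r b (q x) * (b * T * (t x - b) / B))) (at x)"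
    unfolding T_def B_def using b_pos by (intro DERIV_cmult DERIV_wave_primitive DERIV_const DERIV_q) simp
  moreover have "(c - k\<^sup>2) * (wave_primitive_b b (q x) * 0 + wave_primitive_r b (q x) * (b * T * (t x - b) / B))
      = c * b / B\<^sup>2 * ((t x - b) * (T - 2 * b * (t x + b)))"
  proof -
    have "c - k\<^sup>2 = c / B" unfolding k_sq_eq B_def using one_plus_sq_pos[of b] by (simp add: field_simps)
    moreover have "wave_primitive_r b (q x) = (T - 2 * b * (t x + b)) / T"
      unfolding wave_primitive_r_q T_def[symmetric] using pos by (simp add: field_simps)
    ultimately show ?thesis using pos by (simp add: power2_eq_square)
  qed
  moreover have "T - 2 * b * (t x + b) = (t x - b)\<^sup>2 + Q\<^sup>2" unfolding T_def Q_sq by algebra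
  ultimately show ?thesis by (simp add: wave_density_factored B_def)
qed

lemma q_strict_mono: "x < y \<Longrightarrow> q x < q y"
proof (erule DERIV_pos_imp_increasing)
  fix z
  have "b * (1 + (t z)\<^sup>2) * (t z - b) / (1 + b\<^sup>2) > 0"
    using b_pos t_gt_b[of z] one_plus_sq_pos by simp
  then show "\<exists>d. (q has_real_derivative d) (at z) \<and> 0 < d" using DERIV_q by blast
qed

lemma q_pos: "x > 0 \<Longrightarrow> q x > 0"
  using q_strict_mono[of 0 x] by (simp add: q_0)

lemma abs_deriv_phi_lower_bound:
  obtains m where "m > 0" "\<And>x. x \<ge> 1 \<Longrightarrow> m * (t x - b) \<le> \<bar>deriv \<phi> x\<bar>"
proof -
  obtain l where l: "l > 0" "\<And>x. l \<le> \<sigma> x" using \<sigma>_lower_bound by blast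
  show ?thesis
  proof
    show "l * q 1 / (1 + b\<^sup>2) > 0" using l(1) q_pos[of 1] one_plus_sq_pos[of b] by simp
    fix x :: real assume "x \<ge> 1"
    then have "q 1 \<le> q x" using q_strict_mono[of 1 x] by (cases "x = 1") auto
    then have "l * q 1 \<le> \<sigma> x * q x"
      using l q_pos[of 1] by (intro mult_mono) (auto intro: less_imp_le order_trans[of 0 l])
    then have "l * q 1 / (1 + b\<^sup>2) * (t x - b) \<le> \<sigma> x * q x / (1 + b\<^sup>2) * (t x - b)"
      using t_gt_b[of x] one_plus_sq_pos[of b] by (intro divide_right_mono mult_right_mono) auto
    also have "\<dots> = - deriv \<phi> x" by (simp add: deriv_phi_eq algebra_simps diff_divide_distrib)
    also have "\<dots> \<le> \<bar>deriv \<phi> x\<bar>" by (rule abs_ge_minus_self)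
    finally show "l * q 1 / (1 + b\<^sup>2) * (t x - b) \<le> \<bar>deriv \<phi> x\<bar>" .
  qed
qed

lemma q_tendsto_top: "(q \<longlongrightarrow> Q) at_top"
proof -
  have "((\<lambda>x. sqrt (Q\<^sup>2 - 2 * b * (t x - b))) \<longlongrightarrow> sqrt (Q\<^sup>2 - 2 * b * 0)) at_top"
    by (intro tendsto_intros exp_decay_tendsto_top t_minus_b_decay)
  then have "((\<lambda>x. \<bar>q x\<bar>) \<longlongrightarrow> Q) at_top"
    using Q_pos by (simp add: Q_sq_minus_q_sq[symmetric])
  moreover have "\<forall>\<^sub>F x in at_top. \<bar>q x\<bar> = q x"
    using eventually_gt_at_top[of 0] by eventually_elim (simp add: q_pos less_imp_le)
  ultimately show ?thesis by (rule Lim_transform_eventually)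
qed

lemma q_tendsto_bot: "(q \<longlongrightarrow> - Q) at_bot"
  using tendsto_minus[OF q_tendsto_top] by (simp add: filterlim_at_bot_mirror q_odd)

lemma nov_F_eq: "nov_F k \<mu> = 2 * ((c - k\<^sup>2) * wave_primitive b Q)"
proof -
  have "b \<noteq> 0" using b_pos by simp
  have "nov_F k \<mu> = (c - k\<^sup>2) * wave_primitive b Q - (c - k\<^sup>2) * wave_primitive b (- Q)"
    unfolding nov_F_eq_LINT
    by (intro LINT_FTC_real[OF DERIV_wave_primitive_q continuous_on_wave_density integrable_wave_density]
        tendsto_mult_left isCont_tendsto_compose[OF isCont_wave_primitive[OF \<open>b \<noteq> 0\<close>]] q_tendsto_top q_tendsto_bot)
  then show ?thesis by (simp add: wave_primitive_minus)
qed

section \<open>The Euler--Lagrange equation\<close>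

lemma smooth_mu: "smooth \<mu>"
  by (rule smooth_momentum[OF smooth_phi])

definition mu_rate :: "real \<Rightarrow> real" where
  "mu_rate x = 3 * t x * (b - t x) * q x / (1 + b\<^sup>2)"

definition mu_rate' :: "real \<Rightarrow> real" where
  "mu_rate' x = 3 * (1 + (t x)\<^sup>2) * (b - t x) * ((b - 2 * t x) * (q x)\<^sup>2 + b * t x * (t x - b)) / (1 + b\<^sup>2)\<^sup>2"

lemma deriv_mu: "deriv \<mu> x = mu_rate x * \<mu> x"
  using DERIV_imp_deriv[OF DERIV_mu] by (simp add: mu_rate_def)

lemma DERIV_mu_rate: "(mu_rate has_real_derivative mu_rate' x) (at x)"
proof -
  define T B where "T = 1 + (t x)\<^sup>2" and "B = 1 + b\<^sup>2"
  have "B \<noteq> 0" using one_plus_sq_pos[of b] by (simp add: B_def)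
  have "((\<lambda>x. t x * (b - t x) * q x) has_real_derivative
      (T * (b - t x) * q x / B * (b - t x) + (0 - T * (b - t x) * q x / B) * t x) * q x
        + b * T * (t x - b) / B * (t x * (b - t x))) (at x)"
    unfolding T_def B_def by (intro DERIV_mult DERIV_diff DERIV_const DERIV_t DERIV_q)
  then have "((\<lambda>x. 3 / B * (t x * (b - t x) * q x)) has_real_derivative
      3 / B * ((T * (b - t x) * q x / B * (b - t x) + (0 - T * (b - t x) * q x / B) * t x) * q x
        + b * T * (t x - b) / B * (t x * (b - t x)))) (at x)"
    by (rule DERIV_cmult)
  moreover have "3 / B * ((T * (b - t x) * q x / B * (b - t x) + (0 - T * (b - t x) * q x / B) * t x) * q x
        + b * T * (t x - b) / B * (t x * (b - t x))) = mu_rate' x"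
    unfolding mu_rate'_def T_def[symmetric] B_def[symmetric] using \<open>B \<noteq> 0\<close>
    by (simp add: divide_simps) (simp add: algebra_simps power2_eq_square)
  moreover have "mu_rate = (\<lambda>x. 3 / B * (t x * (b - t x) * q x))"
    by (simp add: mu_rate_def B_def fun_eq_iff)
  ultimately show ?thesis by simp
qed

lemma deriv_deriv_mu: "deriv (deriv \<mu>) x = (mu_rate' x + (mu_rate x)\<^sup>2) * \<mu> x"
proof -
  have "((\<lambda>x. mu_rate x * \<mu> x) has_real_derivative mu_rate' x * \<mu> x + mu_rate x * \<mu> x * mu_rate x) (at x)"
    using DERIV_mu[of x] by (intro DERIV_mult DERIV_mu_rate) (simp add: mu_rate_def)
  then show ?thesis
    unfolding deriv_mu[abs_def] by (auto dest!: DERIV_imp_deriv simp: algebra_simps power2_eq_square)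
qed

lemma mu_powr_a: "a powr - e * \<mu> x powr e = (1 / \<sigma> x) powr (3 * e)"
proof -
  have "\<mu> x = a * (1 / \<sigma> x) powr 3" using \<sigma>_pos[of x] by (simp add: mu_eq powr_numeral power_divide)
  then have "\<mu> x powr e = a powr e * (1 / \<sigma> x) powr (3 * e)"
    using a_pos \<sigma>_pos[of x] by (simp add: powr_mult powr_powr del: powr_numeral)
  then show ?thesis using a_pos by (simp add: powr_add[symmetric])
qed

lemma nov_omega1_mu_powr:
  "nov_omega1 c k * \<mu> x powr (4/3) = 9 * (1 + 3 * b\<^sup>2) * (1 + (t x)\<^sup>2)\<^sup>2 / (1 + b\<^sup>2)\<^sup>2"
proof -
  define T B where "T = 1 + (t x)\<^sup>2" and "B = 1 + b\<^sup>2"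
  have pos: "T > 0" "B > 0" using one_plus_sq_pos by (simp_all add: T_def B_def)
  have "nov_omega1 c k * \<mu> x powr (4/3) = 9 * c * (2 * nov_E c k + c) * (a powr - (4/3) * \<mu> x powr (4/3))"
    by (simp add: nov_omega1_def)
  also have "a powr - (4/3) * \<mu> x powr (4/3) = 1 / ((\<sigma> x)\<^sup>2)\<^sup>2"
    unfolding mu_powr_a using \<sigma>_pos[of x] by (simp add: powr_numeral power_divide)
  also have "\<dots> = (T / c)\<^sup>2" by (simp add: \<sigma>_sq T_def power_divide)
  also have "2 * nov_E c k + c = c * (1 + 3 * b\<^sup>2) / B\<^sup>2"
    unfolding nov_E_rational B_def[symmetric] using pos
    by (simp add: divide_simps) (simp add: B_def algebra_simps power2_eq_square)
  finally show ?thesis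
    using c_pos by (simp add: T_def B_def power2_eq_square)
qed

lemma nov_omega0_mu_powr:
  "nov_omega0 c k * \<phi> x * \<mu> x powr (5/3) = - 9 * b * t x * (1 + (t x)\<^sup>2)\<^sup>2 / (1 + b\<^sup>2)\<^sup>2"
proof -
  have "\<mu> x powr (5/3) = \<mu> x powr (2/3) * \<mu> x" using mu_pos[of x] powr_add[of "\<mu> x" "2/3" 1] by simp
  then have "nov_omega0 c k * \<phi> x * \<mu> x powr (5/3) = - 9 * (a powr - (2/3) * \<mu> x powr (2/3)) * (\<phi> x * \<mu> x)"
    by (simp add: nov_omega0_def)
  also have "a powr - (2/3) * \<mu> x powr (2/3) = (1 + (t x)\<^sup>2) / c"
    unfolding mu_powr_a using \<sigma>_pos[of x] by (simp add: powr_numeral power_divide \<sigma>_sq)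
  also have "\<phi> x * \<mu> x = t x * \<sigma> x * \<mu> x" by (simp only: phi_eq[symmetric])
  also have "\<dots> = b * t x * (1 + (t x)\<^sup>2)\<^sup>2 / (1 + b\<^sup>2)\<^sup>2 * (\<sigma> x)\<^sup>2"
    by (simp add: mu_rational power2_eq_square)
  also have "(\<sigma> x)\<^sup>2 = c / (1 + (t x)\<^sup>2)" by (rule \<sigma>_sq)
  finally have "nov_omega0 c k * \<phi> x * \<mu> x powr (5/3)
      = - 9 * (b * t x * (1 + (t x)\<^sup>2)\<^sup>2 / (1 + b\<^sup>2)\<^sup>2 * ((1 + (t x)\<^sup>2) / c * (c / (1 + (t x)\<^sup>2))))"
    by (simp only: mult_ac)
  also have "(1 + (t x)\<^sup>2) / c * (c / (1 + (t x)\<^sup>2)) = 1" using c_pos one_plus_sq_pos[of "t x"] by simp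
  finally show ?thesis by simp
qed

lemma euler_lagrange_mu:
  "euler_lagrange (nov_omega0 c k) (nov_omega1 c k) (\<mu> x) (deriv \<mu> x) (deriv (deriv \<mu>) x) (\<phi> x) = 0"
proof -
  define B where "B = 1 + b\<^sup>2"
  have "B \<noteq> 0" using one_plus_sq_pos[of b] by (simp add: B_def)
  have "2/3 * (mu_rate x)\<^sup>2 - 2 * mu_rate' x - 6
        + 2/3 * (nov_omega1 c k * \<mu> x powr (4/3)) + 2 * (nov_omega0 c k * \<phi> x * \<mu> x powr (5/3))
      = 6 * ((t x * (b - t x))\<^sup>2 * (q x)\<^sup>2
          - (1 + (t x)\<^sup>2) * (b - t x) * ((b - 2 * t x) * (q x)\<^sup>2 + b * t x * (t x - b))
          - B\<^sup>2 + (1 + (t x)\<^sup>2)\<^sup>2 * (1 + 3 * b\<^sup>2 - 3 * b * t x)) / B\<^sup>2"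
    unfolding nov_omega1_mu_powr nov_omega0_mu_powr mu_rate_def mu_rate'_def B_def[symmetric] using \<open>B \<noteq> 0\<close>
    by (simp add: divide_simps power_mult_distrib) (simp add: algebra_simps)
  also have "(t x * (b - t x))\<^sup>2 * (q x)\<^sup>2
          - (1 + (t x)\<^sup>2) * (b - t x) * ((b - 2 * t x) * (q x)\<^sup>2 + b * t x * (t x - b))
          - B\<^sup>2 + (1 + (t x)\<^sup>2)\<^sup>2 * (1 + 3 * b\<^sup>2 - 3 * b * t x) = 0"
    unfolding q_sq B_def by algebra
  finally show ?thesis
    unfolding deriv_mu deriv_deriv_mu euler_lagrange_log_derivative[OF mu_pos] by simp
qed

lemma decaying_derivs_deriv_mu: "decaying_derivs n (deriv \<mu>)"
proof -
  have "decaying_derivs n (\<lambda>x. (t x - b) * (-3 * t x * q x / (1 + b\<^sup>2) * \<mu> x))" by (intro decay_intros)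
  then show ?thesis unfolding deriv_mu[abs_def] mu_rate_def by (simp add: algebra_simps diff_divide_distrib)
qed

text \<open>Translation invariance: differentiate the Euler--Lagrange equation in \<open>x\<close>.\<close>

lemma nov_L_deriv_mu: "nov_L c k \<mu> (\<lambda>x. complex_of_real (deriv \<mu> x)) (\<lambda>x. complex_of_real 0)"
proof -
  obtain l u where bounds: "l > 0" "\<And>x. l \<le> \<mu> x" "\<And>x. \<mu> x \<le> u" using mu_bounds by blast
  have "helmholtz_inv (deriv \<mu>) x = deriv \<phi> x" for x
  proof -
    have "bounded_derivs (Suc 2) \<phi>" by (rule bounded_derivs_phi)
    then have "bounded_derivs 2 (deriv \<phi>)" unfolding derivs_upto_Suc_smooth[OF smooth_phi] ..
    then show ?thesis
      unfolding deriv_momentum[OF smooth_phi] by (intro helmholtz_inv_momentum smooth_deriv smooth_phi)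
  qed
  moreover have "linearized_EL (nov_omega0 c k) (nov_omega1 c k) (\<mu> x) (deriv \<mu> x) (deriv (deriv \<mu>) x)
      (deriv \<mu> x) (deriv (deriv \<mu>) x) (deriv (deriv (deriv \<mu>)) x) (deriv \<phi> x) = 0" for x
  proof -
    have "((\<lambda>x. euler_lagrange (nov_omega0 c k) (nov_omega1 c k) (\<mu> x) (deriv \<mu> x) (deriv (deriv \<mu>) x) (\<phi> x))
        has_real_derivative
        linearized_EL (nov_omega0 c k) (nov_omega1 c k) (\<mu> x) (deriv \<mu> x) (deriv (deriv \<mu>) x)
          (deriv \<mu> x) (deriv (deriv \<mu>) x) (deriv (deriv (deriv \<mu>)) x) (deriv \<phi> x)
        + 2/3 * 0 * \<mu> x powr (-1/3) + 2 * 0 * \<phi> x) (at x)"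
      by (rule DERIV_euler_lagrange) (intro DERIV_const mu_pos smooth_DERIV smooth_deriv smooth_mu smooth_phi)+
    then have "((\<lambda>x. 0) has_real_derivative
        linearized_EL (nov_omega0 c k) (nov_omega1 c k) (\<mu> x) (deriv \<mu> x) (deriv (deriv \<mu>) x)
          (deriv \<mu> x) (deriv (deriv \<mu>) x) (deriv (deriv (deriv \<mu>)) x) (deriv \<phi> x)) (at x)"
      by (simp add: euler_lagrange_mu)
    then show ?thesis by (rule DERIV_unique) (rule DERIV_const)
  qed
  ultimately show ?thesis
    by (intro nov_L_classical[OF smooth_deriv[OF smooth_mu] decaying_derivs_deriv_mu smooth_mu _ bounds])
       (auto intro: exp_decay_zero exp_decay_imp_bounded derivs_upto_zero[OF decaying_derivs_deriv_mu])
qed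

lemma deriv_mu_not_AE_zero: "\<not> (AE x in lborel. complex_of_real (deriv \<mu> x) = 0)"
proof
  assume "AE x in lborel. complex_of_real (deriv \<mu> x) = 0"
  then have "AE x in lborel. x \<notin> {0<..<1::real}"
  proof eventually_elim
    case (elim x)
    have "mu_rate x \<noteq> 0" if "x > 0"
      using q_pos[OF that] t_pos[of x] t_gt_b[of x] one_plus_sq_pos[of b] by (simp add: mu_rate_def)
    with elim show ?case using mu_pos[of x] by (auto simp: deriv_mu)
  qed
  then have "{0<..<1::real} \<in> null_sets lborel"
    by (subst AE_iff_null_sets) auto
  then show False by (simp add: null_sets_def)
qed

lemma L2_inner_deriv_mu:
  "L2_inner (\<lambda>x. complex_of_real (deriv \<mu> x)) (\<lambda>x. complex_of_real (nov_dF k \<mu> x)) = 0"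
proof -
  have "L2_inner (\<lambda>x. complex_of_real (deriv \<mu> x)) (\<lambda>x. complex_of_real (nov_dF k \<mu> x))
      = complex_of_real (LINT x|lborel. deriv \<mu> x * nov_dF k \<mu> x)"
    unfolding L2_inner_def by (subst integral_complex_of_real[symmetric]) simp
  also have "(LINT x|lborel. deriv \<mu> x * nov_dF k \<mu> x) = 0"
    by (rule LINT_odd) (simp add: deriv_mu mu_rate_def nov_dF_eq mu_eq phi_even q_odd)
  finally show ?thesis by simp
qed

end

section \<open>Dependence on the background \<open>k\<close>\<close>

locale novikov_family =
  fixes c k :: real and \<phi> :: "real \<Rightarrow> real \<Rightarrow> real"
  assumes family_c_pos: "c > 0" and k_in: "k \<in> {0<..<sqrt c / 2}"
    and family_profile: "\<And>\<kappa>. \<kappa> \<in> {0<..<sqrt c / 2} \<Longrightarrow> solitary_profile c \<kappa> (\<phi> \<kappa>)"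
    and family_smooth: "jointly_smooth_on ({0<..<sqrt c / 2} \<times> UNIV) \<phi>"
begin

abbreviation I :: "real set" where "I \<equiv> {0<..<sqrt c / 2}"

lemma wave: "\<kappa> \<in> I \<Longrightarrow> novikov_wave c \<kappa> (\<phi> \<kappa>)"
  using family_c_pos family_profile by unfold_locales auto

end

sublocale novikov_family \<subseteq> novikov_wave c k "\<phi> k"
  using wave k_in by blast

sublocale novikov_family \<subseteq> profile: jointly_smooth "{0<..<sqrt c / 2}" \<phi>
  using family_smooth by unfold_locales auto

sublocale novikov_family \<subseteq> momentum: jointly_smooth "{0<..<sqrt c / 2}" "\<lambda>\<kappa>. momentum (\<phi> \<kappa>)"
  by (rule profile.jointly_smooth_momentum)

context novikov_family
begin

abbreviation \<phi>\<^sub>k :: "real \<Rightarrow> real" where "\<phi>\<^sub>k \<equiv> partial1 \<phi> k"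

lemma DERIV_k_cong:
  assumes "(f has_real_derivative f') (at k)" "\<And>\<kappa>. \<kappa> \<in> I \<Longrightarrow> f \<kappa> = g \<kappa>"
  shows "(g has_real_derivative f') (at k)"
  by (rule has_field_derivative_transform_within_open[OF assms(1) open_greaterThanLessThan k_in assms(2)])

lemma DERIV_k_phi: "((\<lambda>\<kappa>. \<phi> \<kappa> x) has_real_derivative \<phi>\<^sub>k x) (at k)"
  by (rule profile.DERIV_partial1[OF k_in])

lemma DERIV_k_t: "((\<lambda>\<kappa>. tau c (\<phi> \<kappa> x)) has_real_derivative (1 + (t x)\<^sup>2) * \<phi>\<^sub>k x / \<sigma> x) (at k)"
  by (rule DERIV_tau[OF DERIV_k_phi phi_sq])

lemma DERIV_k_\<sigma>: "((\<lambda>\<kappa>. sigma c (\<phi> \<kappa> x)) has_real_derivative - t x * \<phi>\<^sub>k x) (at k)"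
  by (rule DERIV_sigma[OF DERIV_k_phi phi_sq])

definition b\<^sub>k :: real where "b\<^sub>k = (1 + b\<^sup>2) / \<sigma>\<^sub>0"

lemma DERIV_k_b: "(tau c has_real_derivative b\<^sub>k) (at k)"
  using DERIV_tau[OF DERIV_ident k_sq] by (simp add: b\<^sub>k_def)

lemma DERIV_k_\<sigma>\<^sub>0: "(sigma c has_real_derivative - b) (at k)"
  using DERIV_sigma[OF DERIV_ident k_sq] by simp

lemma DERIV_k_a: "(nov_a c has_real_derivative a * (1 - 3 * b\<^sup>2) / k) (at k)"
proof -
  have "((\<lambda>\<kappa>. \<kappa> * sigma c \<kappa> ^ 3) has_real_derivative 1 * \<sigma>\<^sub>0 ^ 3 + real 3 * (- b * \<sigma>\<^sub>0 ^ (3 - Suc 0)) * k) (at k)"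
    by (intro DERIV_mult DERIV_ident DERIV_power DERIV_k_\<sigma>\<^sub>0)
  then have "(nov_a c has_real_derivative 1 * \<sigma>\<^sub>0 ^ 3 + real 3 * (- b * \<sigma>\<^sub>0 ^ (3 - Suc 0)) * k) (at k)"
    by (rule DERIV_k_cong) (use novikov_wave.a_eq[OF wave] in auto)
  moreover have "1 * \<sigma>\<^sub>0 ^ 3 + real 3 * (- b * \<sigma>\<^sub>0 ^ (3 - Suc 0)) * k = a * (1 - 3 * b\<^sup>2) / k"
  proof -
    have "a * (1 - 3 * b\<^sup>2) / k = \<sigma>\<^sub>0 ^ 3 * (1 - 3 * b\<^sup>2)" unfolding a_eq using k_pos by simp
    also have "\<dots> = \<sigma>\<^sub>0 ^ 3 - 3 * b * \<sigma>\<^sub>0\<^sup>2 * (b * \<sigma>\<^sub>0)" by algebra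
    finally show ?thesis unfolding k_eq[symmetric] by simp
  qed
  ultimately show ?thesis by simp
qed

lemma DERIV_k_E: "(nov_E c has_real_derivative k * (c - 4 * k\<^sup>2) / c) (at k)"
  unfolding nov_E_def[abs_def] using c_pos
  by (auto intro!: derivative_eq_intros simp: field_simps power2_eq_square power3_eq_cube)

subsection \<open>The variation \<open>\<phi>\<^sub>k - \<phi> / k\<close>\<close>

definition variation :: "real \<Rightarrow> real" where
  "variation x = 1 * \<phi>\<^sub>k x + (- 1 / k) * \<phi> k x"

lemma smooth_phi_k: "smooth \<phi>\<^sub>k"
proof -
  interpret jointly_smooth "{0<..<sqrt c / 2}" "partial1 \<phi>"
    using profile.jointly_smooth_partial1 profile.open_S by unfold_locales
  show ?thesis by (rule smooth[OF k_in])
qed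

lemma smooth_variation: "smooth variation"
  unfolding variation_def[abs_def] by (intro smooth_lincomb smooth_phi_k smooth_phi)

lemma phi_k_even: "\<phi>\<^sub>k (- x) = \<phi>\<^sub>k x"
proof -
  have "((\<lambda>\<kappa>. \<phi> \<kappa> x) has_real_derivative \<phi>\<^sub>k (- x)) (at k)"
    by (rule DERIV_k_cong[OF DERIV_k_phi]) (use novikov_wave.phi_even[OF wave] in auto)
  then show ?thesis using DERIV_k_phi DERIV_unique by blast
qed

lemma variation_even: "variation (- x) = variation x"
  by (simp add: variation_def phi_k_even phi_even)

lemma phi_k_eq: "\<phi>\<^sub>k x = variation x + \<phi> k x / k"
  by (simp add: variation_def)

lemma deriv_variation: "deriv variation x = deriv \<phi>\<^sub>k x - deriv (\<phi> k) x / k"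
  using funpow_deriv_lincomb[OF smooth_phi_k smooth_phi, of 1 1 "- 1 / k"]
  by (simp add: variation_def[abs_def])

text \<open>The \<open>k\<close>-derivative of the first integral.\<close>

lemma Wronskian_phi_k:
  "deriv (\<phi> k) x * deriv \<phi>\<^sub>k x - (\<phi> k x - \<mu> x) * \<phi>\<^sub>k x
    = k * (c - 4 * k\<^sup>2) / c - a * (1 - 3 * b\<^sup>2) / (k * c) * t x"
proof -
  have "((\<lambda>\<kappa>. (deriv (\<phi> \<kappa>) x)\<^sup>2) has_real_derivative 2 * deriv (\<phi> k) x * deriv \<phi>\<^sub>k x) (at k)"
    using DERIV_power[OF profile.DERIV_partial1_funpow_deriv[OF k_in, of 1 x], of 2] by (simp add: mult_ac)
  moreover have "((\<lambda>\<kappa>. (deriv (\<phi> \<kappa>) x)\<^sup>2) has_real_derivative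
      2 * \<phi> k x * \<phi>\<^sub>k x - 2 / c * (a * (1 - 3 * b\<^sup>2) / k * t x + (1 + (t x)\<^sup>2) * \<phi>\<^sub>k x / \<sigma> x * a)
        + 2 * (k * (c - 4 * k\<^sup>2) / c)) (at k)"
  proof (rule DERIV_k_cong)
    show "((\<lambda>\<kappa>. (\<phi> \<kappa> x)\<^sup>2 - 2 / c * (nov_a c \<kappa> * tau c (\<phi> \<kappa> x)) + 2 * nov_E c \<kappa>) has_real_derivative
        2 * \<phi> k x * \<phi>\<^sub>k x - 2 / c * (a * (1 - 3 * b\<^sup>2) / k * t x + (1 + (t x)\<^sup>2) * \<phi>\<^sub>k x / \<sigma> x * a)
          + 2 * (k * (c - 4 * k\<^sup>2) / c)) (at k)"
      by (intro DERIV_add DERIV_diff DERIV_cmult DERIV_mult DERIV_k_a DERIV_k_t DERIV_k_E)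
         (auto intro!: derivative_eq_intros DERIV_k_phi)
  qed (simp add: novikov_wave.first_integral[OF wave])
  ultimately have "2 * deriv (\<phi> k) x * deriv \<phi>\<^sub>k x
      = 2 * \<phi> k x * \<phi>\<^sub>k x - 2 / c * (a * (1 - 3 * b\<^sup>2) / k * t x + (1 + (t x)\<^sup>2) * \<phi>\<^sub>k x / \<sigma> x * a)
        + 2 * (k * (c - 4 * k\<^sup>2) / c)"
    by (rule DERIV_unique)
  moreover have "(1 + (t x)\<^sup>2) * \<phi>\<^sub>k x / \<sigma> x * a = c * (\<mu> x * \<phi>\<^sub>k x)"
    unfolding mu_eq one_plus_tau_sq[OF phi_sq] using \<sigma>_pos[of x] by (simp add: field_simps power_numeral_reduce)
  moreover have "2 / c * (a * (1 - 3 * b\<^sup>2) / k * t x + c * (\<mu> x * \<phi>\<^sub>k x))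
      = 2 * (a * (1 - 3 * b\<^sup>2) / (k * c) * t x) + 2 * (\<mu> x * \<phi>\<^sub>k x)"
    using c_pos k_pos by (simp add: divide_simps)
  ultimately have "2 * (deriv (\<phi> k) x * deriv \<phi>\<^sub>k x) = 2 * (\<phi> k x * \<phi>\<^sub>k x)
      - (2 * (a * (1 - 3 * b\<^sup>2) / (k * c) * t x) + 2 * (\<mu> x * \<phi>\<^sub>k x)) + 2 * (k * (c - 4 * k\<^sup>2) / c)"
    by (simp only: mult.assoc)
  then show ?thesis unfolding left_diff_distrib by linarith
qed

lemma Wronskian_variation:
  "deriv (\<phi> k) x * deriv variation x - (\<phi> k x - \<mu> x) * variation x
    = - (a / (k * c)) * ((t x - b)\<^sup>2 * (t x + 2 * b))"
proof -
  have "\<phi> k x * \<mu> x = t x * (a / (\<sigma> x)\<^sup>2)"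
    unfolding mu_eq tau_def using \<sigma>_pos[of x] by (simp add: field_simps power_numeral_reduce)
  also have "\<dots> = a / c * (t x * (1 + (t x)\<^sup>2))" using c_pos one_plus_sq_pos[of "t x"] by (simp add: \<sigma>_sq)
  finally have "(deriv (\<phi> k) x)\<^sup>2 - (\<phi> k x - \<mu> x) * \<phi> k x = a / c * (t x * ((t x)\<^sup>2 - 1)) + 2 * nov_E c k"
    unfolding first_integral by (simp add: algebra_simps power2_eq_square)
  then have phi_part: "((deriv (\<phi> k) x)\<^sup>2 - (\<phi> k x - \<mu> x) * \<phi> k x) / k
      = a / (k * c) * (t x * ((t x)\<^sup>2 - 1)) + 2 * nov_E c k / k"
    by (simp add: add_divide_distrib)
  have energy_part: "k * (c - 4 * k\<^sup>2) / c - 2 * nov_E c k / k = - (a / (k * c)) * (2 * b ^ 3)"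
  proof -
    have "a / (k * c) * (2 * b ^ 3) = 2 * (b * \<sigma>\<^sub>0) ^ 3 / c"
      unfolding a_eq using k_pos by (simp add: power_mult_distrib)
    also have "\<dots> = 2 * k ^ 3 / c" unfolding k_eq[symmetric] ..
    finally have a_b: "- (a / (k * c)) * (2 * b ^ 3) = - (2 * k ^ 3 / c)" by simp
    show ?thesis
      unfolding a_b nov_E_def using c_pos k_pos by (simp add: field_simps power2_eq_square power3_eq_cube)
  qed
  have "deriv (\<phi> k) x * deriv variation x - (\<phi> k x - \<mu> x) * variation x
      = (deriv (\<phi> k) x * deriv \<phi>\<^sub>k x - (\<phi> k x - \<mu> x) * \<phi>\<^sub>k x)
        - ((deriv (\<phi> k) x)\<^sup>2 - (\<phi> k x - \<mu> x) * \<phi> k x) / k"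
    by (simp add: deriv_variation variation_def algebra_simps power2_eq_square diff_divide_distrib
        add_divide_distrib)
  also have "\<dots> = k * (c - 4 * k\<^sup>2) / c - 2 * nov_E c k / k
      - a / (k * c) * ((1 - 3 * b\<^sup>2) * t x + t x * ((t x)\<^sup>2 - 1))"
    unfolding Wronskian_phi_k phi_part by (simp add: algebra_simps add_divide_distrib diff_divide_distrib)
  also have "\<dots> = - (a / (k * c)) * (2 * b ^ 3 + (1 - 3 * b\<^sup>2) * t x + t x * ((t x)\<^sup>2 - 1))"
    unfolding energy_part by (simp add: algebra_simps)
  also have "2 * b ^ 3 + (1 - 3 * b\<^sup>2) * t x + t x * ((t x)\<^sup>2 - 1) = (t x - b)\<^sup>2 * (t x + 2 * b)"
    by algebra
  finally show ?thesis .
qed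

lemma variation_decay: "exp_decay variation"
proof -
  define T where "T = (1 - b\<^sup>2) / (2 * b)"
  obtain m where "m > 0" and lower: "\<And>x. x \<ge> 1 \<Longrightarrow> m * (t x - b) \<le> \<bar>deriv (\<phi> k) x\<bar>"
    using abs_deriv_phi_lower_bound by blast
  show ?thesis
  proof (rule exp_decay_Wronskian[OF smooth_DERIV[OF smooth_variation] variation_even DERIV_phi' deriv_phi_decay])
    fix x :: real assume "x \<ge> 1"
    have "m * (t x - b) > 0" using \<open>m > 0\<close> t_gt_b[of x] by simp
    then show "deriv (\<phi> k) x \<noteq> 0" using lower[OF \<open>x \<ge> 1\<close>] by auto
    have "(m * (t x - b))\<^sup>2 \<le> \<bar>deriv (\<phi> k) x\<bar>\<^sup>2"
      using lower[OF \<open>x \<ge> 1\<close>] \<open>m * (t x - b) > 0\<close> by (intro power_mono) auto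
    then have "(t x - b)\<^sup>2 \<le> (deriv (\<phi> k) x)\<^sup>2 / m\<^sup>2"
      using \<open>m > 0\<close> by (simp add: pos_le_divide_eq power_mult_distrib mult.commute)
    then have "(t x - b)\<^sup>2 * (t x + 2 * b) \<le> (deriv (\<phi> k) x)\<^sup>2 / m\<^sup>2 * (T + 2 * b)"
      using t_le[of x] t_pos[of x] b_pos by (intro mult_mono) (auto simp: T_def)
    then have "a / (k * c) * ((t x - b)\<^sup>2 * (t x + 2 * b)) \<le> a / (k * c) * ((deriv (\<phi> k) x)\<^sup>2 / m\<^sup>2 * (T + 2 * b))"
      using a_pos k_pos c_pos by (intro mult_left_mono) auto
    moreover have "a / (k * c) * ((t x - b)\<^sup>2 * (t x + 2 * b)) \<ge> 0"
      using a_pos k_pos c_pos t_pos[of x] b_pos by simp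
    ultimately show "\<bar>deriv (\<phi> k) x * deriv variation x - (\<phi> k x - \<mu> x) * variation x\<bar>
        \<le> a / (k * c) * (T + 2 * b) / m\<^sup>2 * (deriv (\<phi> k) x)\<^sup>2"
      unfolding Wronskian_variation mult_minus_left abs_minus_cancel
      by (subst abs_of_nonneg) (simp_all add: mult_ac)
  qed
qed

lemma momentum_phi_k: "momentum \<phi>\<^sub>k x = \<mu> x * ((1 - 3 * b\<^sup>2) / k + 3 * t x * \<phi>\<^sub>k x / \<sigma> x)"
proof -
  have "((\<lambda>\<kappa>. nov_a c \<kappa> * inverse (sigma c (\<phi> \<kappa> x) ^ 3)) has_real_derivative
      a * (1 - 3 * b\<^sup>2) / k * inverse (\<sigma> x ^ 3)
      + - (inverse (\<sigma> x ^ 3) * (real 3 * (- t x * \<phi>\<^sub>k x * \<sigma> x ^ (3 - Suc 0))) * inverse (\<sigma> x ^ 3)) * a) (at k)"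
    using \<sigma>_pos[of x] by (intro DERIV_mult DERIV_k_a DERIV_inverse' DERIV_power DERIV_k_\<sigma>) simp
  then have "((\<lambda>\<kappa>. momentum (\<phi> \<kappa>) x) has_real_derivative
      a * (1 - 3 * b\<^sup>2) / k * inverse (\<sigma> x ^ 3)
      + - (inverse (\<sigma> x ^ 3) * (real 3 * (- t x * \<phi>\<^sub>k x * \<sigma> x ^ (3 - Suc 0))) * inverse (\<sigma> x ^ 3)) * a) (at k)"
    by (rule DERIV_k_cong) (simp only: novikov_wave.mu_eq[OF wave] divide_inverse)
  moreover have "((\<lambda>\<kappa>. momentum (\<phi> \<kappa>) x) has_real_derivative momentum \<phi>\<^sub>k x) (at k)"
    using momentum.DERIV_partial1[OF k_in, of x] unfolding profile.partial1_momentum[OF k_in] .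
  ultimately have "momentum \<phi>\<^sub>k x = a * (1 - 3 * b\<^sup>2) / k * inverse (\<sigma> x ^ 3)
      + - (inverse (\<sigma> x ^ 3) * (real 3 * (- t x * \<phi>\<^sub>k x * \<sigma> x ^ (3 - Suc 0))) * inverse (\<sigma> x ^ 3)) * a"
    by (intro DERIV_unique)
  also have "\<dots> = \<mu> x * ((1 - 3 * b\<^sup>2) / k + 3 * t x * \<phi>\<^sub>k x / \<sigma> x)"
    using \<sigma>_pos[of x] k_pos by (simp add: mu_eq field_simps power_numeral_reduce)
  finally show ?thesis .
qed

lemma funpow_deriv_momentum_variation:
  "(deriv ^^ n) (momentum variation) x = 1 * (deriv ^^ n) (momentum \<phi>\<^sub>k) x + (- 1 / k) * (deriv ^^ n) \<mu> x"
proof -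
  have "momentum variation y = 1 * momentum \<phi>\<^sub>k y + (- 1 / k) * \<mu> y" for y
    using funpow_deriv_lincomb[OF smooth_phi_k smooth_phi, of 2 1 "- 1 / k"]
    by (simp add: momentum_def variation_def[abs_def] numeral_2_eq_2 diff_divide_distrib)
  then have "(deriv ^^ n) (momentum variation) = (deriv ^^ n) (\<lambda>y. 1 * momentum \<phi>\<^sub>k y + (- 1 / k) * \<mu> y)"
    by presburger
  then show ?thesis
    using funpow_deriv_lincomb[OF smooth_momentum[OF smooth_phi_k] smooth_mu, of n 1 "- 1 / k"] by metis
qed

lemma momentum_variation:
  "momentum variation x = variation x * (3 / c * \<mu> x * t x * (1 + (t x)\<^sup>2) * \<sigma> x)
     + (t x - b) * (3 / k * \<mu> x * (t x + b))"
proof -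
  have quotients: "t x * \<phi> k x / \<sigma> x = (t x)\<^sup>2" "1 / \<sigma> x = (1 + (t x)\<^sup>2) * \<sigma> x / c"
    using \<sigma>_pos[of x] c_pos unfolding one_plus_tau_sq[OF phi_sq] by (simp_all add: tau_def power2_eq_square)
  have "momentum variation x = momentum \<phi>\<^sub>k x - \<mu> x / k"
    using funpow_deriv_momentum_variation[of 0 x] by simp
  also have "\<dots> = \<mu> x * (3 * t x * variation x * (1 / \<sigma> x) + 3 * (t x * \<phi> k x / \<sigma> x - b\<^sup>2) / k)"
    unfolding momentum_phi_k phi_k_eq by (simp add: algebra_simps add_divide_distrib diff_divide_distrib)
  finally show ?thesis unfolding quotients by (simp add: algebra_simps power2_eq_square diff_divide_distrib)
qed

lemma decaying_derivs_momentum_variation: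
  assumes "decaying_derivs n variation" shows "decaying_derivs n (momentum variation)"
  unfolding momentum_variation[abs_def] by (intro decay_intros assms)

text \<open>A bootstrap: \<open>variation'' = variation - momentum variation\<close> decays with \<open>variation\<close>.\<close>

lemma decaying_derivs_variation: "decaying_derivs 2 variation"
proof -
  note smooth = smooth_variation smooth_deriv[OF smooth_variation]
  have "exp_decay (momentum variation)"
    using decaying_derivs_momentum_variation[of 0] variation_decay by simp
  then have decay'': "exp_decay (deriv (deriv variation))"
    using exp_decay_diff[OF variation_decay, of "momentum variation"] by (simp add: momentum_def)
  have "exp_decay (deriv variation)"
    by (rule exp_decay_interpolate[OF smooth_DERIV[OF smooth(1)] smooth_DERIV[OF smooth(2)]
          variation_decay decay''])
  then show ?thesis
    using variation_decay decay''
    by (simp add: numeral_2_eq_2 derivs_upto_Suc_smooth smooth del: derivs_upto.simps(2))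
qed

section \<open>The preimage of the variational derivative\<close>

definition \<omega>\<^sub>0\<^sub>k :: real where "\<omega>\<^sub>0\<^sub>k = - 2/3 * ((1 - 3 * b\<^sup>2) / k) * nov_omega0 c k"

definition \<omega>\<^sub>1\<^sub>k :: real where
  "\<omega>\<^sub>1\<^sub>k = - 4/3 * ((1 - 3 * b\<^sup>2) / k) * nov_omega1 c k + 18 * a powr (-4/3) * (k * (c - 4 * k\<^sup>2))"

lemma DERIV_k_a_powr: "((\<lambda>\<kappa>. nov_a c \<kappa> powr p) has_real_derivative p * ((1 - 3 * b\<^sup>2) / k) * a powr p) (at k)"
  by (rule DERIV_cong[OF DERIV_chain2[OF has_real_derivative_powr[OF a_pos] DERIV_k_a]])
     (use a_pos in \<open>simp add: powr_diff\<close>)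

lemma DERIV_k_omega0: "(nov_omega0 c has_real_derivative \<omega>\<^sub>0\<^sub>k) (at k)"
  unfolding nov_omega0_def[abs_def]
  by (rule DERIV_cong[OF DERIV_cmult[OF DERIV_k_a_powr]]) (simp add: \<omega>\<^sub>0\<^sub>k_def nov_omega0_def)

lemma DERIV_k_omega1: "(nov_omega1 c has_real_derivative \<omega>\<^sub>1\<^sub>k) (at k)"
proof -
  have "(nov_omega1 c has_real_derivative
      9 * c * (- 4/3 * ((1 - 3 * b\<^sup>2) / k) * a powr (-4/3)) * (2 * nov_E c k + c)
      + (2 * (k * (c - 4 * k\<^sup>2) / c) + 0) * (9 * c * a powr (-4/3))) (at k)"
    unfolding nov_omega1_def[abs_def]
    by (intro DERIV_mult DERIV_cmult DERIV_k_a_powr DERIV_add DERIV_k_E DERIV_const)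
  then show ?thesis
    by (rule DERIV_cong) (use c_pos in \<open>simp add: \<omega>\<^sub>1\<^sub>k_def nov_omega1_def\<close>)
qed

definition amplitude :: real where
  "amplitude = - 2 * nov_omega0 c k * (1 + b\<^sup>2) / k"

lemma amplitude_pos: "amplitude > 0"
  using a_pos k_pos one_plus_sq_pos[of b] by (simp add: amplitude_def nov_omega0_def)

lemma omega0_coefficient: "- 2 * \<omega>\<^sub>0\<^sub>k - 16/3 * nov_omega0 c k / k = 2 * amplitude"
  using k_pos by (simp add: \<omega>\<^sub>0\<^sub>k_def amplitude_def field_simps)

lemma a_powr_k_powr: "a powr (-2/3) * (b\<^sup>2 * c\<^sup>2 / (1 + b\<^sup>2)\<^sup>2) = k powr (4/3)"
proof -
  have "a = k * \<sigma>\<^sub>0 powr 3" unfolding a_eq using \<sigma>\<^sub>0_pos by (simp add: powr_numeral)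
  then have a_powr: "a powr (-2/3) = k powr (-2/3) * \<sigma>\<^sub>0 powr (-2)"
    using k_pos \<sigma>\<^sub>0_pos by (simp add: powr_mult powr_powr del: powr_numeral)
  have "b\<^sup>2 * c\<^sup>2 / (1 + b\<^sup>2)\<^sup>2 = k\<^sup>2 * \<sigma>\<^sub>0\<^sup>2"
    unfolding k_sq_eq \<sigma>\<^sub>0_sq by (simp add: power2_eq_square)
  also have "\<dots> = k powr 2 * \<sigma>\<^sub>0 powr 2" using k_pos \<sigma>\<^sub>0_pos by (simp add: powr_numeral)
  finally have "a powr (-2/3) * (b\<^sup>2 * c\<^sup>2 / (1 + b\<^sup>2)\<^sup>2)
      = (k powr (-2/3) * k powr 2) * (\<sigma>\<^sub>0 powr (-2) * \<sigma>\<^sub>0 powr 2)"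
    unfolding a_powr by (simp only: mult_ac)
  then show ?thesis using k_pos \<sigma>\<^sub>0_pos by (simp add: powr_add[symmetric] del: powr_numeral)
qed

lemma omega1_coefficient: "2/3 * \<omega>\<^sub>1\<^sub>k + 8/9 * nov_omega1 c k / k = 2 * amplitude * k powr (4/3)"
proof -
  define A B where "A = a powr (-2/3)" and "B = 1 + b\<^sup>2"
  have "B > 0" using one_plus_sq_pos by (simp add: B_def)
  have A_sq: "a powr (-4/3) = A * A" by (simp add: A_def powr_add[symmetric])
  have "2 * nov_E c k + c = c * (1 + 3 * b\<^sup>2) / B\<^sup>2"
    unfolding nov_E_rational B_def[symmetric] using \<open>B > 0\<close>
    by (simp add: divide_simps) (simp add: B_def algebra_simps power2_eq_square)
  then have omega1: "nov_omega1 c k = 9 * (A * A) * (c\<^sup>2 * (1 + 3 * b\<^sup>2) / B\<^sup>2)"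
    unfolding nov_omega1_def A_sq by (simp add: power2_eq_square)
  have E_k: "k * (c - 4 * k\<^sup>2) = c\<^sup>2 * b\<^sup>2 * (1 - 3 * b\<^sup>2) / B\<^sup>2 / k"
  proof -
    have "k * (c - 4 * k\<^sup>2) = k\<^sup>2 * (c - 4 * k\<^sup>2) / k" using k_pos by (simp add: power2_eq_square)
    also have "k\<^sup>2 * (c - 4 * k\<^sup>2) = c\<^sup>2 * b\<^sup>2 * (1 - 3 * b\<^sup>2) / B\<^sup>2"
      unfolding k_sq_eq B_def[symmetric] using \<open>B > 0\<close>
      by (simp add: divide_simps) (simp add: B_def algebra_simps power2_eq_square)
    finally show ?thesis .
  qed
  have "2/3 * \<omega>\<^sub>1\<^sub>k + 8/9 * nov_omega1 c k / k = 36 * (A * A) * (b\<^sup>2 * c\<^sup>2 * (1 + b\<^sup>2) / B\<^sup>2) / k"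
    unfolding \<omega>\<^sub>1\<^sub>k_def omega1 E_k A_sq using k_pos \<open>B > 0\<close>
    by (simp add: divide_simps) (simp add: algebra_simps power2_eq_square)
  also have "\<dots> = 2 * amplitude * (A * (b\<^sup>2 * c\<^sup>2 / B\<^sup>2))"
    unfolding amplitude_def nov_omega0_def A_def[symmetric] B_def[symmetric] by (simp add: mult_ac)
  finally show ?thesis unfolding A_def B_def a_powr_k_powr .
qed

lemma linearized_EL_momentum_phi_k:
  "linearized_EL (nov_omega0 c k) (nov_omega1 c k) (\<mu> x) (deriv \<mu> x) (deriv (deriv \<mu>) x)
     (momentum \<phi>\<^sub>k x) (deriv (momentum \<phi>\<^sub>k) x) (deriv (deriv (momentum \<phi>\<^sub>k)) x) (\<phi>\<^sub>k x)
   = - (2/3 * \<omega>\<^sub>1\<^sub>k * \<mu> x powr (-1/3) + 2 * \<omega>\<^sub>0\<^sub>k * \<phi> k x)" (is "?L = _")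
proof -
  have DERIV_jet: "((\<lambda>\<kappa>. (deriv ^^ n) (momentum (\<phi> \<kappa>)) x) has_real_derivative
      (deriv ^^ n) (momentum \<phi>\<^sub>k) x) (at k)" for n
    using momentum.DERIV_partial1_funpow_deriv[OF k_in] by (simp add: profile.partial1_momentum[OF k_in])
  have "((\<lambda>\<kappa>. euler_lagrange (nov_omega0 c \<kappa>) (nov_omega1 c \<kappa>) (momentum (\<phi> \<kappa>) x) (deriv (momentum (\<phi> \<kappa>)) x)
        (deriv (deriv (momentum (\<phi> \<kappa>))) x) (\<phi> \<kappa> x)) has_real_derivative
      ?L + 2/3 * \<omega>\<^sub>1\<^sub>k * \<mu> x powr (-1/3) + 2 * \<omega>\<^sub>0\<^sub>k * \<phi> k x) (at k)"
    using DERIV_jet[of 0] DERIV_jet[of 1] DERIV_jet[of 2] DERIV_k_phi[of x] mu_pos[of x]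
      DERIV_k_omega0 DERIV_k_omega1
    by (intro DERIV_euler_lagrange) (simp_all add: numeral_2_eq_2)
  then have "((\<lambda>\<kappa>. 0) has_real_derivative ?L + 2/3 * \<omega>\<^sub>1\<^sub>k * \<mu> x powr (-1/3) + 2 * \<omega>\<^sub>0\<^sub>k * \<phi> k x) (at k)"
    by (rule DERIV_k_cong) (rule novikov_wave.euler_lagrange_mu[OF wave])
  then have "?L + 2/3 * \<omega>\<^sub>1\<^sub>k * \<mu> x powr (-1/3) + 2 * \<omega>\<^sub>0\<^sub>k * \<phi> k x = 0" by (rule DERIV_unique) (rule DERIV_const)
  then show ?thesis by linarith
qed

lemma linearized_EL_momentum_variation:
  "linearized_EL (nov_omega0 c k) (nov_omega1 c k) (\<mu> x) (deriv \<mu> x) (deriv (deriv \<mu>) x)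
     (momentum variation x) (deriv (momentum variation) x) (deriv (deriv (momentum variation)) x) (variation x)
   = amplitude * nov_dF k \<mu> x"
proof -
  define M where "M = \<mu> x powr (-1/3)"
  have jets: "momentum variation x = 1 * momentum \<phi>\<^sub>k x + (- 1 / k) * \<mu> x"
    "deriv (momentum variation) x = 1 * deriv (momentum \<phi>\<^sub>k) x + (- 1 / k) * deriv \<mu> x"
    "deriv (deriv (momentum variation)) x = 1 * deriv (deriv (momentum \<phi>\<^sub>k)) x + (- 1 / k) * deriv (deriv \<mu>) x"
    using funpow_deriv_momentum_variation[of 0 x] funpow_deriv_momentum_variation[of 1 x]
      funpow_deriv_momentum_variation[of 2 x] by (simp_all add: numeral_2_eq_2)
  have "linearized_EL (nov_omega0 c k) (nov_omega1 c k) (\<mu> x) (deriv \<mu> x) (deriv (deriv \<mu>) x)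
     (momentum variation x) (deriv (momentum variation) x) (deriv (deriv (momentum variation)) x) (variation x)
     = - (2/3 * \<omega>\<^sub>1\<^sub>k * M + 2 * \<omega>\<^sub>0\<^sub>k * \<phi> k x) - (8/9 * nov_omega1 c k * M + 16/3 * nov_omega0 c k * \<phi> k x) / k"
    unfolding jets variation_def linearized_EL_lincomb linearized_EL_momentum_phi_k
      linearized_EL_self[OF mu_pos euler_lagrange_mu] M_def by simp
  also have "\<dots> = (- 2 * \<omega>\<^sub>0\<^sub>k - 16/3 * nov_omega0 c k / k) * \<phi> k x - (2/3 * \<omega>\<^sub>1\<^sub>k + 8/9 * nov_omega1 c k / k) * M"
    by (simp add: algebra_simps add_divide_distrib)
  also have "\<dots> = amplitude * (2 * \<phi> k x - 2 * (k powr (4/3) * M))"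
    unfolding omega0_coefficient omega1_coefficient by (simp add: algebra_simps)
  finally show ?thesis by (simp only: nov_dF_def helmholtz_inv_mu M_def mult.assoc)
qed

text \<open>The parameter derivative of \<open>\<mu>\<close> alone does not decay; subtracting \<open>\<mu> / k\<close>, on which the operator is
  computed by homogeneity, restores decay.\<close>

lemma nov_L_momentum_variation:
  "nov_L c k \<mu> (\<lambda>x. complex_of_real (momentum variation x)) (\<lambda>x. complex_of_real (amplitude * nov_dF k \<mu> x))"
proof -
  obtain l u where bounds: "l > 0" "\<And>x. l \<le> \<mu> x" "\<And>x. \<mu> x \<le> u" using mu_bounds by blast
  have "helmholtz_inv (momentum variation) x = variation x" for x
    by (rule helmholtz_inv_momentum[OF smooth_variation decaying_derivs_imp_bounded[OF decaying_derivs_variation]])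
  then show ?thesis
    by (intro nov_L_classical[OF smooth_momentum[OF smooth_variation]
          decaying_derivs_momentum_variation[OF decaying_derivs_variation] smooth_mu _ bounds])
       (simp_all add: linearized_EL_momentum_variation exp_decay_mult_left[OF bounded_range_const]
          derivs_upto_zero[OF decaying_derivs_dF] exp_decay_imp_bounded
          derivs_upto_zero[OF decaying_derivs_deriv_mu] continuous_on_mult_left continuous_on_dF)
qed

section \<open>The derivative of the functional along the family\<close>

abbreviation q\<^sub>k :: "real \<Rightarrow> real" where "q\<^sub>k \<equiv> partial1 (\<lambda>\<kappa>. wave_q c \<kappa> (\<phi> \<kappa>)) k"

definition Q\<^sub>k :: real where "Q\<^sub>k = - 3 * b * b\<^sub>k / Q"

lemma DERIV_k_Q: "(wave_Q c has_real_derivative Q\<^sub>k) (at k)"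
  unfolding wave_Q_def[abs_def] Q\<^sub>k_def using three_b_sq
  by (auto intro!: derivative_eq_intros DERIV_k_b simp: field_simps)

lemma DERIV_k_q: "((\<lambda>\<kappa>. wave_q c \<kappa> (\<phi> \<kappa>) x) has_real_derivative q\<^sub>k x) (at k)"
proof -
  have "((\<lambda>\<kappa>. deriv (\<phi> \<kappa>) x) has_real_derivative deriv \<phi>\<^sub>k x) (at k)"
    using profile.DERIV_partial1_funpow_deriv[OF k_in, of 1 x] by simp
  then have "((\<lambda>\<kappa>. (1 + (tau c \<kappa>)\<^sup>2) * deriv (\<phi> \<kappa>) x) has_real_derivative
      2 * b * b\<^sub>k * deriv (\<phi> k) x + deriv \<phi>\<^sub>k x * (1 + b\<^sup>2)) (at k)"
    by (rule DERIV_mult[rotated]) (auto intro!: derivative_eq_intros DERIV_k_b)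
  moreover have "\<sigma> x * (b - t x) \<noteq> 0" using \<sigma>_pos[of x] t_ne_b[of x] by simp
  ultimately have "(\<lambda>\<kappa>. wave_q c \<kappa> (\<phi> \<kappa>) x) field_differentiable (at k)"
    unfolding wave_q_def field_differentiable_def
    using DERIV_divide[OF _ DERIV_mult[OF DERIV_k_\<sigma>[of x] DERIV_diff[OF DERIV_k_b DERIV_k_t[of x]]]] by blast
  then show ?thesis
    unfolding partial1_def by (simp only: DERIV_deriv_iff_field_differentiable)
qed

lemma q_q_k_eq: "q x * q\<^sub>k x = - b * b\<^sub>k - b\<^sub>k * t x - b * ((1 + (t x)\<^sup>2) * \<phi>\<^sub>k x / \<sigma> x)"
proof -
  have "((\<lambda>\<kappa>. (wave_q c \<kappa> (\<phi> \<kappa>) x)\<^sup>2) has_real_derivative 2 * (q x * q\<^sub>k x)) (at k)"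
    by (rule derivative_eq_intros DERIV_k_q refl)+ simp
  moreover have "((\<lambda>\<kappa>. (wave_q c \<kappa> (\<phi> \<kappa>) x)\<^sup>2) has_real_derivative
      2 * (- b * b\<^sub>k - b\<^sub>k * t x - b * ((1 + (t x)\<^sup>2) * \<phi>\<^sub>k x / \<sigma> x))) (at k)"
  proof (rule DERIV_k_cong)
    show "((\<lambda>\<kappa>. 1 - (tau c \<kappa>)\<^sup>2 - 2 * tau c \<kappa> * tau c (\<phi> \<kappa> x)) has_real_derivative
        2 * (- b * b\<^sub>k - b\<^sub>k * t x - b * ((1 + (t x)\<^sup>2) * \<phi>\<^sub>k x / \<sigma> x))) (at k)"
      by (rule DERIV_cong[OF DERIV_diff[OF DERIV_diff[OF DERIV_const DERIV_power[OF DERIV_k_b, where n=2]]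
              DERIV_mult[OF DERIV_cmult[OF DERIV_k_b, of 2] DERIV_k_t]]]) simp
  qed (simp add: novikov_wave.q_sq[OF wave])
  ultimately show ?thesis using DERIV_unique by fastforce
qed

lemma q_k_tendsto_top: "(q\<^sub>k \<longlongrightarrow> Q\<^sub>k) at_top"
proof -
  have phi_lim: "(\<phi> k \<longlongrightarrow> k) at_top" using profile by (simp add: solitary_profile_def)
  then have t_lim: "(t \<longlongrightarrow> b) at_top" and \<sigma>_lim: "(\<sigma> \<longlongrightarrow> \<sigma>\<^sub>0) at_top"
    unfolding tau_def sigma_def using k_sq by (intro tendsto_intros; simp)+
  have "((\<lambda>x. variation x + \<phi> k x / k) \<longlongrightarrow> 0 + k / k) at_top"
    using k_pos by (intro tendsto_intros exp_decay_tendsto_top[OF variation_decay] phi_lim) auto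
  then have "(\<phi>\<^sub>k \<longlongrightarrow> 1) at_top" using k_pos by (simp add: phi_k_eq[symmetric])
  then have "((\<lambda>x. q x * q\<^sub>k x) \<longlongrightarrow> - b * b\<^sub>k - b\<^sub>k * b - b * ((1 + b\<^sup>2) * 1 / \<sigma>\<^sub>0)) at_top"
    unfolding q_q_k_eq using \<sigma>\<^sub>0_pos by (intro tendsto_intros t_lim \<sigma>_lim) auto
  then have "((\<lambda>x. q x * q\<^sub>k x / q x) \<longlongrightarrow> (- b * b\<^sub>k - b\<^sub>k * b - b * ((1 + b\<^sup>2) * 1 / \<sigma>\<^sub>0)) / Q) at_top"
    using Q_pos by (intro tendsto_divide q_tendsto_top) auto
  moreover have "(1 + b\<^sup>2) * 1 / \<sigma>\<^sub>0 = b\<^sub>k" by (simp add: b\<^sub>k_def)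
  then have "(- b * b\<^sub>k - b\<^sub>k * b - b * ((1 + b\<^sup>2) * 1 / \<sigma>\<^sub>0)) / Q = Q\<^sub>k" by (simp only: Q\<^sub>k_def) simp
  moreover have "\<forall>\<^sub>F x in at_top. q x * q\<^sub>k x / q x = q\<^sub>k x"
    using eventually_gt_at_top[of 0] by eventually_elim (use q_pos in force)
  ultimately show ?thesis using Lim_transform_eventually by fastforce
qed

lemma q_k_odd: "q\<^sub>k (- x) = - q\<^sub>k x"
proof -
  have "((\<lambda>\<kappa>. wave_q c \<kappa> (\<phi> \<kappa>) (- x)) has_real_derivative - q\<^sub>k x) (at k)"
    by (rule DERIV_k_cong[OF DERIV_minus[OF DERIV_k_q]]) (simp add: novikov_wave.q_odd[OF wave])
  with DERIV_k_q show ?thesis by (rule DERIV_unique)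
qed

definition primitive_k :: "real \<Rightarrow> real" where
  "primitive_k x = - 2 * k * wave_primitive b (q x)
     + (wave_primitive_b b (q x) * b\<^sub>k + wave_primitive_r b (q x) * q\<^sub>k x) * (c - k\<^sup>2)"

definition primitive_k_limit :: real where
  "primitive_k_limit = - 2 * k * wave_primitive b Q
     + (wave_primitive_b b Q * b\<^sub>k + wave_primitive_r b Q * Q\<^sub>k) * (c - k\<^sup>2)"

lemma DERIV_k_background: "((\<lambda>\<kappa>. c - \<kappa>\<^sup>2) has_real_derivative - 2 * k) (at k)"
  by (auto intro!: derivative_eq_intros)

lemma DERIV_k_primitive:
  "((\<lambda>\<kappa>. (c - \<kappa>\<^sup>2) * wave_primitive (tau c \<kappa>) (wave_q c \<kappa> (\<phi> \<kappa>) x)) has_real_derivative primitive_k x) (at k)"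
  unfolding primitive_k_def using b_pos
  by (intro DERIV_mult DERIV_wave_primitive DERIV_k_b DERIV_k_q DERIV_k_background) simp

lemma DERIV_k_nov_F: "((\<lambda>\<kappa>. nov_F \<kappa> (momentum (\<phi> \<kappa>))) has_real_derivative 2 * primitive_k_limit) (at k)"
proof (rule DERIV_k_cong)
  show "((\<lambda>\<kappa>. 2 * ((c - \<kappa>\<^sup>2) * wave_primitive (tau c \<kappa>) (wave_Q c \<kappa>))) has_real_derivative
      2 * primitive_k_limit) (at k)"
    unfolding primitive_k_limit_def using b_pos
    by (intro DERIV_cmult DERIV_mult DERIV_wave_primitive DERIV_k_b DERIV_k_Q DERIV_k_background) simp
qed (simp add: novikov_wave.nov_F_eq[OF wave])

lemma primitive_k_tendsto_top: "(primitive_k \<longlongrightarrow> primitive_k_limit) at_top"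
proof -
  have "b \<noteq> 0" using b_pos by simp
  then show ?thesis
    unfolding primitive_k_def[abs_def] primitive_k_limit_def
    by (intro tendsto_intros q_k_tendsto_top isCont_tendsto_compose[OF isCont_wave_primitive]
        isCont_tendsto_compose[OF isCont_wave_primitive_b] isCont_tendsto_compose[OF isCont_wave_primitive_r]
        q_tendsto_top)
qed

lemma primitive_k_tendsto_bot: "(primitive_k \<longlongrightarrow> - primitive_k_limit) at_bot"
proof -
  have "primitive_k (- x) = - primitive_k x" for x
    unfolding primitive_k_def q_odd q_k_odd wave_primitive_minus wave_primitive_b_minus wave_primitive_r_minus
    by (simp add: algebra_simps)
  then show ?thesis
    using tendsto_minus[OF primitive_k_tendsto_top] by (simp add: filterlim_at_bot_mirror)
qed

definition density_deriv :: "real \<Rightarrow> real \<Rightarrow> real" where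
  "density_deriv \<kappa> x = momentum (partial1 \<phi> \<kappa>) x * \<phi> \<kappa> x + momentum (\<phi> \<kappa>) x * partial1 \<phi> \<kappa> x + 4 * \<kappa>
     - 4 * \<kappa> powr (1/3) * momentum (\<phi> \<kappa>) x powr (2/3)
     - 2 * \<kappa> powr (4/3) * momentum (\<phi> \<kappa>) x powr (-1/3) * momentum (partial1 \<phi> \<kappa>) x"

lemma wave_density_eq:
  "\<kappa> > 0 \<Longrightarrow> wave_density \<kappa> u x = momentum u x * u x + 2 * \<kappa>\<^sup>2 - 3 * (\<kappa> powr (4/3) * momentum u x powr (2/3))"
proof -
  assume "\<kappa> > 0"
  then have "\<kappa> powr (4/3) * \<kappa> powr (2/3) = \<kappa>\<^sup>2" by (simp add: powr_add[symmetric] powr_numeral)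
  then show ?thesis by (simp add: wave_density_def algebra_simps)
qed

lemma DERIV_wave_density:
  assumes "\<kappa> \<in> I"
  shows "((\<lambda>\<kappa>. wave_density \<kappa> (\<phi> \<kappa>) x) has_real_derivative density_deriv \<kappa> x) (at \<kappa>)"
proof -
  have pos: "\<kappa> > 0" "momentum (\<phi> \<kappa>) x > 0" using assms novikov_wave.mu_pos[OF wave] by auto
  have DERIV_momentum: "((\<lambda>\<kappa>. momentum (\<phi> \<kappa>) x) has_real_derivative momentum (partial1 \<phi> \<kappa>) x) (at \<kappa>)"
    using momentum.DERIV_partial1[OF assms, of x] unfolding profile.partial1_momentum[OF assms] .
  have powr_k: "((\<lambda>\<kappa>. \<kappa> powr (4/3)) has_real_derivative 4/3 * \<kappa> powr (1/3)) (at \<kappa>)"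
    using has_real_derivative_powr[OF pos(1), of "4/3"] by simp
  have powr_m: "((\<lambda>\<kappa>. momentum (\<phi> \<kappa>) x powr (2/3)) has_real_derivative
      2/3 * momentum (\<phi> \<kappa>) x powr (-1/3) * momentum (partial1 \<phi> \<kappa>) x) (at \<kappa>)"
    using DERIV_chain2[OF has_real_derivative_powr[OF pos(2), of "2/3"] DERIV_momentum] by simp
  have "((\<lambda>\<kappa>. momentum (\<phi> \<kappa>) x * \<phi> \<kappa> x + 2 * \<kappa>\<^sup>2 - 3 * (\<kappa> powr (4/3) * momentum (\<phi> \<kappa>) x powr (2/3)))
      has_real_derivative density_deriv \<kappa> x) (at \<kappa>)"
    by (rule DERIV_cong,
        (rule derivative_eq_intros powr_k powr_m DERIV_momentum profile.DERIV_partial1[OF assms] refl)+)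
       (simp add: density_deriv_def algebra_simps)
  then show ?thesis
    by (rule has_field_derivative_transform_within_open[OF _ open_greaterThanLessThan assms])
       (simp add: wave_density_eq)
qed

lemma continuous_on_density_deriv: "continuous_on (I \<times> UNIV) (\<lambda>(\<kappa>, x). density_deriv \<kappa> x)"
proof -
  interpret partial: jointly_smooth "{0<..<sqrt c / 2}" "partial1 \<phi>"
    using profile.jointly_smooth_partial1 profile.open_S by unfold_locales
  interpret partial_momentum: jointly_smooth "{0<..<sqrt c / 2}" "\<lambda>\<kappa>. momentum (partial1 \<phi> \<kappa>)"
    by (rule partial.jointly_smooth_momentum)
  note [continuous_intros] = profile.continuous_on_joint[of UNIV, unfolded case_prod_beta]
    momentum.continuous_on_joint[of UNIV, unfolded case_prod_beta]
    partial.continuous_on_joint[of UNIV, unfolded case_prod_beta]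
    partial_momentum.continuous_on_joint[of UNIV, unfolded case_prod_beta]
  have "momentum (\<phi> \<kappa>) x \<noteq> 0" if "\<kappa> \<in> I" for \<kappa> x using novikov_wave.mu_pos[OF wave[OF that], of x] by simp
  then show ?thesis
    unfolding density_deriv_def case_prod_beta by (intro continuous_intros) auto
qed

lemma DERIV_primitive_k: "(primitive_k has_real_derivative density_deriv k x) (at x)"
  by (rule DERIV_param_primitive[where S=I and g="\<lambda>\<kappa>. wave_density \<kappa> (\<phi> \<kappa>)"
        and G="\<lambda>\<kappa> x. (c - \<kappa>\<^sup>2) * wave_primitive (tau c \<kappa>) (wave_q c \<kappa> (\<phi> \<kappa>) x)"])
     (auto intro: novikov_wave.DERIV_wave_primitive_q[OF wave] DERIV_wave_density continuous_on_density_deriv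
        DERIV_k_primitive simp: k_in[simplified])

text \<open>Euler's identity: the density is homogeneous of degree \<open>2\<close> in \<open>(k, \<phi>)\<close>.\<close>

lemma density_deriv_eq:
  "density_deriv k x = momentum variation x * nov_dF k \<mu> x
     - (\<phi> k x * momentum variation x - \<mu> x * variation x) + 2 / k * wave_density k (\<phi> k) x"
proof -
  define m m\<^sub>v p where "m = \<mu> x" and "m\<^sub>v = momentum variation x" and "p = \<phi> k x"
  define A B where "A = k powr (1/3) * m powr (2/3)" and "B = k powr (4/3) * m powr (-1/3)"
  have m_k: "momentum \<phi>\<^sub>k x = m\<^sub>v + m / k"
    using funpow_deriv_momentum_variation[of 0 x] by (simp add: m_def m\<^sub>v_def)
  have "k powr (4/3) = k * k powr (1/3)" using k_pos powr_add[of k 1 "1/3"] by simp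
  moreover have "m powr (-1/3) * m = m powr (2/3)" using mu_pos[of x] powr_add[of m "-1/3" 1] by (simp add: m_def)
  ultimately have B_m: "B * m = k * A" and k_A: "k powr (4/3) * m powr (2/3) = k * A"
    by (simp_all add: A_def B_def)
  have density_deriv: "density_deriv k x
      = (m\<^sub>v + m / k) * p + m * (variation x + p / k) + 4 * k - 4 * A - (2 * B * m\<^sub>v + 2 * B * m / k)"
    unfolding density_deriv_def m_k phi_k_eq m_def[symmetric] p_def[symmetric] A_def B_def
    by (simp add: mult.assoc distrib_left)
  have density: "2 / k * wave_density k (\<phi> k) x = 2 / k * (m * p) + 4 * k - 6 * A"
    unfolding wave_density_eq[OF k_pos] m_def[symmetric] p_def[symmetric] k_A using k_pos
    by (simp add: field_simps power2_eq_square)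
  have dF: "nov_dF k \<mu> x = 2 * p - 2 * B"
    by (simp add: nov_dF_def helmholtz_inv_mu m_def p_def B_def)
  have "2 * B * m / k = 2 * A" using B_m k_pos by (simp add: mult.assoc)
  then show ?thesis
    unfolding density_deriv density dF m_def[symmetric] m\<^sub>v_def[symmetric] p_def[symmetric]
    by (simp add: algebra_simps)
qed

lemma integrable_momentum_variation_dF: "integrable lborel (\<lambda>x. momentum variation x * nov_dF k \<mu> x)"
proof (rule exp_decay_integrable)
  have "decaying_derivs 0 (\<lambda>x. momentum variation x * nov_dF k \<mu> x)"
    using decaying_derivs_momentum_variation[of 0] variation_decay
      decaying_derivs_imp_bounded[OF decaying_derivs_dF]
    by (intro decay_intros) auto
  then show "exp_decay (\<lambda>x. momentum variation x * nov_dF k \<mu> x)" by simp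
  show "continuous_on UNIV (\<lambda>x. momentum variation x * nov_dF k \<mu> x)"
    by (intro continuous_intros continuous_on_dF smooth_continuous_on smooth_momentum smooth_variation)
qed

lemma LINT_momentum_variation_dF:
  "(LINT x|lborel. momentum variation x * nov_dF k \<mu> x)
    = deriv (\<lambda>\<kappa>. nov_F \<kappa> (momentum (\<phi> \<kappa>))) k - 2 / k * nov_F k \<mu>"
proof -
  let ?sym = "\<lambda>x. \<phi> k x * momentum variation x - \<mu> x * variation x"
  note symmetric = LINT_momentum_symmetric[OF smooth_phi bounded_derivs_phi
      smooth_variation decaying_derivs_variation]
  have integrable: "integrable lborel (density_deriv k)"
    unfolding density_deriv_eq[abs_def]
    using integrable_momentum_variation_dF symmetric(1) integrable_wave_density by simp
  have "continuous_on UNIV (\<lambda>y. (\<lambda>(\<kappa>, x). density_deriv \<kappa> x) (k, y))"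
    by (rule continuous_on_compose2[OF continuous_on_density_deriv]) (use k_in in \<open>auto intro!: continuous_intros\<close>)
  then have "continuous_on UNIV (density_deriv k)" by simp
  then have "(LINT x|lborel. density_deriv k x) = primitive_k_limit - - primitive_k_limit"
    by (intro LINT_FTC_real[OF DERIV_primitive_k _ integrable primitive_k_tendsto_top primitive_k_tendsto_bot])
  moreover have "(LINT x|lborel. density_deriv k x)
      = (LINT x|lborel. momentum variation x * nov_dF k \<mu> x) - (LINT x|lborel. ?sym x) + 2 / k * nov_F k \<mu>"
    unfolding density_deriv_eq nov_F_eq_LINT
    using integrable_momentum_variation_dF symmetric(1) integrable_wave_density by simp
  ultimately show ?thesis using symmetric(2) DERIV_imp_deriv[OF DERIV_k_nov_F] by simp
qed

lemma nov_L_preimage_exists: "\<exists>w. nov_L c k \<mu> w (\<lambda>x. complex_of_real (nov_dF k \<mu> x))"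
  using nov_L_lincomb[OF nov_L_momentum_variation nov_L_momentum_variation, of "1 / complex_of_real amplitude" 0]
    amplitude_pos by auto

lemma L2_inner_momentum_variation:
  "L2_inner (\<lambda>x. complex_of_real (momentum variation x)) (\<lambda>x. complex_of_real (nov_dF k \<mu> x))
    = complex_of_real (deriv (\<lambda>\<kappa>. nov_F \<kappa> (momentum (\<phi> \<kappa>))) k - 2 / k * nov_F k \<mu>)"
  unfolding LINT_momentum_variation_dF[symmetric] L2_inner_def by (subst integral_complex_of_real[symmetric]) simp

lemma L2_inner_preimage:
  assumes spec: "spectral_assumption (nov_L c k \<mu>)"
    and w: "nov_L c k \<mu> w (\<lambda>x. complex_of_real (nov_dF k \<mu> x))"
  shows "L2_inner w (\<lambda>x. complex_of_real (nov_dF k \<mu> x))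
    = complex_of_real ((deriv (\<lambda>\<kappa>. nov_F \<kappa> (momentum (\<phi> \<kappa>))) k - 2 / k * nov_F k \<mu>) / amplitude)"
proof -
  let ?A = "complex_of_real amplitude" and ?f = "\<lambda>x. complex_of_real (momentum variation x)"
    and ?\<mu>' = "\<lambda>x. complex_of_real (deriv \<mu> x)"
  have "?A \<noteq> 0" using amplitude_pos by simp
  have L2: "?f \<in> L2" "?\<mu>' \<in> L2" "w \<in> L2"
    using nov_L_momentum_variation nov_L_deriv_mu w by (auto simp: nov_L_def weak_deriv_def)
  have "simple_eigenvalue (nov_L c k \<mu>) 0" using spec by (auto simp: spectral_assumption_def)
  moreover have "nov_L c k \<mu> (\<lambda>x. ?A * w x + - 1 * ?f x) (\<lambda>x. 0 * (?A * w x + - 1 * ?f x))"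
    using nov_L_lincomb[OF w nov_L_momentum_variation, of ?A "- 1"] by simp
  ultimately obtain \<beta> where "AE x in lborel. ?A * w x + - 1 * ?f x = \<beta> * ?\<mu>' x"
    using simple_eigenvalue_eigenvector[of "nov_L c k \<mu>" 0 ?\<mu>'] nov_L_deriv_mu deriv_mu_not_AE_zero by auto
  then have w_eq: "AE x in lborel. w x = 1 / ?A * ?f x + \<beta> / ?A * ?\<mu>' x"
    by eventually_elim (use \<open>?A \<noteq> 0\<close> in \<open>simp add: field_simps\<close>)
  have "w \<in> borel_measurable lborel" using L2(3) by (simp add: L2_def)
  from L2_inner_AE_lincomb[OF L2(1,2) this derivs_upto_zero[OF decaying_derivs_dF] continuous_on_dF w_eq]
  show ?thesis by (simp add: L2_inner_momentum_variation L2_inner_deriv_mu)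
qed

lemma L2_inner_preimage_negative:
  assumes "spectral_assumption (nov_L c k \<mu>)" "deriv (\<lambda>\<kappa>. nov_F \<kappa> (momentum (\<phi> \<kappa>))) k < 0"
    and "nov_L c k \<mu> w (\<lambda>x. complex_of_real (nov_dF k \<mu> x))"
  shows "L2_inner w (\<lambda>x. complex_of_real (nov_dF k \<mu> x)) \<in> \<real>
    \<and> Re (L2_inner w (\<lambda>x. complex_of_real (nov_dF k \<mu> x))) < 0"
proof -
  have "2 / k * nov_F k \<mu> > 0" using nov_F_pos k_pos by simp
  then show ?thesis
    unfolding L2_inner_preimage[OF assms(1,3)] using assms(2) amplitude_pos by (simp add: divide_neg_pos)
qed

end

theorem lemma4p9:
  fixes c :: real and \<phi> :: "real \<Rightarrow> real \<Rightarrow> real"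
  assumes "c > 0"
    and "\<And>k. k \<in> {0<..<sqrt c / 2} \<Longrightarrow> solitary_profile c k (\<phi> k)"
    and "jointly_smooth_on ({0<..<sqrt c / 2} \<times> UNIV) \<phi>"
  shows "(\<forall>k\<in>{0<..<sqrt c / 2}. nov_F k (momentum (\<phi> k)) > 0) \<and>
    (\<forall>k\<in>{0<..<sqrt c / 2}.
       let \<mu> = momentum (\<phi> k);
           L = nov_L c k \<mu>;
           dF = (\<lambda>x. complex_of_real (nov_dF k \<mu> x))
       in spectral_assumption L \<longrightarrow>
          deriv (\<lambda>\<kappa>. nov_F \<kappa> (momentum (\<phi> \<kappa>))) k < 0 \<longrightarrow>
          (\<exists>w. L w dF) \<and>
          (\<forall>w. L w dF \<longrightarrow> L2_inner w dF \<in> \<real> \<and> Re (L2_inner w dF) < 0))"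
  unfolding Let_def
proof (intro conjI ballI impI allI)
  fix k assume "k \<in> {0<..<sqrt c / 2}"
  then interpret novikov_family c k \<phi>
    using assms by unfold_locales auto
  show "nov_F k (momentum (\<phi> k)) > 0" by (rule nov_F_pos)
  show "\<exists>w. nov_L c k (momentum (\<phi> k)) w (\<lambda>x. complex_of_real (nov_dF k (momentum (\<phi> k)) x))"
    by (rule nov_L_preimage_exists)
  fix w
  assume "spectral_assumption (nov_L c k (momentum (\<phi> k)))" "deriv (\<lambda>\<kappa>. nov_F \<kappa> (momentum (\<phi> \<kappa>))) k < 0"
    and "nov_L c k (momentum (\<phi> k)) w (\<lambda>x. complex_of_real (nov_dF k (momentum (\<phi> k)) x))"
  then show "L2_inner w (\<lambda>x. complex_of_real (nov_dF k (momentum (\<phi> k)) x)) \<in> \<real>"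
    "Re (L2_inner w (\<lambda>x. complex_of_real (nov_dF k (momentum (\<phi> k)) x))) < 0"
    using L2_inner_preimage_negative by auto
qed

end
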